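(* Let $G$ be a Cayley graph of a finitely generated countable group with degree of growth $d \ge 5$. Let $H$ be the trace of the two-sided simple random walk on $G$ started at a vertex $o$. If $p < p_c(G)$, then $\mathcal{U}_p(H)$ has infinitely many cut points, $P^{o,o} \otimes \mathbb{P}_p$-a.s.
   Context: Graphs are locally finite, simple and non-oriented. Cayley graph: for a finitely generated countable group $\Gamma$ and a finite symmetric generating set $\mathcal{S}$ not containing the unit element, the Cayley graph has vertex set $\Gamma$ and edge set $\{\{x,y\} : x^{-1}y \in \mathcal{S}\}$. A graph $G$ has degree of growth $d \in (0,\infty)$ if for every vertex $x$, $0 < \liminf_{n\to\infty} |B_G(x,n)|/n^d \le \limsup_{n\to\infty} |B_G(x,n)|/n^d < \infty$, where $B_G(x,n)$ is the ball of radius $n$ about $x$ in the graph distance. $P^{x,y}$ is the law of two independent simple random walks $S^1, S^2$ on $G$ started at $x$ and $y$. The two-sided simple random walk started at $o$ is $\widetilde S_n = S^1_n$ for $n \ge 0$ and $\widetilde S_n = S^2_{-n}$ for $n<0$, under $P^{o,o}$; its trace is the random subgraph formed by the vertices visited and the edges traversed. Bernoulli bond percolation: $\mathbb{P}_p$ is the product measure on $\{0,1\}^{E(G)}$ under which each edge is open with probability $p$ independently. $C_x$ is the open cluster containing $x$. $p_c(G) := \inf\{p : \mathbb{P}_p(|C_x| = +\infty) > 0\}$ (independent of $x$). Enlargement: for a subgraph $H$ of $G$, $\mathcal{U}_p(H)$ is the random subgraph with $V(\mathcal{U}_p(H)) = \bigcup_{x \in V(H)} V(C_x)$ and $E(\mathcal{U}_p(H))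 = E(H) \cup \bigcup_{x \in V(H)} E(C_x)$. Cut point: a vertex $x$ of a graph is a cut point if there is an edge $e$ containing $x$ such that removing $e$ (as an edge) splits the graph into two infinite connected components. *)

theory Defs
  imports "HOL-Probability.Probability" "HOL-Algebra.Generated_Groups"
begin

section \<open>Graphs\<close>

text \<open>Edges are unordered pairs, represented as two-element sets of vertices.\<close>

record 'a graph =
  verts :: "'a set"
  edges :: "'a set set"

definition nbrs :: "'a graph \<Rightarrow> 'a \<Rightarrow> 'a set" where
  "nbrs G x = {y. {x, y} \<in> edges G}"

definition walk :: "'a graph \<Rightarrow> 'a \<Rightarrow> 'a list \<Rightarrow> 'a \<Rightarrow> bool" where
  "walk G x ws y \<longleftrightarrow> ws \<noteq> [] \<and> hd ws = x \<and> last ws = y \<and> set ws \<subseteq> verts G \<and>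
     successively (\<lambda>u v. {u, v} \<in> edges G) ws"

text \<open>The graph distance is infinite between different connected components
  (infimum of the empty set in \<^typ>\<open>enat\<close>).\<close>

definition graph_dist :: "'a graph \<Rightarrow> 'a \<Rightarrow> 'a \<Rightarrow> enat" where
  "graph_dist G x y = (INF ws\<in>{ws. walk G x ws y}. enat (length ws - 1))"

definition graph_ball :: "'a graph \<Rightarrow> 'a \<Rightarrow> nat \<Rightarrow> 'a set" where
  "graph_ball G x n = {y \<in> verts G. graph_dist G x y \<le> enat n}"

definition degree_of_growth :: "'a graph \<Rightarrow> real \<Rightarrow> bool" where
  "degree_of_growth G d \<longleftrightarrow> 0 < d \<and>
     (\<forall>x\<in>verts G.
        0 < liminf (\<lambda>n. ereal (real (card (graph_ball G x n)) / real n powr d)) \<and>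
        limsup (\<lambda>n. ereal (real (card (graph_ball G x n)) / real n powr d)) < \<infinity>)"

definition component :: "'a graph \<Rightarrow> 'a \<Rightarrow> 'a set" where
  "component G x = {y. \<exists>ws. walk G x ws y}"

definition components :: "'a graph \<Rightarrow> 'a set set" where
  "components G = component G ` verts G"

definition remove_edge :: "'a graph \<Rightarrow> 'a set \<Rightarrow> 'a graph" where
  "remove_edge G e = G\<lparr>edges := edges G - {e}\<rparr>"

definition cut_point :: "'a graph \<Rightarrow> 'a \<Rightarrow> bool" where
  "cut_point G x \<longleftrightarrow> x \<in> verts G \<and>
     (\<exists>e\<in>edges G. x \<in> e \<and>
        (\<exists>A B. A \<noteq> B \<and> components (remove_edge G e) = {A, B} \<and> infinite A \<and> infinite B))"

definition cayley_graph :: "('a, 'b) monoid_scheme \<Rightarrow> 'a set \<Rightarrow> 'a graph" where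
  "cayley_graph \<Gamma> S =
     \<lparr>verts = carrier \<Gamma>,
      edges = {{x, y} | x y. x \<in> carrier \<Gamma> \<and> y \<in> carrier \<Gamma> \<and> inv\<^bsub>\<Gamma>\<^esub> x \<otimes>\<^bsub>\<Gamma>\<^esub> y \<in> S}\<rparr>"

section \<open>Simple random walk\<close>

text \<open>The law of the walk on trajectories is the Ionescu-Tulcea measure of the kernels below:
  the kernel for time \<open>n\<close> gives the law of the position at time \<open>n\<close>, given the positions at
  the times before \<open>n\<close>. The state space is the whole type because \<^const>\<open>measure_pmf\<close> lives on
  it; the lemma \<open>emeasure_srw_law_cylinder\<close> gives the finite-dimensional distributions.\<close>

definition srw_kernel :: "'a graph \<Rightarrow> 'a \<Rightarrow> nat \<Rightarrow> (nat \<Rightarrow> 'a) \<Rightarrow> 'a measure" where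
  "srw_kernel G x n \<omega> =
     measure_pmf (if n = 0 then return_pmf x else pmf_of_set (nbrs G (\<omega> (n - 1))))"

definition srw_law :: "'a graph \<Rightarrow> 'a \<Rightarrow> (nat \<Rightarrow> 'a) measure" where
  "srw_law G x =
     projective_family.lim UNIV
       (Ionescu_Tulcea.CI (srw_kernel G x) (\<lambda>_. count_space UNIV)) (\<lambda>_. count_space UNIV)"

definition two_srw_law :: "'a graph \<Rightarrow> 'a \<Rightarrow> 'a \<Rightarrow> ((nat \<Rightarrow> 'a) \<times> (nat \<Rightarrow> 'a)) measure" where
  "two_srw_law G x y = srw_law G x \<Otimes>\<^sub>M srw_law G y"

definition two_sided :: "(nat \<Rightarrow> 'a) \<Rightarrow> (nat \<Rightarrow> 'a) \<Rightarrow> int \<Rightarrow> 'a" where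
  "two_sided s1 s2 n = (if n \<ge> 0 then s1 (nat n) else s2 (nat (- n)))"

definition walk_trace :: "(int \<Rightarrow> 'a) \<Rightarrow> 'a graph" where
  "walk_trace s = \<lparr>verts = range s, edges = {{s n, s (n + 1)} | n. True}\<rparr>"

section \<open>Bernoulli bond percolation\<close>

definition percolation :: "'a graph \<Rightarrow> real \<Rightarrow> ('a set \<Rightarrow> bool) measure" where
  "percolation G p = (\<Pi>\<^sub>M e\<in>edges G. measure_pmf (bernoulli_pmf p))"

definition open_graph :: "'a graph \<Rightarrow> ('a set \<Rightarrow> bool) \<Rightarrow> 'a graph" where
  "open_graph G \<omega> = \<lparr>verts = verts G, edges = {e \<in> edges G. \<omega> e}\<rparr>"

definition cluster :: "'a graph \<Rightarrow> ('a set \<Rightarrow> bool) \<Rightarrow> 'a \<Rightarrow> 'a graph" where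
  "cluster G \<omega> x =
     \<lparr>verts = component (open_graph G \<omega>) x,
      edges = {e \<in> edges (open_graph G \<omega>). e \<subseteq> component (open_graph G \<omega>) x}\<rparr>"

text \<open>On the connected graphs considered here the value does not depend on the vertex \<open>x\<close>.\<close>

definition critical_prob :: "'a graph \<Rightarrow> 'a \<Rightarrow> real" where
  "critical_prob G x =
     Inf {p \<in> {0..1}. \<P>(\<omega> in percolation G p. infinite (verts (cluster G \<omega> x))) > 0}"

definition enlargement :: "'a graph \<Rightarrow> ('a set \<Rightarrow> bool) \<Rightarrow> 'a graph \<Rightarrow> 'a graph" where
  "enlargement G \<omega> H =
     \<lparr>verts = (\<Union>x\<in>verts H. verts (cluster G \<omega> x)),
      edges = edges H \<union> (\<Union>x\<in>verts H. edges (cluster G \<omega> x))\<rparr>"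

section \<open>Finite-dimensional distributions of the walk\<close>

lemma Ionescu_Tulcea_srw: "Ionescu_Tulcea (srw_kernel G x) (\<lambda>_. count_space UNIV)"
proof (rule Ionescu_Tulcea.intro)
  fix n :: nat
  have m: "(\<lambda>\<omega>. measure_pmf (pmf_of_set (nbrs G (\<omega> (n - 1)))))
      \<in> measurable (\<Pi>\<^sub>M i\<in>{0..<n}. count_space UNIV) (subprob_algebra (count_space UNIV))"
    if "n \<noteq> 0"
  proof -
    have "(\<lambda>\<omega>. \<omega> (n - 1)) \<in> measurable (\<Pi>\<^sub>M i\<in>{0..<n}. count_space UNIV) (count_space UNIV)"
      using that by (intro measurable_component_singleton) auto
    moreover have "(\<lambda>y. measure_pmf (pmf_of_set (nbrs G y)))
        \<in> measurable (count_space UNIV) (subprob_algebra (count_space UNIV))"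
      by (simp add: space_subprob_algebra measure_pmf.subprob_space_axioms)
    ultimately show ?thesis
      by (rule measurable_compose)
  qed
  show "srw_kernel G x n
      \<in> measurable (\<Pi>\<^sub>M i\<in>{0..<n}. count_space UNIV) (subprob_algebra (count_space UNIV))"
    by (cases "n = 0") (auto simp: srw_kernel_def[abs_def] m space_subprob_algebra measure_pmf.subprob_space_axioms)
qed (simp add: srw_kernel_def measure_pmf.prob_space_axioms)

lemma prob_space_srw_law: "prob_space (srw_law G x)"
proof -
  interpret Ionescu_Tulcea "srw_kernel G x" "\<lambda>_. count_space UNIV"
    by (rule Ionescu_Tulcea_srw)
  have sp: "prod_emb UNIV (\<lambda>_. count_space UNIV) {} {\<lambda>_. undefined} = (UNIV :: (nat \<Rightarrow> 'a) set)"
    by (auto simp: prod_emb_def restrict_def)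
  have "emeasure (srw_law G x) (space (srw_law G x)) = 1"
    using lim[of "{}" "{\<lambda>_. undefined}"] prob_space.emeasure_space_1[OF PF.prob_space_P[of "{}"]]
    by (simp add: srw_law_def sp PF.space_lim space_PiM PF.space_P sets_PiM_empty)
  then show ?thesis by (rule prob_spaceI)
qed

lemma emeasure_srw_law_cylinder:
  "emeasure (srw_law G x) {s. \<forall>i\<le>n. s i = w i} =
     (if w 0 = x then 1 else 0) * (\<Prod>i<n. ennreal (pmf (pmf_of_set (nbrs G (w i))) (w (Suc i))))"
proof -
  interpret Ionescu_Tulcea "srw_kernel G x" "\<lambda>_. count_space UNIV"
    by (rule Ionescu_Tulcea_srw)
  let ?M = "\<lambda>_. count_space UNIV :: 'a measure"
  have single: "{restrict w {0..<m}} \<in> sets (Pi\<^sub>M {0..<m} ?M)" for m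
  proof -
    have "(\<Pi>\<^sub>E i\<in>{0..<m}. {w i}) \<in> sets (Pi\<^sub>M {0..<m} ?M)"
      by (intro sets_PiM_I_finite) auto
    moreover have "(\<Pi>\<^sub>E i\<in>{0..<m}. {w i}) = {restrict w {0..<m}}"
      by (auto simp: PiE_iff extensional_def restrict_def fun_eq_iff)
    ultimately show ?thesis by simp
  qed
  have C: "emeasure (C 0 m (\<lambda>_. undefined)) {restrict w {0..<m}} =
      (\<Prod>i<m. emeasure (srw_kernel G x i w) {w i})" for m
  proof (induction m)
    case 0
    then show ?case
      by (auto simp: space_PiM sets_PiM_empty restrict_def)
  next
    case (Suc m)
    have sp: "(\<lambda>_. undefined) \<in> space (Pi\<^sub>M {0..<0} ?M)"
      by (simp add: space_PiM PiE_iff extensional_def)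
    have step: "emeasure (eP m \<omega>) {restrict w {0..<Suc m}} =
        emeasure (srw_kernel G x m w) {w m} * indicator {restrict w {0..<m}} \<omega>"
      if \<omega>: "\<omega> \<in> space (Pi\<^sub>M {0..<m} ?M)" for \<omega>
    proof -
      have ext: "\<omega> \<in> extensional {0..<m}"
        using \<omega> by (auto simp: space_PiM PiE_def)
      have upd: "fun_upd \<omega> m y = restrict w {0..<Suc m} \<longleftrightarrow> \<omega> = restrict w {0..<m} \<and> y = w m" for y
      proof
        assume h: "fun_upd \<omega> m y = restrict w {0..<Suc m}"
        have "\<omega> i = restrict w {0..<m} i" for i
          using fun_cong[OF h, of i] ext by (cases "i < m") (auto simp: extensional_def split: if_splits)
        then show "\<omega> = restrict w {0..<m} \<and> y = w m"
          using fun_cong[OF h, of m] by auto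
      next
        assume "\<omega> = restrict w {0..<m} \<and> y = w m"
        then show "fun_upd \<omega> m y = restrict w {0..<Suc m}"
          by (auto simp: fun_eq_iff restrict_def less_Suc_eq)
      qed
      have "emeasure (eP m \<omega>) {restrict w {0..<Suc m}} =
          emeasure (srw_kernel G x m \<omega>) {y. fun_upd \<omega> m y = restrict w {0..<Suc m}}"
        using emeasure_eP[OF \<omega> single[of "Suc m"]] by (simp add: vimage_def)
      also have "\<dots> = emeasure (srw_kernel G x m w) {w m} * indicator {restrict w {0..<m}} \<omega>"
      proof (cases "\<omega> = restrict w {0..<m}")
        case True
        then have "{y. fun_upd \<omega> m y = restrict w {0..<Suc m}} = {w m}"
          using upd by blast
        moreover have "srw_kernel G x m \<omega> = srw_kernel G x m w"
          using True by (simp add: srw_kernel_def)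
        ultimately show ?thesis
          using True by (simp only:) simp
      qed (simp add: upd)
      finally show ?thesis .
    qed
    have m0: "C 0 m (\<lambda>_. undefined) \<in> space (subprob_algebra (Pi\<^sub>M {0..<m} ?M))"
      using measurable_space[OF measurable_C[of 0 m] sp] by simp
    have "emeasure (C 0 (Suc m) (\<lambda>_. undefined)) {restrict w {0..<Suc m}} =
        (\<integral>\<^sup>+\<omega>. emeasure (eP m \<omega>) {restrict w {0..<Suc m}} \<partial>C 0 m (\<lambda>_. undefined))"
      using prob_space.not_empty[OF prob_space_C[OF sp, of m]] measurable_eP[of m] sets_C[OF sp, of m]
      by (simp del: PiM_empty, intro emeasure_bind[OF _ _ single[of "Suc m"]])
         (simp_all cong: measurable_cong_sets)
    also have "\<dots> = (\<integral>\<^sup>+\<omega>. emeasure (srw_kernel G x m w) {w m} * indicator {restrict w {0..<m}} \<omega>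
        \<partial>C 0 m (\<lambda>_. undefined))"
      using space_C[OF sp, of m] by (intro nn_integral_cong step) simp
    also have "\<dots> = emeasure (srw_kernel G x m w) {w m} * emeasure (C 0 m (\<lambda>_. undefined)) {restrict w {0..<m}}"
      using single[of m] sets_C[OF sp, of m] by (intro nn_integral_cmult_indicator) simp
    finally show ?case
      by (simp only: Suc.IH prod.lessThan_Suc mult.commute)
  qed
  have "emeasure (srw_law G x) {s. \<forall>i\<le>n. s i = w i} =
      emeasure PF.lim (PF.emb UNIV {0..<Suc n} {restrict w {0..<Suc n}})"
    unfolding srw_law_def
    by (intro arg_cong2[where f=emeasure] refl)
       (auto simp: prod_emb_def space_PiM restrict_def fun_eq_iff less_Suc_eq_le, meson)
  also have "\<dots> = emeasure (C 0 (Suc n) (\<lambda>_. undefined)) {restrict w {0..<Suc n}}"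
    using single[of "Suc n"] 
    by (subst lim, simp, simp) (subst emeasure_CI[of _ "Suc n"], auto simp: prod_emb_id dest: sets.sets_into_space)
  also have "\<dots> = (\<Prod>i<Suc n. emeasure (srw_kernel G x i w) {w i})"
    by (rule C)
  also have "\<dots> = (if w 0 = x then 1 else 0) *
      (\<Prod>i<n. ennreal (pmf (pmf_of_set (nbrs G (w i))) (w (Suc i))))"
    by (subst prod.lessThan_Suc_shift) (auto simp: srw_kernel_def emeasure_pmf_single indicator_def)
  finally show ?thesis .
qed

end

theory Submission
  imports Defs
begin

text \<open>Call an integer \<open>n\<close> a cut time if no vertex visited up to time \<open>n\<close> is joined by open edges to a vertex
visited after time \<open>n\<close>. At a cut time the edge traversed between \<open>n\<close> and \<open>n + 1\<close> is a bridge of the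
enlarged trace: its removal separates the clusters met by the past from those met by the future.
Positions at two different cut times are different vertices, so infinitely many cut times in both
time directions make both sides infinite and give infinitely many cut points
(\<open>infinitely_many_cut_points\<close>). It remains to find infinitely many cut times almost surely.

Two estimates make links between the past and the future rare. Below the critical probability the
expected cluster size is finite (\<open>subcritical_susceptibility\<close>); this is the argument of
Duminil-Copin and Tassion. If \<open>\<phi>\<close>, the expected number of open exits of some finite set reachable from
the starting vertex within the set, is below \<open>1\<close>, then exploring clusters set by set bounds the cluster size
by a geometric series. If \<open>\<phi> \<ge> 1\<close> for all finite sets, raising \<open>p\<close> by any amount connects the
starting vertex to far distances with a probability bounded below, so \<open>p\<close> is not subcritical. Secondly, volume growth of
order at least five forces the heat kernel at time \<open>n\<close> below \<open>b n\<close> with \<open>(n + 1) * b n\<close> summable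
(\<open>heat_kernel_decay\<close>), through a Nash-type inequality for the \<open>l\<^sup>2\<close> norm of the kernel. Together they bound the probability
that two positions \<open>n\<close> steps apart lie in one cluster by a multiple of \<open>b n\<close>. There are \<open>n + 1\<close>
ways to place such a pair around time \<open>0\<close>, so by summability the far past and the far future are unlinked with
positive probability (\<open>no_far_links\<close>).

On that event, close all edges around the middle part of the walk and splice the walk: follow the
past up to its last contact with the middle part before the first contact of the middle part with
the future, run along the middle part, and continue with the future. Time \<open>0\<close> is a cut time of the
spliced walk. The spliced walk uses pairwise different increments of the original one, so it has
the same law, and \<open>0\<close> is a cut time with positive probability (\<open>cut_positive_probability\<close>).

Finally, cut times are approximated from outside by events that depend on finitely many increments and
on the edges near the current position. Two such events at distant times are nearly independent,
since the walk is unlikely to be close to where it was; a second-moment argument then yields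
infinitely many cut times (\<open>infinitely_many_cuts\<close>).\<close>

section \<open>Product measures and a second-moment criterion\<close>

text \<open>Measurability with respect to a set of coordinates, expressed pointwise on the space of a product
measure. This form is closed under all logical operations and easy to check for combinatorial events.\<close>

definition depends_on :: "('i \<Rightarrow> 'c) measure \<Rightarrow> 'i set \<Rightarrow> (('i \<Rightarrow> 'c) \<Rightarrow> 'd) \<Rightarrow> bool" where
  "depends_on N J f \<longleftrightarrow>
     (\<forall>\<omega>\<in>space N. \<forall>\<omega>'\<in>space N. (\<forall>i\<in>J. \<omega> i = \<omega>' i) \<longrightarrow> f \<omega> = f \<omega>')"

lemma depends_onI:
  assumes "\<And>\<omega> \<omega>'. \<omega> \<in> space N \<Longrightarrow> \<omega>' \<in> space N \<Longrightarrow> (\<And>i. i \<in> J \<Longrightarrow> \<omega> i = \<omega>' i) \<Longrightarrow> f \<omega> = f \<omega>'"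
  shows "depends_on N J f"
  unfolding depends_on_def using assms by blast

lemma depends_onD:
  "depends_on N J f \<Longrightarrow> \<omega> \<in> space N \<Longrightarrow> \<omega>' \<in> space N \<Longrightarrow> (\<And>i. i \<in> J \<Longrightarrow> \<omega> i = \<omega>' i) \<Longrightarrow> f \<omega> = f \<omega>'"
  unfolding depends_on_def by blast

lemma depends_on_mono: "depends_on N J f \<Longrightarrow> J \<subseteq> K \<Longrightarrow> depends_on N K f"
  unfolding depends_on_def by blast

lemma depends_on_compose: "depends_on N J f \<Longrightarrow> depends_on N J (\<lambda>\<omega>. h (f \<omega>))"
  unfolding depends_on_def by metis

lemma depends_on_compose2:
  "depends_on N J f \<Longrightarrow> depends_on N J g \<Longrightarrow> depends_on N J (\<lambda>\<omega>. h (f \<omega>) (g \<omega>))"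
  unfolding depends_on_def by metis

text \<open>The restrictions of the sample to two disjoint index sets are independent, and each function factors
through one of them: filling the missing coordinates from a fixed sample point reconstructs an
argument with the same value.\<close>

lemma PiM_indep_functions:
  fixes f g :: "('i \<Rightarrow> 'c) \<Rightarrow> real"
  assumes M: "\<And>i. i \<in> I \<Longrightarrow> prob_space (M i)"
    and J: "J \<subseteq> I" "K \<subseteq> I" "J \<inter> K = {}"
    and f: "f \<in> borel_measurable (PiM I M)" "depends_on (PiM I M) J f" "\<And>\<omega>. \<omega> \<in> space (PiM I M) \<Longrightarrow> \<bar>f \<omega>\<bar> \<le> B"
    and g: "g \<in> borel_measurable (PiM I M)" "depends_on (PiM I M) K g" "\<And>\<omega>. \<omega> \<in> space (PiM I M) \<Longrightarrow> \<bar>g \<omega>\<bar> \<le> B"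
  shows "(\<integral>\<omega>. f \<omega> * g \<omega> \<partial>PiM I M) = (\<integral>\<omega>. f \<omega> \<partial>PiM I M) * (\<integral>\<omega>. g \<omega> \<partial>PiM I M)"
proof -
  let ?N = "PiM I M"
  interpret N: prob_space ?N by (rule prob_space_PiM) (rule M)
  obtain a where a: "a \<in> space ?N" using N.not_empty by blast
  show ?thesis
  proof (cases "I = {}")
    case True
    have "f \<omega> = f a" "g \<omega> = g a" if "\<omega> \<in> space ?N" for \<omega>
      using that a True by (auto simp: space_PiM)
    then have "(\<integral>\<omega>. f \<omega> * g \<omega> \<partial>?N) = (\<integral>\<omega>. f a * g a \<partial>?N)" "(\<integral>\<omega>. f \<omega> \<partial>?N) = (\<integral>\<omega>. f a \<partial>?N)"
      "(\<integral>\<omega>. g \<omega> \<partial>?N) = (\<integral>\<omega>. g a \<partial>?N)"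
      by (intro Bochner_Integration.integral_cong refl; metis)+
    then show ?thesis by (simp add: N.prob_space)
  next
    case False
    have iv: "N.indep_vars M (\<lambda>i \<omega>. \<omega> i) I"
    proof (subst N.indep_vars_iff_distr_eq_PiM'[OF False])
      show "(\<lambda>\<omega>. \<omega> i) \<in> measurable ?N (M i)" if "i \<in> I" for i
        using that by (rule measurable_component_singleton)
      have "distr ?N ?N (\<lambda>x. \<lambda>i\<in>I. x i) = distr ?N ?N (\<lambda>x. x)"
        by (intro distr_cong) (auto simp: space_PiM PiE_def extensional_restrict)
      also have "\<dots> = ?N" by (rule distr_id)
      also have "\<dots> = Pi\<^sub>M I (\<lambda>i. distr ?N (M i) (\<lambda>\<omega>. \<omega> i))"
        by (intro PiM_cong refl distr_PiM_component[symmetric] M)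
      finally show "distr ?N ?N (\<lambda>x. \<lambda>i\<in>I. x i) = Pi\<^sub>M I (\<lambda>i. distr ?N (M i) (\<lambda>\<omega>. \<omega> i))" .
    qed
    define ext where "ext L \<eta> = (\<lambda>i\<in>I. if i \<in> L then \<eta> i else a i)" for L :: "'i set" and \<eta> :: "'i \<Rightarrow> 'c"
    have ext_meas: "ext L \<in> measurable (PiM L M) ?N" if "L \<subseteq> I" for L
      unfolding ext_def
    proof (rule measurable_restrict)
      fix i assume i: "i \<in> I"
      show "(\<lambda>\<eta>. if i \<in> L then \<eta> i else a i) \<in> measurable (PiM L M) (M i)"
        using i a by (cases "i \<in> L") (auto simp: space_PiM PiE_iff intro!: measurable_const)
    qed
    have ext_space: "ext L (restrict (\<lambda>i. \<omega> i) L) \<in> space ?N" if "L \<subseteq> I" "\<omega> \<in> space ?N" for L \<omega>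
      using that a by (auto simp: ext_def space_PiM PiE_iff)
    have fe: "f \<omega> = f (ext J (restrict (\<lambda>i. \<omega> i) J))" if "\<omega> \<in> space ?N" for \<omega>
      using J by (intro depends_onD[OF f(2) that ext_space[OF J(1) that]]) (auto simp: ext_def)
    have ge: "g \<omega> = g (ext K (restrict (\<lambda>i. \<omega> i) K))" if "\<omega> \<in> space ?N" for \<omega>
      using J by (intro depends_onD[OF g(2) that ext_space[OF J(2) that]]) (auto simp: ext_def)
    have "N.indep_var borel ((f \<circ> ext J) \<circ> (\<lambda>\<omega>. restrict (\<lambda>i. \<omega> i) J)) borel ((g \<circ> ext K) \<circ> (\<lambda>\<omega>. restrict (\<lambda>i. \<omega> i) K))"
      using J by (intro N.indep_var_compose[OF N.indep_var_restrict[OF iv]]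
          measurable_comp[OF ext_meas f(1)] measurable_comp[OF ext_meas g(1)]) auto
    then have ind: "N.indep_var borel f borel g"
      unfolding N.indep_var_eq
      apply (simp add: f(1) g(1) comp_def)
      apply (elim conjE)
      subgoal premises p
      proof -
        have "(\<lambda>x. f (ext J (\<lambda>i\<in>J. x i))) -` A \<inter> space ?N = f -` A \<inter> space ?N" for A using fe by auto
        moreover have "(\<lambda>x. g (ext K (\<lambda>i\<in>K. x i))) -` A \<inter> space ?N = g -` A \<inter> space ?N" for A using ge by auto
        ultimately show ?thesis using p by simp
      qed
      done
    have "integrable ?N f" "integrable ?N g"
      using f(1,3) g(1,3) by (intro N.integrable_const_bound[where B=B] AE_I2; simp)+
    then show ?thesis
      by (intro N.indep_var_lebesgue_integral ind)
  qed
qed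

lemma PiM_indep_events:
  assumes M: "\<And>i. i \<in> I \<Longrightarrow> prob_space (M i)"
    and J: "J \<subseteq> I" "K \<subseteq> I" "J \<inter> K = {}"
    and P: "{\<omega>\<in>space (PiM I M). P \<omega>} \<in> sets (PiM I M)" "depends_on (PiM I M) J P"
    and Q: "{\<omega>\<in>space (PiM I M). Q \<omega>} \<in> sets (PiM I M)" "depends_on (PiM I M) K Q"
  shows "measure (PiM I M) {\<omega>\<in>space (PiM I M). P \<omega> \<and> Q \<omega>} =
    measure (PiM I M) {\<omega>\<in>space (PiM I M). P \<omega>} * measure (PiM I M) {\<omega>\<in>space (PiM I M). Q \<omega>}"
proof -
  let ?N = "PiM I M"
  let ?A = "{\<omega>\<in>space ?N. P \<omega>}" and ?B = "{\<omega>\<in>space ?N. Q \<omega>}"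
  interpret N: prob_space ?N by (rule prob_space_PiM) (rule M)
  have dep: "depends_on ?N L (indicator {\<omega>\<in>space ?N. R \<omega>} :: _ \<Rightarrow> real)" if "depends_on ?N L R" for L R
  proof (rule depends_onI)
    fix \<omega> \<omega>' assume *: "\<omega> \<in> space ?N" "\<omega>' \<in> space ?N" "\<And>i. i \<in> L \<Longrightarrow> \<omega> i = \<omega>' i"
    have "R \<omega> = R \<omega>'" using depends_onD[OF that *] .
    then show "indicator {\<omega>\<in>space ?N. R \<omega>} \<omega> = (indicator {\<omega>\<in>space ?N. R \<omega>} \<omega>' :: real)"
      using *(1,2) by (simp add: indicator_def)
  qed
  have "(\<integral>\<omega>. (indicator ?A \<omega> :: real) * indicator ?B \<omega> \<partial>?N) = (\<integral>\<omega>. (indicator ?A \<omega> :: real) \<partial>?N) * (\<integral>\<omega>. (indicator ?B \<omega> :: real) \<partial>?N)"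
    by (rule PiM_indep_functions[OF M J borel_measurable_indicator[OF P(1)] dep[OF P(2)] _ borel_measurable_indicator[OF Q(1)] dep[OF Q(2)], where B=1])
       (simp_all add: indicator_def)
  moreover have "(\<lambda>\<omega>. indicator ?A \<omega> * indicator ?B \<omega> :: real) = indicator {\<omega>\<in>space ?N. P \<omega> \<and> Q \<omega>}"
    by (auto simp: indicator_def)
  moreover have "{\<omega>\<in>space ?N. P \<omega> \<and> Q \<omega>} \<inter> space ?N = {\<omega>\<in>space ?N. P \<omega> \<and> Q \<omega>}"
    "?A \<inter> space ?N = ?A" "?B \<inter> space ?N = ?B" by blast+
  ultimately show ?thesis by (simp only: Bochner_Integration.integral_indicator)
qed

text \<open>Finitely many coordinates with finitely many values split the space into finitely many cylinders,
and the function is constant on each.\<close>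

lemma measurable_depends_on_finite:
  fixes f :: "('i \<Rightarrow> 'c) \<Rightarrow> 'd"
  assumes fin: "\<And>i. i \<in> J \<Longrightarrow> finite (space (M i))" "\<And>i. i \<in> J \<Longrightarrow> sets (M i) = Pow (space (M i))"
    and J: "J \<subseteq> I" "finite J" and f: "depends_on (PiM I M) J f"
  shows "f \<in> measurable (PiM I M) (count_space UNIV)"
proof (rule measurableI)
  fix A :: "'d set"
  let ?N = "PiM I M"
  let ?G = "{g \<in> (\<Pi>\<^sub>E i\<in>J. space (M i)). \<exists>\<omega>\<in>space ?N. restrict \<omega> J = g \<and> f \<omega> \<in> A}"
  have "f -` A \<inter> space ?N = (\<Union>g\<in>?G. {\<omega>\<in>space ?N. \<forall>i\<in>J. \<omega> i \<in> {g i}})" (is "?L = ?R")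
  proof
    show "?L \<subseteq> ?R"
    proof
      fix \<omega> assume \<omega>: "\<omega> \<in> ?L"
      have "restrict \<omega> J \<in> (\<Pi>\<^sub>E i\<in>J. space (M i))" using \<omega> J by (auto simp: space_PiM PiE_iff)
      then have "restrict \<omega> J \<in> ?G" using \<omega> by blast
      moreover have "\<forall>i\<in>J. \<omega> i \<in> {restrict \<omega> J i}" by simp
      ultimately show "\<omega> \<in> ?R" using \<omega> by blast
    qed
    show "?R \<subseteq> ?L"
    proof
      fix \<omega> assume "\<omega> \<in> ?R"
      then obtain \<omega>' where *: "\<omega> \<in> space ?N" "\<omega>' \<in> space ?N" "f \<omega>' \<in> A" "\<forall>i\<in>J. \<omega> i = \<omega>' i"
        by auto
      then have "f \<omega> = f \<omega>'" by (intro depends_onD[OF f]) auto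
      then show "\<omega> \<in> ?L" using * by auto
    qed
  qed
  moreover have "?R \<in> sets ?N"
  proof (intro sets.finite_UN)
    show "finite ?G"
      by (rule finite_subset[OF _ finite_PiE[OF J(2) fin(1)]]) auto
    fix g assume g: "g \<in> ?G"
    show "{\<omega>\<in>space ?N. \<forall>i\<in>J. \<omega> i \<in> {g i}} \<in> sets ?N"
      using J fin g by (intro sets.sets_Collect_finite_All sets_Collect_single') (auto simp: PiE_iff)
  qed
  ultimately show "f -` A \<inter> space ?N \<in> sets ?N" by simp
qed auto

text \<open>Chebyshev's inequality replaces a zero-one law: among \<open>K\<close> widely spaced events the number that occur has mean
\<open>K r\<close> and, by asymptotic pairwise independence, variance \<open>o(K\<^sup>2)\<close>, so it is zero only with
vanishing probability.\<close>

lemma infinitely_often_by_second_moment: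
  fixes D :: "nat \<Rightarrow> 'a \<Rightarrow> bool" and r :: real
  assumes M: "prob_space M" and meas: "\<And>n. {x\<in>space M. D n x} \<in> sets M"
    and r: "r > 0" "\<And>n. measure M {x\<in>space M. D n x} = r"
    and mix: "\<And>e. e > 0 \<Longrightarrow> \<exists>W. \<forall>n m. n + W < m \<longrightarrow>
      measure M {x\<in>space M. D n x \<and> D m x} \<le> r\<^sup>2 + e"
  shows "AE x in M. infinite {n. D n x}"
proof -
  interpret prob_space M by (rule M)
  have zero: "measure M {x\<in>space M. \<forall>n\<ge>j. \<not> D n x} = 0" for j
  proof -
    let ?F = "{x\<in>space M. \<forall>n\<ge>j. \<not> D n x}"
    have Fm: "?F \<in> sets M"
      using meas by (intro sets.sets_Collect_countable_All sets.sets_Collect_imp sets.sets_Collect_const sets.sets_Collect_neg) auto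
    define F where "F = ?F"
    note Fm = Fm[folded F_def]
    have bound: "measure M F \<le> e" if e: "e > 0" for e
    proof -
      define e' where "e' = e * r\<^sup>2 / 2"
      have e': "e' > 0" using e r by (simp add: e'_def)
      obtain W where W: "\<And>n m. n + W < m \<Longrightarrow> measure M {x\<in>space M. D n x \<and> D m x} \<le> r\<^sup>2 + e'"
        using mix[OF e'] by blast
      obtain K :: nat where K: "K > 0" "1 / real K < e'"
        using e' by (metis nat_approx_posE of_nat_0_less_iff zero_less_Suc)
      \<comment> \<open>Indices beyond \<open>j\<close>, spaced by more than \<open>W\<close>.\<close>
      define t where "t i = j + i * (W + 1)" for i
      define X where "X i x = (indicator {x\<in>space M. D (t i) x} x :: real)" for i x
      have double_perc[measurable]: "X i \<in> borel_measurable M" for i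
        unfolding X_def using meas by auto
      have Xb: "\<bar>X i x\<bar> \<le> 1" for i x by (auto simp: X_def indicator_def)
      have Xint: "integrable M (X i)" for i
        using Xb by (intro integrable_const_bound[where B=1]) auto
      have XXint: "integrable M (\<lambda>x. X i x * X k x)" for i k
      proof (rule integrable_const_bound[where B=1])
        show "AE x in M. norm (X i x * X k x) \<le> 1" by (auto simp: X_def indicator_def)
      qed measurable
      have EX: "(\<integral>x. X i x \<partial>M) = r" for i
        unfolding X_def using meas r by simp
      have EXX: "(\<integral>x. X i x * X k x \<partial>M) = measure M {x\<in>space M. D (t i) x \<and> D (t k) x}" for i k
      proof -
        have 1: "(\<lambda>x. X i x * X k x) = indicator ({x\<in>space M. D (t i) x} \<inter> {x\<in>space M. D (t k) x})"
          by (auto simp: X_def indicator_def)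
        have 2: "{x\<in>space M. D (t i) x} \<inter> {x\<in>space M. D (t k) x} = {x\<in>space M. D (t i) x \<and> D (t k) x}"
          by blast
        have "{x\<in>space M. D (t i) x} \<inter> {x\<in>space M. D (t k) x} \<in> sets M"
          using meas by (intro sets.Int)
        then show ?thesis unfolding 1 by (simp add: 2)
      qed
      have tless: "t i + W < t k" if "i < k" for i k
      proof -
        have "Suc i * (W+1) \<le> k * (W+1)" using that by (intro mult_right_mono) auto
        then show ?thesis by (simp add: t_def)
      qed
      have EXX_le: "(\<integral>x. X i x * X k x \<partial>M) \<le> r\<^sup>2 + e'" if "i \<noteq> k" for i k
      proof (cases "i < k")
        case True then show ?thesis using W[OF tless[OF True]] by (simp add: EXX)
      next
        case False then have "k < i" using that by auto
        then show ?thesis using W[OF tless[OF \<open>k < i\<close>]] by (simp add: EXX conj_commute)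
      qed
      define Y where "Y x = (\<Sum>i<K. X i x)" for x
      have sq: "(Y x - K * r)\<^sup>2 = (\<Sum>i<K. \<Sum>k<K. X i x * X k x) - 2 * K * r * (\<Sum>i<K. X i x) + (K*r)\<^sup>2" for x
        unfolding Y_def power2_diff by (simp add: power2_eq_square sum_product)
      have "c * measure M F = (\<integral>x. c * indicator F x \<partial>M)" for c
        unfolding Bochner_Integration.integral_mult_right_zero Bochner_Integration.integral_indicator
        using sets.sets_into_space[OF Fm] by (intro arg_cong2[where f="(*)"] arg_cong2[where f=measure]) blast+
      then have "(K * r)\<^sup>2 * measure M F = (\<integral>x. (K*r)\<^sup>2 * indicator F x \<partial>M)" .
      also have "\<dots> \<le> (\<integral>x. (Y x - K * r)\<^sup>2 \<partial>M)"
      proof (rule integral_mono)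
        show "integrable M (\<lambda>x. (K*r)\<^sup>2 * indicator F x)"
          using Fm by (intro integrable_mult_right integrable_real_indicator) (simp_all add: emeasure_eq_measure)
        show "integrable M (\<lambda>x. (Y x - K * r)\<^sup>2)"
          unfolding sq using Xint XXint by (intro Bochner_Integration.integrable_add Bochner_Integration.integrable_diff
           Bochner_Integration.integrable_sum integrable_mult_right) auto
        fix x assume "x \<in> space M"
        show "(K*r)\<^sup>2 * indicator F x \<le> (Y x - K * r)\<^sup>2"
        proof (cases "x \<in> F")
          case True
          then have "Y x = 0" by (auto simp: Y_def X_def t_def F_def)
          then show ?thesis by (simp add: True)
        qed simp
      qed
      also have "\<dots> = (\<Sum>i<K. \<Sum>k<K. (\<integral>x. X i x * X k x \<partial>M)) - 2 * K * r * (\<Sum>i<K. (\<integral>x. X i x \<partial>M)) + (K*r)\<^sup>2"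
      proof -
        have 1: "integrable M (\<lambda>x. \<Sum>i<K. \<Sum>k<K. X i x * X k x)" "integrable M (\<lambda>x. \<Sum>i<K. X i x)"
          using Xint XXint by (simp_all add: Bochner_Integration.integrable_sum)
        have 2: "(\<integral>x. (\<Sum>i<K. \<Sum>k<K. X i x * X k x) \<partial>M) = (\<Sum>i<K. \<Sum>k<K. (\<integral>x. X i x * X k x \<partial>M))"
          using XXint by (simp add: Bochner_Integration.integral_sum Bochner_Integration.integrable_sum)
        have 3: "(\<integral>x. (\<Sum>i<K. X i x) \<partial>M) = (\<Sum>i<K. (\<integral>x. X i x \<partial>M))"
          using Xint by (simp add: Bochner_Integration.integral_sum)
        have 4: "(\<integral>x. F x - c * G x + d \<partial>M) = (\<integral>x. F x \<partial>M) - c * (\<integral>x. G x \<partial>M) + d"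
          if "integrable M F" "integrable M G" for F G :: "'a \<Rightarrow> real" and c d
        proof -
          have "(\<integral>x. F x - c * G x + d \<partial>M) = (\<integral>x. F x - c * G x \<partial>M) + (\<integral>x. d \<partial>M)"
            using that by (intro Bochner_Integration.integral_add Bochner_Integration.integrable_diff integrable_mult_right) auto
          also have "(\<integral>x. F x - c * G x \<partial>M) = (\<integral>x. F x \<partial>M) - (\<integral>x. c * G x \<partial>M)"
            using that by (intro Bochner_Integration.integral_diff integrable_mult_right)
          finally show ?thesis by (simp add: prob_space)
        qed
        show ?thesis unfolding sq 4[OF 1] 2 3 ..
      qed
      also have "(\<Sum>i<K. \<Sum>k<K. (\<integral>x. X i x * X k x \<partial>M)) \<le> (\<Sum>i<K. \<Sum>k<K. r\<^sup>2 + e' + (if k = i then 1 else 0))"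
      proof (intro sum_mono)
        fix i k assume "i \<in> {..<K}" "k \<in> {..<K}"
        show "(\<integral>x. X i x * X k x \<partial>M) \<le> r\<^sup>2 + e' + (if k = i then 1 else 0)"
          using EXX_le[of i k] e' by (cases "i = k") (auto simp: EXX intro: order_trans[OF prob_le_1])
      qed
      also have "(\<Sum>i<K. \<Sum>k<K. r\<^sup>2 + e' + (if k = i then 1 else 0)) = K * (K * (r\<^sup>2 + e')) + K"
        by (simp add: sum.distrib sum.delta ring_distribs)
      also have "(\<Sum>i<K. (\<integral>x. X i x \<partial>M)) = K * r"
        by (simp add: EX)
      finally have le: "(K * r)\<^sup>2 * measure M F \<le> K * (K * (r\<^sup>2 + e')) + K - 2 * K * r * (K * r) + (K * r)\<^sup>2"
        by (simp add: prob_space)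
      define \<kappa> where "\<kappa> = real K"
      have \<kappa>: "\<kappa> > 0" using K by (simp add: \<kappa>_def)
      have "\<kappa>\<^sup>2 * (r\<^sup>2 * measure M F) \<le> \<kappa>\<^sup>2 * e' + \<kappa>"
        using le unfolding of_nat_mult \<kappa>_def[symmetric] by (simp add: power2_eq_square ring_distribs mult.assoc mult.left_commute)
      also have "\<dots> = \<kappa>\<^sup>2 * (e' + 1 / \<kappa>)"
        using \<kappa> by (simp add: power2_eq_square ring_distribs)
      finally have "r\<^sup>2 * measure M F \<le> e' + 1 / \<kappa>" using \<kappa> by simp
      also have "\<dots> \<le> e' + e'" using K by (simp add: \<kappa>_def)
      also have "e' + e' = r\<^sup>2 * e" by (simp add: e'_def)
      finally show ?thesis using r by simp
    qed
    have "measure M F \<le> 0"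
    proof (rule ccontr)
      assume "\<not> measure M F \<le> 0"
      then have "0 < measure M F / 2" by linarith
      from bound[OF this] this show False by linarith
    qed
    then show ?thesis unfolding F_def[symmetric] using measure_nonneg[of M F] by linarith
  qed
  have "AE x in M. \<forall>j. \<not> (\<forall>n\<ge>j. \<not> D n x)"
  proof (subst AE_all_countable, rule allI)
    fix j
    have "{x\<in>space M. \<forall>n\<ge>j. \<not> D n x} \<in> sets M"
      using meas by (intro sets.sets_Collect_countable_All sets.sets_Collect_imp sets.sets_Collect_const sets.sets_Collect_neg) auto
    moreover have "emeasure M {x\<in>space M. \<forall>n\<ge>j. \<not> D n x} = 0"
      unfolding emeasure_eq_measure zero by (rule ennreal_0)
    ultimately show "AE x in M. \<not> (\<forall>n\<ge>j. \<not> D n x)"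
      by (intro AE_I[where N="{x\<in>space M. \<forall>n\<ge>j. \<not> D n x}"]) blast
  qed
  then show ?thesis
  proof eventually_elim
    case (elim x)
    then show ?case unfolding infinite_nat_iff_unbounded_le by blast
  qed
qed

section \<open>Cayley graphs\<close>

text \<open>The standing data: a finite symmetric generating set without the unit.\<close>

locale cayley = group \<Gamma> for \<Gamma> :: "('a, 'b) monoid_scheme" (structure) +
  fixes S :: "'a set"
  assumes S_sub: "S \<subseteq> carrier \<Gamma>" and S_fin: "finite S"
    and S_inv: "\<And>s. s \<in> S \<Longrightarrow> inv s \<in> S" and S_one: "\<one> \<notin> S"
    and S_gen: "generate \<Gamma> S = carrier \<Gamma>"
begin

abbreviation G where "G \<equiv> cayley_graph \<Gamma> S"
abbreviation V where "V \<equiv> carrier \<Gamma>"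
abbreviation E where "E \<equiv> edges (cayley_graph \<Gamma> S)"

lemma verts_G [simp]: "verts G = V"
  by (simp add: cayley_graph_def)

lemma S_closed [simp, intro]: "s \<in> S \<Longrightarrow> s \<in> V"
  using S_sub by blast

lemma inv_mult_cancel: "x \<in> V \<Longrightarrow> y \<in> V \<Longrightarrow> inv x \<otimes> (x \<otimes> y) = y"
  by (simp add: m_assoc[symmetric])

lemma mult_inv_cancel: "x \<in> V \<Longrightarrow> y \<in> V \<Longrightarrow> x \<otimes> (inv x \<otimes> y) = y"
  by (simp add: m_assoc[symmetric])

lemma edge_iff: "{x, y} \<in> E \<longleftrightarrow> x \<in> V \<and> (\<exists>s\<in>S. y = x \<otimes> s)"
proof
  assume "{x, y} \<in> E"
  then obtain a b where ab: "{x, y} = {a, b}" "a \<in> V" "b \<in> V" "inv a \<otimes> b \<in> S"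
    by (auto simp: cayley_graph_def)
  have 1: "b = a \<otimes> (inv a \<otimes> b)" using ab by (simp add: mult_inv_cancel)
  have "inv (inv a \<otimes> b) = inv b \<otimes> a" using ab by (simp add: inv_mult_group)
  then have 2: "inv b \<otimes> a \<in> S" using S_inv[OF ab(4)] by simp
  have 3: "a = b \<otimes> (inv b \<otimes> a)" using ab by (simp add: mult_inv_cancel)
  from ab(1) consider "x = a" "y = b" | "x = b" "y = a" by (auto simp: doubleton_eq_iff)
  then show "x \<in> V \<and> (\<exists>s\<in>S. y = x \<otimes> s)"
    using ab 1 2 3 by cases blast+
next
  assume "x \<in> V \<and> (\<exists>s\<in>S. y = x \<otimes> s)"
  then obtain s where "x \<in> V" "s \<in> S" "y = x \<otimes> s" by blast
  then have "x \<in> V \<and> y \<in> V \<and> inv x \<otimes> y \<in> S" by (auto simp: inv_mult_cancel)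
  then show "{x, y} \<in> E" by (auto simp: cayley_graph_def)
qed

lemma edge_mult: "x \<in> V \<Longrightarrow> s \<in> S \<Longrightarrow> {x, x \<otimes> s} \<in> E"
  by (auto simp: edge_iff)

lemma edge_verts: "{x, y} \<in> E \<Longrightarrow> x \<in> V \<and> y \<in> V"
  by (auto simp: edge_iff)

lemma mult_ne: "x \<in> V \<Longrightarrow> s \<in> S \<Longrightarrow> x \<otimes> s \<noteq> x"
proof
  assume x: "x \<in> V" "s \<in> S" "x \<otimes> s = x"
  have "s = inv x \<otimes> (x \<otimes> s)" using x by (simp add: inv_mult_cancel)
  also have "\<dots> = \<one>" unfolding x(3) using x(1) by simp
  finally show False using S_one x by simp
qed

lemma edge_cases:
  assumes "e \<in> E" obtains x y where "e = {x, y}" "x \<in> V" "y \<in> V" "x \<noteq> y"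
proof -
  from assms obtain x y where "e = {x, y}" "x \<in> V" "y \<in> V" "{x, y} \<in> E"
    by (auto simp: cayley_graph_def)
  moreover have "x \<noteq> y" using \<open>{x, y} \<in> E\<close> mult_ne[of x] by (auto simp: edge_iff)
  ultimately show ?thesis using that by blast
qed

lemma nbrs_eq: "x \<in> V \<Longrightarrow> nbrs G x = (\<lambda>s. x \<otimes> s) ` S"
  by (auto simp: nbrs_def edge_iff)

lemma finite_touching: "finite A \<Longrightarrow> finite {e \<in> E. e \<inter> A \<noteq> {}}"
proof (rule finite_subset)
  show "{e \<in> E. e \<inter> A \<noteq> {}} \<subseteq> (\<lambda>(x, s). {x, x \<otimes> s}) ` (A \<times> S)"
  proof
    fix e assume "e \<in> {e \<in> E. e \<inter> A \<noteq> {}}"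
    then obtain x where x: "e \<in> E" "x \<in> e" "x \<in> A" by blast
    then obtain y where y: "e = {x, y}" by (elim edge_cases) blast
    then have "{x, y} \<in> E" using x by simp
    then obtain s where "s \<in> S" "y = x \<otimes> s" by (auto simp: edge_iff)
    then show "e \<in> (\<lambda>(x, s). {x, x \<otimes> s}) ` (A \<times> S)" using x y by blast
  qed
qed (use S_fin in simp)

fun wprod :: "'a list \<Rightarrow> 'a" where
  "wprod [] = \<one>"
| "wprod (s # w) = s \<otimes> wprod w"

lemma wprod_closed [simp, intro]: "set w \<subseteq> V \<Longrightarrow> wprod w \<in> V"
  by (induction w) auto

lemma wprod_append: "set u \<subseteq> V \<Longrightarrow> set w \<subseteq> V \<Longrightarrow> wprod (u @ w) = wprod u \<otimes> wprod w"
  by (induction u) (auto simp: m_assoc)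

text \<open>Ball about the unit in the word metric. It serves both as the exhausting sequence of finite vertex
sets and as the measure of volume.\<close>

definition wball :: "nat \<Rightarrow> 'a set" where
  "wball n = wprod ` {w. set w \<subseteq> S \<and> length w \<le> n}"

lemma wball_sub: "wball n \<subseteq> V"
  using S_sub by (auto simp: wball_def intro!: wprod_closed)

lemma finite_wball [simp]: "finite (wball n)"
  unfolding wball_def using S_fin by (intro finite_imageI finite_lists_length_le)

lemma one_wball [simp]: "\<one> \<in> wball n"
  unfolding wball_def by (intro image_eqI[of _ _ "[]"]) auto

lemma wball_mono: "n \<le> m \<Longrightarrow> wball n \<subseteq> wball m"
  by (auto simp: wball_def)

lemma wball_mult: "x \<in> wball n \<Longrightarrow> y \<in> wball m \<Longrightarrow> x \<otimes> y \<in> wball (n + m)"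
proof -
  assume "x \<in> wball n" "y \<in> wball m"
  then obtain u w where "x = wprod u" "y = wprod w" "set u \<subseteq> S" "set w \<subseteq> S" "length u \<le> n" "length w \<le> m"
    by (auto simp: wball_def)
  moreover from this have "wprod (u @ w) = x \<otimes> y" using S_sub by (subst wprod_append) auto
  ultimately show ?thesis unfolding wball_def by (intro image_eqI[of _ _ "u @ w"]) auto
qed

lemma S_wball: "s \<in> S \<Longrightarrow> s \<in> wball 1"
  unfolding wball_def by (intro image_eqI[of _ _ "[s]"]) auto

lemma wball_inv: "x \<in> wball n \<Longrightarrow> inv x \<in> wball n"
proof -
  have *: "set w \<subseteq> S \<Longrightarrow> inv (wprod w) \<in> wball (length w)" for w
  proof (induction w)
    case (Cons s w)
    have "inv (wprod (s # w)) = inv (wprod w) \<otimes> inv s"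
      using Cons.prems S_sub by (simp add: inv_mult_group subset_iff)
    moreover have "inv (wprod w) \<otimes> inv s \<in> wball (length w + 1)"
      using Cons S_inv by (intro wball_mult S_wball) auto
    ultimately show ?case by simp
  qed simp
  assume "x \<in> wball n"
  then obtain w where "x = wprod w" "set w \<subseteq> S" "length w \<le> n" by (auto simp: wball_def)
  then show ?thesis using *[of w] wball_mono[of "length w" n] by auto
qed

lemma wball_exhaust: "x \<in> V \<Longrightarrow> \<exists>n. x \<in> wball n"
proof -
  assume "x \<in> V"
  then have "x \<in> generate \<Gamma> S" using S_gen by simp
  then show ?thesis
  proof induction
    case one then show ?case by (intro exI one_wball)
  next
    case (incl h) then show ?case using S_wball by blast
  next
    case (inv h) then show ?case using S_wball S_inv by blast
  next
    case (eng h1 h2) then show ?case using wball_mult by blast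
  qed
qed

lemma V_eq: "V = (\<Union>n. wball n)"
  using wball_exhaust wball_sub by blast

lemma countable_V [simp]: "countable V"
  unfolding V_eq by (intro countable_UN) (auto intro: countable_finite)

lemma finite_sub_wball: "finite A \<Longrightarrow> A \<subseteq> V \<Longrightarrow> \<exists>n. A \<subseteq> wball n"
proof (induction rule: finite_induct)
  case (insert x A)
  then obtain n where "A \<subseteq> wball n" by blast
  moreover obtain m where "x \<in> wball m" using wball_exhaust insert by blast
  ultimately have "insert x A \<subseteq> wball (max n m)"
    using wball_mono[of n "max n m"] wball_mono[of m "max n m"] by auto
  then show ?case by blast
qed simp

lemma countable_E [simp]: "countable E"
proof -
  have "E \<subseteq> (\<lambda>(x, y). {x, y}) ` (V \<times> V)" by (auto simp: cayley_graph_def)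
  then show ?thesis by (rule countable_subset) (intro countable_image countable_SIGMA countable_V)
qed

section \<open>Open connections\<close>

text \<open>Connection by open edges whose endpoints lie in \<open>A\<close>. The restriction to \<open>A\<close> controls which edges
the event depends on, which is what all independence arguments below rest on.\<close>

inductive conn :: "('a set \<Rightarrow> bool) \<Rightarrow> 'a set \<Rightarrow> 'a \<Rightarrow> 'a \<Rightarrow> bool" for \<omega> A where
  conn_refl: "x \<in> A \<Longrightarrow> conn \<omega> A x x"
| conn_step: "conn \<omega> A x y \<Longrightarrow> z \<in> A \<Longrightarrow> {y, z} \<in> E \<Longrightarrow> \<omega> {y, z} \<Longrightarrow> conn \<omega> A x z"

lemma conn_in: "conn \<omega> A x y \<Longrightarrow> x \<in> A \<and> y \<in> A"
  by (induction rule: conn.induct) auto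

lemma conn_trans: "conn \<omega> A y z \<Longrightarrow> conn \<omega> A x y \<Longrightarrow> conn \<omega> A x z"
  by (induction rule: conn.induct) (auto intro: conn.intros)

lemma conn_edge: "x \<in> A \<Longrightarrow> y \<in> A \<Longrightarrow> {x, y} \<in> E \<Longrightarrow> \<omega> {x, y} \<Longrightarrow> conn \<omega> A x y"
  by (rule conn_step[OF conn_refl])

lemma conn_sym: "conn \<omega> A x y \<Longrightarrow> conn \<omega> A y x"
proof (induction rule: conn.induct)
  case (conn_step x y z)
  then have "conn \<omega> A z y" using conn_in by (intro conn_edge) (auto simp: insert_commute)
  then show ?case using conn_step conn_trans by blast
qed (rule conn_refl)

lemma conn_mono: "conn \<omega> A x y \<Longrightarrow> A \<subseteq> B \<Longrightarrow> conn \<omega> B x y"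
  by (induction rule: conn.induct) (auto intro: conn.intros)

lemma conn_mono_open: "conn \<omega> A x y \<Longrightarrow> (\<And>e. e \<in> E \<Longrightarrow> e \<subseteq> A \<Longrightarrow> \<omega> e \<Longrightarrow> \<omega>' e) \<Longrightarrow> conn \<omega>' A x y"
proof (induction rule: conn.induct)
  case (conn_step x y z)
  have "\<omega>' {y, z}" using conn_step conn_in by blast
  then show ?case using conn_step conn.conn_step[of \<omega>' A x y z] by blast
qed (rule conn_refl)

lemma conn_cong: "(\<And>e. e \<in> E \<Longrightarrow> e \<subseteq> A \<Longrightarrow> \<omega> e = \<omega>' e) \<Longrightarrow> conn \<omega> A x y \<longleftrightarrow> conn \<omega>' A x y"
  using conn_mono_open[of \<omega> A x y \<omega>'] conn_mono_open[of \<omega>' A x y \<omega>] by blast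

text \<open>A path is finite, so it stays in some ball. This gives measurability of connection events and their
approximation by events on finitely many edges.\<close>

lemma conn_exhaust: "conn \<omega> A x y \<Longrightarrow> A \<subseteq> V \<Longrightarrow> \<exists>n. conn \<omega> (A \<inter> wball n) x y"
proof (induction rule: conn.induct)
  case (conn_refl x)
  then obtain n where "x \<in> wball n" using wball_exhaust by blast
  then have "conn \<omega> (A \<inter> wball n) x x" using conn_refl by (intro conn.conn_refl) blast
  then show ?case ..
next
  case (conn_step x y z)
  then obtain n where n: "conn \<omega> (A \<inter> wball n) x y" by blast
  obtain m where m: "z \<in> wball m" using conn_step wball_exhaust by blast
  let ?B = "A \<inter> wball (max n m)"
  have "conn \<omega> ?B x y" using n wball_mono[of n "max n m"] by (elim conn_mono) auto
  moreover have "z \<in> ?B" using conn_step(2) m wball_mono[of m "max n m"] by auto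
  ultimately have "conn \<omega> ?B x z" using conn_step(3,4) by (intro conn.conn_step[of \<omega> ?B x y z])
  then show ?case ..
qed

section \<open>Translations of configurations\<close>

text \<open>The configuration seen after left translation by \<open>g\<close>; left multiplication is an automorphism of the
Cayley graph.\<close>

abbreviation translate :: "'a \<Rightarrow> ('a set \<Rightarrow> bool) \<Rightarrow> ('a set \<Rightarrow> bool)" where
  "translate g \<omega> \<equiv> (\<lambda>e\<in>E. \<omega> ((\<lambda>x. g \<otimes> x) ` e))"

lemma edge_translate: "g \<in> V \<Longrightarrow> e \<in> E \<Longrightarrow> (\<lambda>x. g \<otimes> x) ` e \<in> E"
proof -
  assume g: "g \<in> V" and e: "e \<in> E"
  from e obtain x y where "e = {x, y}" by (rule edge_cases)
  with e have xy: "e = {x, y}" "{x, y} \<in> E" by simp_all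
  then obtain s where s: "x \<in> V" "s \<in> S" "y = x \<otimes> s" by (auto simp: edge_iff)
  then have "g \<otimes> y = (g \<otimes> x) \<otimes> s" using g by (simp add: m_assoc)
  then have "{g \<otimes> x, g \<otimes> y} \<in> E" using s g edge_mult[of "g \<otimes> x" s] by simp
  then show ?thesis using xy by simp
qed

lemma conn_translate_imp:
  "conn (translate g \<omega>) A x y \<Longrightarrow> A \<subseteq> V \<Longrightarrow> g \<in> V \<Longrightarrow> conn \<omega> ((\<lambda>x. g \<otimes> x) ` A) (g \<otimes> x) (g \<otimes> y)"
proof (induction rule: conn.induct)
  case (conn_step x y z)
  have "{g \<otimes> y, g \<otimes> z} \<in> E" using edge_translate[OF conn_step.prems(2) conn_step.hyps(3)] by simp
  moreover have "\<omega> {g \<otimes> y, g \<otimes> z}" 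
    using conn_step.hyps(4) unfolding restrict_apply'[OF conn_step.hyps(3)] image_insert image_empty .
  moreover have "g \<otimes> z \<in> (\<lambda>x. g \<otimes> x) ` A" using conn_step.hyps(2) by blast
  ultimately show ?case
    by (intro conn.conn_step[OF conn_step.IH[OF conn_step.prems]])
qed (rule conn_refl, rule imageI)

lemma translate_translate: "g \<in> V \<Longrightarrow> A \<subseteq> V \<Longrightarrow> (\<lambda>x. g \<otimes> x) ` (\<lambda>x. inv g \<otimes> x) ` A = A"
proof -
  assume "g \<in> V" "A \<subseteq> V"
  then have "(\<lambda>x. g \<otimes> (inv g \<otimes> x)) ` A = id ` A"
    by (intro image_cong) (auto simp: mult_inv_cancel)
  then show ?thesis by (simp add: image_image)
qed

lemma conn_translate:
  assumes "A \<subseteq> V" "g \<in> V" "x \<in> V" "y \<in> V"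
  shows "conn (translate g \<omega>) A x y \<longleftrightarrow> conn \<omega> ((\<lambda>x. g \<otimes> x) ` A) (g \<otimes> x) (g \<otimes> y)"
proof
  assume *: "conn \<omega> ((\<lambda>x. g \<otimes> x) ` A) (g \<otimes> x) (g \<otimes> y)"
  have E: "e \<subseteq> V" if "e \<in> E" for e using that by (auto elim: edge_cases)
  have "conn (translate (inv g) (translate g \<omega>)) ((\<lambda>x. g \<otimes> x) ` A) (g \<otimes> x) (g \<otimes> y)"
    using * assms
    by (subst conn_cong[where \<omega>'=\<omega>]) (auto simp: edge_translate translate_translate E)
  from conn_translate_imp[OF this]
  have *: "conn (translate g \<omega>) ((\<lambda>x. inv g \<otimes> x) ` (\<lambda>x. g \<otimes> x) ` A) (inv g \<otimes> (g \<otimes> x)) (inv g \<otimes> (g \<otimes> y))"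
    using assms(1,2) by blast
  have "(\<lambda>x. inv g \<otimes> x) ` (\<lambda>x. g \<otimes> x) ` A = A"
    using assms translate_translate[of "inv g" A] by simp
  with * show "conn (translate g \<omega>) A x y"
    using assms by (simp only: inv_mult_cancel)
next
  assume "conn (translate g \<omega>) A x y"
  then show "conn \<omega> ((\<lambda>x. g \<otimes> x) ` A) (g \<otimes> x) (g \<otimes> y)"
    using assms(1,2) by (rule conn_translate_imp)
qed

section \<open>The percolation measure\<close>

abbreviation perc where "perc p \<equiv> percolation G p"
abbreviation perc_prob :: "real \<Rightarrow> (('a set \<Rightarrow> bool) \<Rightarrow> bool) \<Rightarrow> real" where
  "perc_prob p Q \<equiv> measure (perc p) {\<omega> \<in> space (perc p). Q \<omega>}"
text \<open>The two-point function of percolation restricted to \<open>A\<close>.\<close>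

abbreviation \<tau> :: "real \<Rightarrow> 'a set \<Rightarrow> 'a \<Rightarrow> 'a \<Rightarrow> real" where
  "\<tau> p A x y \<equiv> perc_prob p (\<lambda>\<omega>. conn \<omega> A x y)"

lemma space_perc: "space (perc p) = extensional E"
  by (simp add: percolation_def space_PiM PiE_UNIV_domain PiE_def)

lemma prob_space_perc: "prob_space (perc p)"
  unfolding percolation_def by (intro prob_space_PiM measure_pmf.prob_space_axioms)

text \<open>Events on finitely many edges are measurable, whatever their description.\<close>

lemma pred_finite:
  "finite F \<Longrightarrow> F \<subseteq> E \<Longrightarrow> depends_on (perc p) F Q \<Longrightarrow> Q \<in> measurable (perc p) (count_space UNIV)"
  unfolding percolation_def by (rule measurable_depends_on_finite[where J=F]) auto

lemma perc_prob_indep: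
  assumes "F \<subseteq> E" "F' \<subseteq> E" "F \<inter> F' = {}"
    and "Measurable.pred (perc p) P" "depends_on (perc p) F P"
    and "Measurable.pred (perc p) Q" "depends_on (perc p) F' Q"
  shows "perc_prob p (\<lambda>\<omega>. P \<omega> \<and> Q \<omega>) = perc_prob p P * perc_prob p Q"
  using assms unfolding percolation_def
  by (intro PiM_indep_events[where J=F and K=F'] measure_pmf.prob_space_axioms predE)

lemma perc_prob_mono: "Measurable.pred (perc p) Q \<Longrightarrow> (\<And>\<omega>. \<omega> \<in> space (perc p) \<Longrightarrow> P \<omega> \<Longrightarrow> Q \<omega>) \<Longrightarrow> perc_prob p P \<le> perc_prob p Q"
proof -
  interpret prob_space "perc p" by (rule prob_space_perc)
  assume "Measurable.pred (perc p) Q" "\<And>\<omega>. \<omega> \<in> space (perc p) \<Longrightarrow> P \<omega> \<Longrightarrow> Q \<omega>"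
  then show ?thesis by (intro finite_measure_mono) (auto simp: pred_def)
qed

lemma perc_prob_cong: "(\<And>\<omega>. \<omega> \<in> space (perc p) \<Longrightarrow> P \<omega> = Q \<omega>) \<Longrightarrow> perc_prob p P = perc_prob p Q"
  by (intro arg_cong2[where f=measure]) auto

lemma perc_prob_le_1: "perc_prob p Q \<le> 1"
  using prob_space.prob_le_1[OF prob_space_perc] .

lemma perc_prob_finite_union:
  assumes "finite I" "\<And>i. i \<in> I \<Longrightarrow> Measurable.pred (perc p) (Q i)"
  shows "perc_prob p (\<lambda>\<omega>. \<exists>i\<in>I. Q i \<omega>) \<le> (\<Sum>i\<in>I. perc_prob p (Q i))"
proof -
  interpret prob_space "perc p" by (rule prob_space_perc)
  have "{\<omega> \<in> space (perc p). \<exists>i\<in>I. Q i \<omega>} = (\<Union>i\<in>I. {\<omega> \<in> space (perc p). Q i \<omega>})" by blast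
  then show ?thesis
    using assms by (simp only:) (intro finite_measure_subadditive_finite, auto simp: pred_def)
qed

lemma perc_prob_disjoint_union:
  assumes "finite I" "\<And>i. i \<in> I \<Longrightarrow> Measurable.pred (perc p) (Q i)"
    "\<And>i j \<omega>. i \<in> I \<Longrightarrow> j \<in> I \<Longrightarrow> i \<noteq> j \<Longrightarrow> Q i \<omega> \<Longrightarrow> \<not> Q j \<omega>"
  shows "perc_prob p (\<lambda>\<omega>. \<exists>i\<in>I. Q i \<omega>) = (\<Sum>i\<in>I. perc_prob p (Q i))"
proof -
  interpret prob_space "perc p" by (rule prob_space_perc)
  have *: "{\<omega> \<in> space (perc p). \<exists>i\<in>I. Q i \<omega>} = (\<Union>i\<in>I. {\<omega> \<in> space (perc p). Q i \<omega>})" by blast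
  show ?thesis
    unfolding * using assms
    by (intro finite_measure_finite_Union) (auto simp: pred_def disjoint_family_on_def)
qed

lemma depends_conn: "depends_on (perc p) {e \<in> E. e \<subseteq> A} (\<lambda>\<omega>. conn \<omega> A x y)"
  by (intro depends_onI conn_cong) blast

lemma finite_inside: "finite A \<Longrightarrow> finite {e \<in> E. e \<subseteq> A}"
  by (rule finite_subset[of _ "Pow A"]) auto

lemma pred_conn [measurable]:
  assumes "A \<subseteq> V" shows "Measurable.pred (perc p) (\<lambda>\<omega>. conn \<omega> A x y)"
proof -
  have "Measurable.pred (perc p) (\<lambda>\<omega>. conn \<omega> (A \<inter> wball n) x y)" for n
    by (rule pred_finite[OF _ _ depends_conn]) (auto intro!: finite_inside)
  then have "Measurable.pred (perc p) (\<lambda>\<omega>. \<exists>n. conn \<omega> (A \<inter> wball n) x y)"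
    by (rule pred_intros_countable)
  moreover have "(\<lambda>\<omega>. \<exists>n. conn \<omega> (A \<inter> wball n) x y) = (\<lambda>\<omega>. conn \<omega> A x y)"
    using conn_exhaust[OF _ assms] conn_mono[OF _ Int_lower1] by (intro ext) blast
  ultimately show ?thesis by simp
qed

lemma perc_prob_edge_open: "e \<in> E \<Longrightarrow> 0 \<le> p \<Longrightarrow> p \<le> 1 \<Longrightarrow> perc_prob p (\<lambda>\<omega>. \<omega> e) = p"
proof -
  assume e: "e \<in> E" "0 \<le> p" "p \<le> 1"
  have "emeasure (perc p) {\<omega>\<in>space (perc p). \<omega> e \<in> {True}} = emeasure (measure_pmf (bernoulli_pmf p)) {True}"
    unfolding percolation_def using e
    by (intro product_prob_space.emeasure_PiM_Collect_single product_prob_spaceI measure_pmf.prob_space_axioms) auto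
  then show ?thesis using e by (simp add: measure_def emeasure_pmf_single)
qed

lemma translate_measurable: "g \<in> V \<Longrightarrow> translate g \<in> measurable (perc p) (perc p)"
  unfolding percolation_def
  by (intro measurable_restrict measurable_component_singleton edge_translate)

lemma distr_translate: "g \<in> V \<Longrightarrow> distr (perc p) (perc p) (translate g) = perc p"
proof -
  assume g: "g \<in> V"
  have "inj_on (\<lambda>e. (\<lambda>x. g \<otimes> x) ` e) E"
  proof (rule inj_onI)
    fix e e' assume e: "e \<in> E" "e' \<in> E" "(\<lambda>x. g \<otimes> x) ` e = (\<lambda>x. g \<otimes> x) ` e'"
    then have V: "e \<subseteq> V" "e' \<subseteq> V" by (auto elim: edge_cases)
    have "(\<lambda>x. inv g \<otimes> x) ` (\<lambda>x. g \<otimes> x) ` e = e" "(\<lambda>x. inv g \<otimes> x) ` (\<lambda>x. g \<otimes> x) ` e' = e'"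
      using translate_translate[of "inv g"] g V by simp_all
    then show "e = e'" using e by metis
  qed
  then show ?thesis
    unfolding percolation_def using g
    by (intro distr_PiM_reindex[where M="\<lambda>_. measure_pmf (bernoulli_pmf p)"] measure_pmf.prob_space_axioms)
      (auto intro: edge_translate)
qed

lemma perc_prob_translate:
  assumes "g \<in> V" "Measurable.pred (perc p) Q"
  shows "perc_prob p (\<lambda>\<omega>. Q (translate g \<omega>)) = perc_prob p Q"
proof -
  have "perc_prob p Q = measure (distr (perc p) (perc p) (translate g)) {\<omega>\<in>space (perc p). Q \<omega>}"
    by (simp only: distr_translate[OF assms(1)])
  also have "\<dots> = measure (perc p) (translate g -` {\<omega>\<in>space (perc p). Q \<omega>} \<inter> space (perc p))"
    using assms by (intro measure_distr translate_measurable) (auto simp: pred_def)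
  also have "translate g -` {\<omega>\<in>space (perc p). Q \<omega>} \<inter> space (perc p) = {\<omega>\<in>space (perc p). Q (translate g \<omega>)}"
    by (auto simp: space_perc)
  finally show ?thesis by simp
qed

lemma \<tau>_translate:
  assumes "g \<in> V" "A \<subseteq> V" "x \<in> V" "y \<in> V"
  shows "\<tau> p ((\<lambda>x. g \<otimes> x) ` A) (g \<otimes> x) (g \<otimes> y) = \<tau> p A x y"
  using perc_prob_translate[OF assms(1) pred_conn[OF assms(2)], of p x y] conn_translate[OF assms(2,1,3,4)]
  by simp

lemma translate_V: "g \<in> V \<Longrightarrow> (\<lambda>x. g \<otimes> x) ` V = V"
  using translate_translate[of g V] by (auto simp: image_iff) (metis inv_closed m_closed mult_inv_cancel)

lemma \<tau>_translate_V: "g \<in> V \<Longrightarrow> x \<in> V \<Longrightarrow> y \<in> V \<Longrightarrow> \<tau> p V (g \<otimes> x) (g \<otimes> y) = \<tau> p V x y"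
  using \<tau>_translate[of g V x y p] by (simp add: translate_V)

end

section \<open>Connected components\<close>

text \<open>Inductive form of reachability by walks, which replaces lists in the proofs.\<close>

inductive reach :: "'v graph \<Rightarrow> 'v \<Rightarrow> 'v \<Rightarrow> bool" for H where
  reach_refl: "x \<in> verts H \<Longrightarrow> reach H x x"
| reach_step: "reach H x y \<Longrightarrow> z \<in> verts H \<Longrightarrow> {y, z} \<in> edges H \<Longrightarrow> reach H x z"

lemma reach_in: "reach H x y \<Longrightarrow> x \<in> verts H \<and> y \<in> verts H"
  by (induction rule: reach.induct) auto

lemma component_eq: "component H x = {y. reach H x y}"
proof (intro Set.set_eqI iffI)
  fix y assume "y \<in> component H x"
  then obtain ws where "walk H x ws y" by (auto simp: component_def)
  then show "y \<in> {y. reach H x y}"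
  proof (induction ws arbitrary: y rule: rev_induct)
    case Nil then show ?case by (simp add: walk_def)
  next
    case (snoc z ws)
    show ?case
    proof (cases "ws = []")
      case True
      then show ?thesis using snoc.prems by (auto simp: walk_def intro: reach_refl)
    next
      case False
      then have "walk H x ws (last ws)" "{last ws, z} \<in> edges H" "z \<in> verts H" "y = z"
        using snoc.prems by (auto simp: walk_def successively_append_iff)
      then show ?thesis using snoc.IH reach_step by fastforce
    qed
  qed
next
  fix y assume "y \<in> {y. reach H x y}"
  then have "reach H x y" by simp
  then have "\<exists>ws. walk H x ws y"
  proof (induction rule: reach.induct)
    case (reach_refl x)
    then have "walk H x [x] x" by (simp add: walk_def)
    then show ?case ..
  next
    case (reach_step x y z)
    then obtain ws where "walk H x ws y" by blast
    then have "walk H x (ws @ [z]) z" using reach_step by (auto simp: walk_def successively_append_iff)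
    then show ?case ..
  qed
  then show "y \<in> component H x" by (simp add: component_def)
qed

context cayley
begin

lemma component_open: "component (open_graph G \<omega>) x = {y. conn \<omega> V x y}"
proof -
  have "reach (open_graph G \<omega>) x y \<Longrightarrow> conn \<omega> V x y" for x y
    by (induction rule: reach.induct) (auto simp: open_graph_def intro: conn.intros)
  moreover have "conn \<omega> V x y \<Longrightarrow> reach (open_graph G \<omega>) x y" for x y
    by (induction rule: conn.induct) (auto simp: open_graph_def intro: reach.intros)
  ultimately show ?thesis unfolding component_eq by blast
qed

lemma verts_cluster: "verts (cluster G \<omega> x) = {y. conn \<omega> V x y}"
  by (simp add: cluster_def component_open)

section \<open>A finite-volume criterion for finite susceptibility\<close>

definition boundary :: "'a set \<Rightarrow> ('a \<times> 'a) set" where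
  "boundary B = {(u, w). u \<in> B \<and> w \<in> V - B \<and> {u, w} \<in> E}"

text \<open>The expected number of open edges leaving \<open>B\<close> whose inner endpoint is reached from \<open>x\<close> inside \<open>B\<close>,
since a boundary edge is independent of the connections inside \<open>B\<close>.\<close>

definition \<phi> :: "real \<Rightarrow> 'a \<Rightarrow> 'a set \<Rightarrow> real" where
  "\<phi> p x B = p * (\<Sum>(u, w)\<in>boundary B. \<tau> p B x u)"

lemma finite_boundary: "finite B \<Longrightarrow> finite (boundary B)"
proof (rule finite_subset)
  show "boundary B \<subseteq> (\<lambda>(x, s). (x, x \<otimes> s)) ` (B \<times> S)"
    by (auto simp: boundary_def edge_iff)
qed (use S_fin in simp)

lemma boundary_translate:
  assumes "g \<in> V" "B \<subseteq> V"
  shows "boundary ((\<lambda>x. g \<otimes> x) ` B) = (\<lambda>(u, w). (g \<otimes> u, g \<otimes> w)) ` boundary B"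
proof -
  have *: "(\<lambda>(u, w). (g \<otimes> u, g \<otimes> w)) ` boundary B \<subseteq> boundary ((\<lambda>x. g \<otimes> x) ` B)" if "g \<in> V" "B \<subseteq> V" for g B
  proof clarify
    fix u w assume uw: "(u, w) \<in> boundary B"
    then have V: "u \<in> V" "w \<in> V" using that by (auto simp: boundary_def)
    have "{g \<otimes> u, g \<otimes> w} \<in> E" using edge_translate[of g "{u, w}"] uw that by (simp add: boundary_def)
    moreover have "g \<otimes> w \<notin> (\<lambda>x. g \<otimes> x) ` B"
    proof
      assume "g \<otimes> w \<in> (\<lambda>x. g \<otimes> x) ` B"
      then obtain b where "b \<in> B" "g \<otimes> w = g \<otimes> b" by blast
      then have "w = b" using that V by (metis inv_mult_cancel subsetD)
      then show False using uw \<open>b \<in> B\<close> by (simp add: boundary_def)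
    qed
    ultimately show "(g \<otimes> u, g \<otimes> w) \<in> boundary ((\<lambda>x. g \<otimes> x) ` B)"
      using uw V that by (auto simp: boundary_def)
  qed
  let ?B = "(\<lambda>x. g \<otimes> x) ` B"
  have B: "(\<lambda>x. inv g \<otimes> x) ` ?B = B" using translate_translate[of "inv g" B] assms by simp
  have BV: "?B \<subseteq> V" using assms by auto
  have "boundary ?B \<subseteq> (\<lambda>(u, w). (g \<otimes> u, g \<otimes> w)) ` boundary B"
  proof clarify
    fix u w assume uw: "(u, w) \<in> boundary ?B"
    then have V: "u \<in> V" "w \<in> V" using BV by (auto simp: boundary_def)
    have "(inv g \<otimes> u, inv g \<otimes> w) \<in> boundary B"
      using *[of "inv g" ?B] BV assms uw unfolding B by auto
    moreover have "(u, w) = (\<lambda>(u, w). (g \<otimes> u, g \<otimes> w)) (inv g \<otimes> u, inv g \<otimes> w)"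
      using V assms by (simp add: mult_inv_cancel)
    ultimately show "(u, w) \<in> (\<lambda>(u, w). (g \<otimes> u, g \<otimes> w)) ` boundary B" by (rule rev_image_eqI)
  qed
  then show ?thesis using *[OF assms] by blast
qed

text \<open>Cut the path at its last visit to \<open>C\<close>: the remainder avoids \<open>C\<close>.\<close>

lemma last_exit:
  assumes "conn \<omega> \<Lambda> x y" "x \<in> C"
  shows "y \<in> C \<or> (\<exists>u w. u \<in> C \<and> w \<in> \<Lambda> - C \<and> {u, w} \<in> E \<and> \<omega> {u, w} \<and> conn \<omega> (\<Lambda> - C) w y)"
  using assms
proof (induction rule: conn.induct)
  case (conn_step x y z)
  show ?case
  proof (cases "z \<in> C")
    case False
    then have z: "z \<in> \<Lambda> - C" using conn_step by blast
    show ?thesis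
    proof (cases "y \<in> C")
      case True
      then show ?thesis using z conn_step conn_refl[OF z] by blast
    next
      case False
      then obtain u w where uw: "u \<in> C" "w \<in> \<Lambda> - C" "{u, w} \<in> E" "\<omega> {u, w}" "conn \<omega> (\<Lambda> - C) w y"
        using conn_step by blast
      then have "conn \<omega> (\<Lambda> - C) w z" using conn_step.hyps z by (intro conn.conn_step[OF uw(5)])
      then show ?thesis using uw by blast
    qed
  qed simp
qed simp

text \<open>Exploring the cluster of \<open>x\<close> from inside reveals only edges that touch it, so the event that it
equals \<open>C\<close> says nothing about edges disjoint from \<open>C\<close>.\<close>

lemma depends_cluster:
  "depends_on (perc p) {e \<in> E. e \<subseteq> A \<and> e \<inter> C \<noteq> {}} (\<lambda>\<omega>. {z. conn \<omega> A x z} = C)"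
  (is "depends_on _ ?F ?P")
proof -
  have *: "{z. conn \<omega>' A x z} = C"
    if eq: "\<And>e. e \<in> {e \<in> E. e \<subseteq> A \<and> e \<inter> C \<noteq> {}} \<Longrightarrow> \<omega> e = \<omega>' e"
      and C: "{z. conn \<omega> A x z} = C" for \<omega> \<omega>'
  proof
    show "{z. conn \<omega>' A x z} \<subseteq> C"
    proof clarify
      fix z assume "conn \<omega>' A x z"
      then show "z \<in> C" using C
      proof (induction rule: conn.induct)
        case (conn_refl x) then show ?case using conn.conn_refl by blast
      next
        case (conn_step x y z)
        have y: "y \<in> C" using conn_step by blast
        then have "y \<in> A" using conn_in conn_step.hyps by blast
        then have "\<omega> {y, z}" using eq[of "{y, z}"] conn_step.hyps y by blast
        then have "conn \<omega> A x z" using y conn_step.hyps conn_step.prems by (intro conn.conn_step[of \<omega> A x y z]) auto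
        then show ?case using conn_step.prems by blast
      qed
    qed
    show "C \<subseteq> {z. conn \<omega>' A x z}"
    proof
      fix z assume "z \<in> C"
      then have "conn \<omega> A x z" using C by blast
      then show "z \<in> {z. conn \<omega>' A x z}" using C
      proof (induction rule: conn.induct)
        case (conn_refl x) then show ?case by (simp add: conn.conn_refl)
      next
        case (conn_step x y z)
        have y: "y \<in> C" using conn_step by blast
        then have "y \<in> A" using conn_in conn_step.hyps by blast
        then have "\<omega>' {y, z}" using eq[of "{y, z}"] conn_step.hyps y by blast
        moreover have "conn \<omega>' A x y" using conn_step.IH conn_step.prems by blast
        ultimately have "conn \<omega>' A x z" using conn_step.hyps by (intro conn.conn_step[of \<omega>' A x y z])
        then show ?case by simp
      qed
    qed
  qed
  show ?thesis
  proof (rule depends_onI, rule iffI)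
    fix \<omega> \<omega>' :: "'a set \<Rightarrow> bool" assume eq: "\<And>e. e \<in> ?F \<Longrightarrow> \<omega> e = \<omega>' e"
    show "?P \<omega>'" if "?P \<omega>" by (rule *[OF eq that])
    show "?P \<omega>" if "?P \<omega>'" by (rule *[OF eq[symmetric] that])
  qed
qed

text \<open>A Simon-type inequality without the BK inequality. Reveal the cluster \<open>C\<close> of \<open>x\<close> inside \<open>B\<close>; a path from \<open>x\<close> to
\<open>y\<close> leaves \<open>C\<close> for the last time through an open boundary edge of \<open>B\<close>, and continues
outside \<open>C\<close>. The three events depend on disjoint edge sets.\<close>

lemma simon_inequality:
  assumes p: "0 \<le> p" "p \<le> 1" and \<Lambda>: "finite \<Lambda>" "\<Lambda> \<subseteq> V" and B: "finite B" "B \<subseteq> V"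
    and x: "x \<in> \<Lambda>" "x \<in> B" and y: "y \<in> \<Lambda>" "y \<notin> B"
  shows "\<tau> p \<Lambda> x y \<le> (\<Sum>(u, w)\<in>boundary B. if w \<in> \<Lambda> then \<tau> p B x u * (p * \<tau> p \<Lambda> w y) else 0)"
proof -
  define A where "A = B \<inter> \<Lambda>"
  have A: "finite A" "A \<subseteq> V" "x \<in> A" "A \<subseteq> \<Lambda>" "A \<subseteq> B" using assms by (auto simp: A_def)
  \<comment> \<open>\<open>C\<close> is the cluster of \<open>x\<close> in \<open>B\<close>, and the edge from \<open>u\<close> to \<open>w\<close> the last exit from it.\<close>
  define Q where "Q = (\<lambda>(C, (u, w)) \<omega>. u \<in> C \<and> w \<in> \<Lambda> \<and> {z. conn \<omega> A x z} = C \<and> \<omega> {u, w} \<and> conn \<omega> (\<Lambda> - C) w y)"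
  have cl_pred: "Measurable.pred (perc p) (\<lambda>\<omega>. {z. conn \<omega> A x z} = C)" for C
    by (rule pred_finite[OF _ _ depends_cluster]) (use A in \<open>auto intro: finite_subset[OF _ finite_inside[OF A(1)]]\<close>)
  have edge_pred: "Measurable.pred (perc p) (\<lambda>\<omega>. \<omega> e)" "depends_on (perc p) {e} (\<lambda>\<omega>. \<omega> e)" if "e \<in> E" for e
    using that by (auto intro!: pred_finite[of "{e}"] simp: depends_on_def)
  have Q_pred: "Measurable.pred (perc p) (Q t)" if "t \<in> Pow A \<times> boundary B" for t
  proof -
    obtain C u w where t: "t = (C, (u, w))" by (metis prod.collapse)
    then have "{u, w} \<in> E" using that by (auto simp: boundary_def)
    then have "Measurable.pred (perc p) (\<lambda>\<omega>. \<omega> {u, w})" by (rule edge_pred)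
    moreover have "Measurable.pred (perc p) (\<lambda>\<omega>. conn \<omega> (\<Lambda> - C) w y)" using \<Lambda> by (intro pred_conn) auto
    ultimately show ?thesis using cl_pred unfolding Q_def t prod.case by (intro pred_intros_logic) auto
  qed
  have "\<tau> p \<Lambda> x y \<le> perc_prob p (\<lambda>\<omega>. \<exists>t\<in>Pow A \<times> boundary B. Q t \<omega>)"
  proof (rule perc_prob_mono)
    show "Measurable.pred (perc p) (\<lambda>\<omega>. \<exists>t\<in>Pow A \<times> boundary B. Q t \<omega>)"
      using Q_pred A finite_boundary[OF B(1)] by (intro pred_intros_finite) auto
    fix \<omega> assume c: "conn \<omega> \<Lambda> x y"
    define C where "C = {z. conn \<omega> A x z}"
    have C: "C \<subseteq> A" "x \<in> C" using conn_in conn_refl A by (auto simp: C_def)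
    have "y \<notin> C" using C y by (auto simp: A_def)
    then obtain u w where uw: "u \<in> C" "w \<in> \<Lambda> - C" "{u, w} \<in> E" "\<omega> {u, w}" "conn \<omega> (\<Lambda> - C) w y"
      using last_exit[OF c C(2)] by blast
    have "w \<notin> B"
    proof
      assume "w \<in> B"
      then have "w \<in> A" using uw by (simp add: A_def)
      then have "conn \<omega> A x w" using uw by (intro conn_step[of \<omega> A x u w]) (auto simp: C_def)
      then show False using uw by (simp add: C_def)
    qed
    then have "(u, w) \<in> boundary B" using uw C A \<Lambda> by (auto simp: boundary_def)
    moreover have "Q (C, (u, w)) \<omega>" using uw by (simp add: Q_def C_def)
    ultimately show "\<exists>t\<in>Pow A \<times> boundary B. Q t \<omega>" using C by (intro bexI[of _ "(C, (u, w))"]) auto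
  qed
  also have "\<dots> \<le> (\<Sum>t\<in>Pow A \<times> boundary B. perc_prob p (Q t))"
    using Q_pred A finite_boundary[OF B(1)] by (intro perc_prob_finite_union) auto
  also have "\<dots> \<le> (\<Sum>(C, (u, w))\<in>Pow A \<times> boundary B.
      if w \<in> \<Lambda> then perc_prob p (\<lambda>\<omega>. u \<in> C \<and> {z. conn \<omega> A x z} = C) * (p * \<tau> p \<Lambda> w y) else 0)"
  proof (rule sum_mono)
    fix t assume t: "t \<in> Pow A \<times> boundary B"
    obtain C u w where t': "t = (C, (u, w))" by (metis prod.collapse)
    have uw: "u \<in> B" "w \<in> V" "w \<notin> B" "{u, w} \<in> E" "C \<subseteq> A" using t by (auto simp: boundary_def t')
    have "perc_prob p (Q (C, (u, w))) \<le> perc_prob p (\<lambda>\<omega>. u \<in> C \<and> {z. conn \<omega> A x z} = C) * (p * \<tau> p \<Lambda> w y)"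
      if w: "w \<in> \<Lambda>"
    proof (cases "u \<in> C")
      case True
      have pc: "Measurable.pred (perc p) (\<lambda>\<omega>. conn \<omega> (\<Lambda> - C) w y)" using \<Lambda> by (intro pred_conn) auto
      have "perc_prob p (Q (C, (u, w))) = perc_prob p (\<lambda>\<omega>. {z. conn \<omega> A x z} = C \<and> (\<omega> {u, w} \<and> conn \<omega> (\<Lambda> - C) w y))"
        using True w by (simp add: Q_def)
      also have "\<dots> = perc_prob p (\<lambda>\<omega>. {z. conn \<omega> A x z} = C) * perc_prob p (\<lambda>\<omega>. \<omega> {u, w} \<and> conn \<omega> (\<Lambda> - C) w y)"
      proof (rule perc_prob_indep[OF _ _ _ cl_pred depends_cluster])
        show "{e \<in> E. e \<subseteq> A \<and> e \<inter> C \<noteq> {}} \<inter> insert {u, w} {e \<in> E. e \<subseteq> \<Lambda> - C} = {}"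
          using uw A by auto
        show "Measurable.pred (perc p) (\<lambda>\<omega>. \<omega> {u, w} \<and> conn \<omega> (\<Lambda> - C) w y)"
          using edge_pred[OF uw(4)] pc by (intro pred_intros_logic)
        show "depends_on (perc p) (insert {u, w} {e \<in> E. e \<subseteq> \<Lambda> - C}) (\<lambda>\<omega>. \<omega> {u, w} \<and> conn \<omega> (\<Lambda> - C) w y)"
          by (intro depends_on_compose2[where h="(\<and>)"] depends_on_mono[OF edge_pred(2)[OF uw(4)]] depends_on_mono[OF depends_conn]) auto
      qed (use uw in auto)
      finally have eq: "perc_prob p (Q (C, (u, w))) = perc_prob p (\<lambda>\<omega>. {z. conn \<omega> A x z} = C) * perc_prob p (\<lambda>\<omega>. \<omega> {u, w} \<and> conn \<omega> (\<Lambda> - C) w y)" .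
      have "perc_prob p (\<lambda>\<omega>. \<omega> {u, w} \<and> conn \<omega> (\<Lambda> - C) w y) = perc_prob p (\<lambda>\<omega>. \<omega> {u, w}) * \<tau> p (\<Lambda> - C) w y"
        by (rule perc_prob_indep[OF _ _ _ edge_pred[OF uw(4)] pc depends_conn]) (use uw True in auto)
      also have "perc_prob p (\<lambda>\<omega>. \<omega> {u, w}) = p" by (rule perc_prob_edge_open[OF uw(4) p])
      finally have eq2: "perc_prob p (\<lambda>\<omega>. \<omega> {u, w} \<and> conn \<omega> (\<Lambda> - C) w y) = p * \<tau> p (\<Lambda> - C) w y" .
      have "\<tau> p (\<Lambda> - C) w y \<le> \<tau> p \<Lambda> w y"
        by (rule perc_prob_mono[OF pred_conn[OF \<Lambda>(2)]]) (erule conn_mono, rule Diff_subset)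
      then have "perc_prob p (\<lambda>\<omega>. \<omega> {u, w} \<and> conn \<omega> (\<Lambda> - C) w y) \<le> p * \<tau> p \<Lambda> w y"
        unfolding eq2 by (rule mult_left_mono[OF _ p(1)])
      then have "perc_prob p (\<lambda>\<omega>. {z. conn \<omega> A x z} = C) * perc_prob p (\<lambda>\<omega>. \<omega> {u, w} \<and> conn \<omega> (\<Lambda> - C) w y)
        \<le> perc_prob p (\<lambda>\<omega>. {z. conn \<omega> A x z} = C) * (p * \<tau> p \<Lambda> w y)"
        by (rule mult_left_mono[OF _ measure_nonneg])
      then show ?thesis unfolding eq using True by (simp only: simp_thms)
    qed (simp add: Q_def p)
    moreover have "perc_prob p (Q (C, (u, w))) \<le> 0" if "w \<notin> \<Lambda>" using that by (simp add: Q_def)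
    ultimately show "perc_prob p (Q t) \<le> (case t of (C, (u, w)) \<Rightarrow>
      if w \<in> \<Lambda> then perc_prob p (\<lambda>\<omega>. u \<in> C \<and> {z. conn \<omega> A x z} = C) * (p * \<tau> p \<Lambda> w y) else 0)"
      unfolding t' prod.case by presburger
  qed
  also have "\<dots> = (\<Sum>(u, w)\<in>boundary B. \<Sum>C\<in>Pow A.
      if w \<in> \<Lambda> then perc_prob p (\<lambda>\<omega>. u \<in> C \<and> {z. conn \<omega> A x z} = C) * (p * \<tau> p \<Lambda> w y) else 0)"
    by (subst sum.cartesian_product[symmetric], subst sum.swap) (simp add: case_prod_unfold)
  also have "\<dots> \<le> (\<Sum>(u, w)\<in>boundary B. if w \<in> \<Lambda> then \<tau> p B x u * (p * \<tau> p \<Lambda> w y) else 0)"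
  proof (rule sum_mono, clarify)
    fix u w assume "(u, w) \<in> boundary B"
    have "(\<Sum>C\<in>Pow A. perc_prob p (\<lambda>\<omega>. u \<in> C \<and> {z. conn \<omega> A x z} = C)) =
        perc_prob p (\<lambda>\<omega>. \<exists>C\<in>Pow A. u \<in> C \<and> {z. conn \<omega> A x z} = C)"
      using A cl_pred by (intro perc_prob_disjoint_union[symmetric] pred_intros_logic) auto
    also have "\<dots> \<le> \<tau> p B x u"
      using B A by (intro perc_prob_mono pred_conn) (auto intro: conn_mono)
    finally have *: "(\<Sum>C\<in>Pow A. perc_prob p (\<lambda>\<omega>. u \<in> C \<and> {z. conn \<omega> A x z} = C)) \<le> \<tau> p B x u" .
    show "(\<Sum>C\<in>Pow A. if w \<in> \<Lambda> then perc_prob p (\<lambda>\<omega>. u \<in> C \<and> {z. conn \<omega> A x z} = C) * (p * \<tau> p \<Lambda> w y) else 0)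
      \<le> (if w \<in> \<Lambda> then \<tau> p B x u * (p * \<tau> p \<Lambda> w y) else 0)"
      using mult_right_mono[OF *, of "p * \<tau> p \<Lambda> w y"] p by (simp add: sum_distrib_right)
  qed
  finally show ?thesis .
qed

text \<open>Apply the Simon-type inequality at every \<open>x\<close> to the translate of \<open>B\<close> and sum over \<open>y\<close>: the maximum \<open>m\<close> of
the expected cluster size over starting points in \<open>\<Lambda>\<close> satisfies \<open>m \<le> card B + \<phi> m\<close>. The finite
volume guarantees that \<open>m\<close> is finite.\<close>

lemma susceptibility_finite_volume:
  assumes p: "0 \<le> p" "p \<le> 1" and B: "finite B" "B \<subseteq> V" "v \<in> B" and \<phi>: "\<phi> p v B < 1"
    and \<Lambda>: "finite \<Lambda>" "\<Lambda> \<subseteq> V" and x: "x \<in> \<Lambda>"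
  shows "(\<Sum>y\<in>\<Lambda>. \<tau> p \<Lambda> x y) \<le> real (card B) / (1 - \<phi> p v B)"
proof -
  define f where "f x = (\<Sum>y\<in>\<Lambda>. \<tau> p \<Lambda> x y)" for x
  define m where "m = Max (f ` \<Lambda>)"
  have f_le: "f x \<le> m" if "x \<in> \<Lambda>" for x using that \<Lambda> by (auto simp: m_def)
  have f_nn: "0 \<le> f x" for x by (auto simp: f_def intro: sum_nonneg)
  have step: "f x \<le> real (card B) + \<phi> p v B * m" if x: "x \<in> \<Lambda>" for x
  proof -
    have vV: "v \<in> V" and xV: "x \<in> V" using B x \<Lambda> by auto
    define g where "g = x \<otimes> inv v"
    have g: "g \<in> V" "g \<otimes> v = x" using vV xV by (auto simp: g_def m_assoc)
    define B' where "B' = (\<lambda>x. g \<otimes> x) ` B"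
    have B': "finite B'" "B' \<subseteq> V" "x \<in> B'" "card B' \<le> card B"
      using B g by (auto simp: B'_def intro: card_image_le)
    have inj: "inj_on (\<lambda>(u, w). (g \<otimes> u, g \<otimes> w)) (boundary B)"
    proof (rule inj_onI, clarify)
      fix a b c d assume h: "(a, b) \<in> boundary B" "(c, d) \<in> boundary B" "g \<otimes> a = g \<otimes> c" "g \<otimes> b = g \<otimes> d"
      have V: "a \<in> V" "b \<in> V" "c \<in> V" "d \<in> V" using h(1,2) B by (auto simp: boundary_def)
      show "a = c \<and> b = d"
        using V h(3,4) g(1) by simp
    qed
    have \<phi>': "p * (\<Sum>(u, w)\<in>boundary B'. \<tau> p B' x u) = \<phi> p v B"
    proof -
      have "(\<Sum>(u, w)\<in>boundary B'. \<tau> p B' x u) = (\<Sum>(u, w)\<in>boundary B. \<tau> p B' x (g \<otimes> u))"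
        unfolding B'_def boundary_translate[OF g(1) B(2)]
        by (subst sum.reindex[OF inj]) (simp add: case_prod_unfold comp_def)
      also have "\<dots> = (\<Sum>(u, w)\<in>boundary B. \<tau> p B v u)"
      proof (intro sum.cong refl, clarify)
        fix u w assume "(u, w) \<in> boundary B"
        then have "u \<in> V" using B by (auto simp: boundary_def)
        then show "\<tau> p B' x (g \<otimes> u) = \<tau> p B v u"
          using \<tau>_translate[OF g(1) B(2) vV, of u p] by (simp add: B'_def g)
      qed
      finally show ?thesis by (simp add: \<phi>_def)
    qed
    have "f x = (\<Sum>y\<in>\<Lambda> \<inter> B'. \<tau> p \<Lambda> x y) + (\<Sum>y\<in>\<Lambda> - B'. \<tau> p \<Lambda> x y)"
      unfolding f_def using \<Lambda> by (subst sum.union_disjoint[symmetric]) (auto intro: sum.cong)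
    also have "(\<Sum>y\<in>\<Lambda> \<inter> B'. \<tau> p \<Lambda> x y) \<le> (\<Sum>y\<in>\<Lambda> \<inter> B'. 1)"
      by (intro sum_mono perc_prob_le_1)
    also have "(\<Sum>y\<in>\<Lambda> \<inter> B'. 1) \<le> real (card B)"
      using B' card_mono[of B' "\<Lambda> \<inter> B'"] by simp
    also have "(\<Sum>y\<in>\<Lambda> - B'. \<tau> p \<Lambda> x y) \<le>
        (\<Sum>y\<in>\<Lambda> - B'. \<Sum>(u, w)\<in>boundary B'. if w \<in> \<Lambda> then \<tau> p B' x u * (p * \<tau> p \<Lambda> w y) else 0)"
      using p \<Lambda> B' x by (intro sum_mono simon_inequality) auto
    also have "\<dots> = (\<Sum>(u, w)\<in>boundary B'. \<Sum>y\<in>\<Lambda> - B'. if w \<in> \<Lambda> then \<tau> p B' x u * (p * \<tau> p \<Lambda> w y) else 0)"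
      by (subst sum.swap) (simp add: case_prod_unfold)
    also have "\<dots> \<le> (\<Sum>(u, w)\<in>boundary B'. p * \<tau> p B' x u * m)"
    proof (rule sum_mono, clarify)
      fix u w assume "(u, w) \<in> boundary B'"
      have m0: "0 \<le> m" using f_le[OF x] f_nn[of x] by linarith
      show "(\<Sum>y\<in>\<Lambda> - B'. if w \<in> \<Lambda> then \<tau> p B' x u * (p * \<tau> p \<Lambda> w y) else 0) \<le> p * \<tau> p B' x u * m"
      proof (cases "w \<in> \<Lambda>")
        case True
        have "(\<Sum>y\<in>\<Lambda> - B'. \<tau> p \<Lambda> w y) \<le> f w"
          unfolding f_def using \<Lambda> by (intro sum_mono2) auto
        also have "\<dots> \<le> m" using f_le[OF True] .
        finally have "p * \<tau> p B' x u * (\<Sum>y\<in>\<Lambda> - B'. \<tau> p \<Lambda> w y) \<le> p * \<tau> p B' x u * m"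
          using p by (intro mult_left_mono) auto
        then show ?thesis using True by (simp add: sum_distrib_left mult_ac)
      next
        case False
        then show ?thesis using p m0 by simp
      qed
    qed
    also have "\<dots> = \<phi> p v B * m"
      unfolding \<phi>'[symmetric] by (simp add: sum_distrib_left sum_distrib_right case_prod_unfold)
    finally show ?thesis by simp
  qed
  have "m \<in> f ` \<Lambda>" unfolding m_def using \<Lambda> x by (intro Max_in) auto
  then have "m \<le> real (card B) + \<phi> p v B * m" using step by auto
  then have "m * (1 - \<phi> p v B) \<le> real (card B)" by (simp add: algebra_simps)
  then have "m \<le> real (card B) / (1 - \<phi> p v B)" using \<phi> by (simp add: pos_le_divide_eq)
  then show ?thesis using f_le[OF x] by (simp add: f_def)
qed

lemma \<tau>_limit:
  shows "(\<lambda>n. \<tau> p (wball n) x y) \<longlonglongrightarrow> \<tau> p V x y"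
proof -
  interpret prob_space "perc p" by (rule prob_space_perc)
  have un: "(\<Union>n. {\<omega> \<in> space (perc p). conn \<omega> (wball n) x y}) = {\<omega> \<in> space (perc p). conn \<omega> V x y}"
  proof (intro Set.set_eqI iffI)
    fix \<omega> assume "\<omega> \<in> {\<omega> \<in> space (perc p). conn \<omega> V x y}"
    then have "\<omega> \<in> space (perc p)" "conn \<omega> V x y" by auto
    moreover from this obtain n where "conn \<omega> (V \<inter> wball n) x y" using conn_exhaust by blast
    ultimately show "\<omega> \<in> (\<Union>n. {\<omega> \<in> space (perc p). conn \<omega> (wball n) x y})"
      using conn_mono[OF _ Int_lower2] by blast
  qed (use conn_mono[OF _ wball_sub] in blast)
  have "(\<lambda>n. \<tau> p (wball n) x y) \<longlonglongrightarrow> measure (perc p) (\<Union>n. {\<omega> \<in> space (perc p). conn \<omega> (wball n) x y})"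
  proof (rule finite_Lim_measure_incseq)
    show "range (\<lambda>n. {\<omega> \<in> space (perc p). conn \<omega> (wball n) x y}) \<subseteq> sets (perc p)"
      using pred_conn[OF wball_sub] by (auto simp: pred_def)
    show "incseq (\<lambda>n. {\<omega> \<in> space (perc p). conn \<omega> (wball n) x y})"
      unfolding incseq_def using conn_mono[OF _ wball_mono] by blast
  qed
  then show ?thesis unfolding un .
qed

text \<open>The finite-volume bound is uniform in the volume, so it passes to the limit.\<close>

lemma susceptibility_bound:
  assumes p: "0 \<le> p" "p \<le> 1" and B: "finite B" "B \<subseteq> V" "v \<in> B" and \<phi>: "\<phi> p v B < 1"
    and Y: "finite Y" "Y \<subseteq> V" and x: "x \<in> V"
  shows "(\<Sum>y\<in>Y. \<tau> p V x y) \<le> real (card B) / (1 - \<phi> p v B)"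
proof (rule LIMSEQ_le_const2)
  show "(\<lambda>n. \<Sum>y\<in>Y. \<tau> p (wball n) x y) \<longlonglongrightarrow> (\<Sum>y\<in>Y. \<tau> p V x y)"
    by (intro tendsto_sum \<tau>_limit)
  obtain n0 where n0: "insert x Y \<subseteq> wball n0" using finite_sub_wball[of "insert x Y"] Y x by auto
  show "\<exists>N. \<forall>n\<ge>N. (\<Sum>y\<in>Y. \<tau> p (wball n) x y) \<le> real (card B) / (1 - \<phi> p v B)"
  proof (intro exI allI impI)
    fix n assume "n \<ge> n0"
    then have sub: "insert x Y \<subseteq> wball n" using n0 wball_mono by blast
    have "(\<Sum>y\<in>Y. \<tau> p (wball n) x y) \<le> (\<Sum>y\<in>wball n. \<tau> p (wball n) x y)"
      using sub by (intro sum_mono2) auto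
    also have "\<dots> \<le> real (card B) / (1 - \<phi> p v B)"
      using p B \<phi> sub wball_sub by (intro susceptibility_finite_volume) auto
    finally show "(\<Sum>y\<in>Y. \<tau> p (wball n) x y) \<le> real (card B) / (1 - \<phi> p v B)" .
  qed
qed

end

lemma pred_countable_Bex:
  assumes "countable X" "\<And>i. i \<in> X \<Longrightarrow> Measurable.pred M (P i)"
  shows "Measurable.pred M (\<lambda>x. \<exists>i\<in>X. P i x)"
proof -
  have "{x \<in> space M. \<exists>i\<in>X. P i x} = (\<Union>i\<in>X. {x \<in> space M. P i x})" by blast
  also have "\<dots> \<in> sets M" using assms by (intro sets.countable_UN'' predE)
  finally show ?thesis unfolding pred_def .
qed

context cayley
begin

section \<open>Sharpness of the phase transition\<close>

text \<open>Connection of \<open>x\<close> to the complement of \<open>\<Lambda>\<close>. The definition propagates backwards from the complement,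
which makes the determination of the set of vertices that do not escape a direct induction.\<close>

inductive escapes :: "('a set \<Rightarrow> bool) \<Rightarrow> 'a set \<Rightarrow> 'a \<Rightarrow> bool" for \<omega> \<Lambda> where
  escapes_base: "x \<in> \<Lambda> \<Longrightarrow> w \<in> V - \<Lambda> \<Longrightarrow> {x, w} \<in> E \<Longrightarrow> \<omega> {x, w} \<Longrightarrow> escapes \<omega> \<Lambda> x"
| escapes_step: "x \<in> \<Lambda> \<Longrightarrow> escapes \<omega> \<Lambda> y \<Longrightarrow> {x, y} \<in> E \<Longrightarrow> \<omega> {x, y} \<Longrightarrow> escapes \<omega> \<Lambda> x"

lemma escapes_imp_conn: "escapes \<omega> \<Lambda> x \<Longrightarrow> \<Lambda> \<subseteq> V \<Longrightarrow> \<exists>w\<in>V - \<Lambda>. conn \<omega> V x w"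
proof (induction rule: escapes.induct)
  case (escapes_base x w)
  then have "conn \<omega> V x w" by (intro conn_edge) auto
  then show ?case using escapes_base by blast
next
  case (escapes_step x y)
  then obtain w where w: "w \<in> V - \<Lambda>" "conn \<omega> V y w" by blast
  have "conn \<omega> V x y" using escapes_step conn_in[OF w(2)] by (intro conn_edge) auto
  then show ?case using w conn_trans by blast
qed

lemma escapes_conn: "conn \<omega> \<Lambda> x u \<Longrightarrow> escapes \<omega> \<Lambda> u \<Longrightarrow> escapes \<omega> \<Lambda> x"
proof (induction rule: conn.induct)
  case (conn_step x y z)
  then have "escapes \<omega> \<Lambda> y" using conn_in by (intro escapes_step[of y \<Lambda> \<omega> z]) auto
  then show ?case using conn_step by blast
qed simp

lemma escapes_mono_open: "escapes \<omega> \<Lambda> x \<Longrightarrow> (\<And>e. e \<in> E \<Longrightarrow> e \<inter> \<Lambda> \<noteq> {} \<Longrightarrow> \<omega> e \<Longrightarrow> \<omega>' e) \<Longrightarrow> escapes \<omega>' \<Lambda> x"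
proof (induction rule: escapes.induct)
  case (escapes_base x w)
  then have "\<omega>' {x, w}" by blast
  then show ?case using escapes_base escapes.escapes_base[of x \<Lambda> w \<omega>'] by blast
next
  case (escapes_step x y)
  then have "\<omega>' {x, y}" by blast
  then show ?case using escapes_step escapes.escapes_step[of x \<Lambda> \<omega>' y] by blast
qed

lemma depends_escapes: "depends_on (perc p) {e \<in> E. e \<inter> \<Lambda> \<noteq> {}} (\<lambda>\<omega>. escapes \<omega> \<Lambda> x)"
proof (rule depends_onI, rule iffI)
  fix \<omega> \<omega>' :: "'a set \<Rightarrow> bool" assume *: "\<And>e. e \<in> {e \<in> E. e \<inter> \<Lambda> \<noteq> {}} \<Longrightarrow> \<omega> e = \<omega>' e"
  show "escapes \<omega>' \<Lambda> x" if "escapes \<omega> \<Lambda> x" using escapes_mono_open[OF that, of \<omega>'] * by blast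
  show "escapes \<omega> \<Lambda> x" if "escapes \<omega>' \<Lambda> x" using escapes_mono_open[OF that, of \<omega>] * by blast
qed

lemma pred_escapes: "finite \<Lambda> \<Longrightarrow> Measurable.pred (perc p) (\<lambda>\<omega>. escapes \<omega> \<Lambda> x)"
  by (rule pred_finite[OF _ _ depends_escapes]) (auto intro: finite_touching)

text \<open>Exploring from outside reveals only edges with an endpoint that escapes. Hence, given the
set \<open>Z\<close> of vertices that do not escape, the edges inside \<open>Z\<close> are still fresh.\<close>

lemma depends_unreached:
  "depends_on (perc p) {e \<in> E. e \<inter> \<Lambda> \<noteq> {} \<and> \<not> e \<subseteq> Z} (\<lambda>\<omega>. {z \<in> \<Lambda>. \<not> escapes \<omega> \<Lambda> z} = Z)"
  (is "depends_on _ ?F ?P")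
proof -
  have *: "{z \<in> \<Lambda>. \<not> escapes \<omega>' \<Lambda> z} = Z"
    if eq: "\<And>e. e \<in> {e \<in> E. e \<inter> \<Lambda> \<noteq> {} \<and> \<not> e \<subseteq> Z} \<Longrightarrow> \<omega> e = \<omega>' e"
      and Z: "{z \<in> \<Lambda>. \<not> escapes \<omega> \<Lambda> z} = Z" for \<omega> \<omega>'
  proof -
    have 1: "escapes \<omega>' \<Lambda> x" if "escapes \<omega> \<Lambda> x" for x
      using that
    proof (induction rule: escapes.induct)
      case (escapes_base x w)
      have "w \<notin> Z" using escapes_base Z by blast
      then have "\<omega>' {x, w}" using eq[of "{x, w}"] escapes_base by blast
      then show ?case using escapes_base escapes.escapes_base[of x \<Lambda> w \<omega>'] by blast
    next
      case (escapes_step x y)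
      have "y \<notin> Z" using escapes_step Z by blast
      then have "\<omega>' {x, y}" using eq[of "{x, y}"] escapes_step by blast
      then show ?case using escapes_step escapes.escapes_step[of x \<Lambda> \<omega>' y] by blast
    qed
    have 2: "escapes \<omega> \<Lambda> x" if "escapes \<omega>' \<Lambda> x" for x
      using that
    proof (induction rule: escapes.induct)
      case (escapes_base x w)
      have "w \<notin> Z" using escapes_base Z by blast
      then have "\<omega> {x, w}" using eq[of "{x, w}"] escapes_base by blast
      then show ?case using escapes_base escapes.escapes_base[of x \<Lambda> w \<omega>] by blast
    next
      case (escapes_step x y)
      have "y \<notin> Z" using escapes_step Z by blast
      then have "\<omega> {x, y}" using eq[of "{x, y}"] escapes_step by blast
      then show ?case using escapes_step escapes.escapes_step[of x \<Lambda> \<omega> y] by blast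
    qed
    show ?thesis using 1 2 Z by blast
  qed
  show ?thesis
  proof (rule depends_onI, rule iffI)
    fix \<omega> \<omega>' :: "'a set \<Rightarrow> bool" assume eq: "\<And>e. e \<in> ?F \<Longrightarrow> \<omega> e = \<omega>' e"
    show "?P \<omega>'" if "?P \<omega>" by (rule *[OF eq that])
    show "?P \<omega>" if "?P \<omega>'" by (rule *[OF eq[symmetric] that])
  qed
qed

text \<open>Two independent configurations, realised as one product over two copies of the edge set so that
independence of events on disjoint coordinates covers both configurations at once.\<close>

definition double_perc :: "real \<Rightarrow> real \<Rightarrow> ('a set + 'a set \<Rightarrow> bool) measure" where
  "double_perc q \<delta> = (\<Pi>\<^sub>M i\<in>E <+> E. measure_pmf (case i of Inl _ \<Rightarrow> bernoulli_pmf q | Inr _ \<Rightarrow> bernoulli_pmf \<delta>))"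

abbreviation first_config :: "('a set + 'a set \<Rightarrow> bool) \<Rightarrow> 'a set \<Rightarrow> bool" where "first_config X \<equiv> (\<lambda>e\<in>E. X (Inl e))"
abbreviation second_config :: "('a set + 'a set \<Rightarrow> bool) \<Rightarrow> 'a set \<Rightarrow> bool" where "second_config X \<equiv> (\<lambda>e\<in>E. X (Inr e))"
abbreviation joined_config :: "('a set + 'a set \<Rightarrow> bool) \<Rightarrow> 'a set \<Rightarrow> bool" where "joined_config X \<equiv> (\<lambda>e\<in>E. X (Inl e) \<or> X (Inr e))"

lemma prob_space_double_perc: "prob_space (double_perc q \<delta>)"
  unfolding double_perc_def by (intro prob_space_PiM measure_pmf.prob_space_axioms)

lemma first_config_measurable: "first_config \<in> measurable (double_perc q \<delta>) (perc q)"
  and second_config_measurable: "second_config \<in> measurable (double_perc q \<delta>) (perc \<delta>)"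
  unfolding double_perc_def percolation_def
  by (intro measurable_restrict, rule measurable_compose[OF measurable_component_singleton], auto)+

lemma distr_first_config: "distr (double_perc q \<delta>) (perc q) first_config = perc q"
  using distr_PiM_reindex[of "E <+> E" "\<lambda>i. measure_pmf (case i of Inl _ \<Rightarrow> bernoulli_pmf q | Inr _ \<Rightarrow> bernoulli_pmf \<delta>)" Inl E]
  unfolding double_perc_def percolation_def by (simp add: measure_pmf.prob_space_axioms Pi_I InlI)

lemma distr_second_config: "distr (double_perc q \<delta>) (perc \<delta>) second_config = perc \<delta>"
  using distr_PiM_reindex[of "E <+> E" "\<lambda>i. measure_pmf (case i of Inl _ \<Rightarrow> bernoulli_pmf q | Inr _ \<Rightarrow> bernoulli_pmf \<delta>)" Inr E]
  unfolding double_perc_def percolation_def by (simp add: measure_pmf.prob_space_axioms Pi_I InrI)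

lemma double_perc_coord:
  assumes "i \<in> E <+> E"
  shows "Measurable.pred (double_perc q \<delta>) (\<lambda>X. X i)" "depends_on (double_perc q \<delta>) {i} (\<lambda>X. X i)"
proof -
  have "(\<lambda>X. X i) \<in> measurable (double_perc q \<delta>) (measure_pmf (case i of Inl _ \<Rightarrow> bernoulli_pmf q | Inr _ \<Rightarrow> bernoulli_pmf \<delta>))"
    unfolding double_perc_def by (rule measurable_component_singleton[OF assms])
  then show "Measurable.pred (double_perc q \<delta>) (\<lambda>X. X i)" by simp
qed (simp add: depends_on_def)

lemma double_perc_indep:
  assumes "J \<subseteq> E <+> E" "K \<subseteq> E <+> E" "J \<inter> K = {}"
    and "Measurable.pred (double_perc q \<delta>) P" "depends_on (double_perc q \<delta>) J P"
    and "Measurable.pred (double_perc q \<delta>) Q" "depends_on (double_perc q \<delta>) K Q"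
  shows "measure (double_perc q \<delta>) {X \<in> space (double_perc q \<delta>). P X \<and> Q X} =
    measure (double_perc q \<delta>) {X \<in> space (double_perc q \<delta>). P X} * measure (double_perc q \<delta>) {X \<in> space (double_perc q \<delta>). Q X}"
  using assms unfolding double_perc_def
  by (intro PiM_indep_events[where J=J and K=K] measure_pmf.prob_space_axioms predE)

lemma double_perc_both_closed:
  assumes e: "e \<in> E" and q: "0 \<le> q" "q \<le> 1" "0 \<le> \<delta>" "\<delta> \<le> 1"
  shows "measure (double_perc q \<delta>) {X \<in> space (double_perc q \<delta>). \<not> X (Inl e) \<and> \<not> X (Inr e)} = (1 - q) * (1 - \<delta>)"
proof -
  have c: "measure (double_perc q \<delta>) {X \<in> space (double_perc q \<delta>). \<not> X i} =
      pmf (case i of Inl _ \<Rightarrow> bernoulli_pmf q | Inr _ \<Rightarrow> bernoulli_pmf \<delta>) False" if "i \<in> E <+> E" for i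
  proof -
    have "emeasure (double_perc q \<delta>) {X\<in>space (double_perc q \<delta>). X i \<in> {False}} =
        emeasure (measure_pmf (case i of Inl _ \<Rightarrow> bernoulli_pmf q | Inr _ \<Rightarrow> bernoulli_pmf \<delta>)) {False}"
      unfolding double_perc_def using that
      by (intro product_prob_space.emeasure_PiM_Collect_single product_prob_spaceI measure_pmf.prob_space_axioms) auto
    then show ?thesis by (simp add: measure_def emeasure_pmf_single)
  qed
  have "measure (double_perc q \<delta>) {X \<in> space (double_perc q \<delta>). \<not> X (Inl e) \<and> \<not> X (Inr e)} =
    measure (double_perc q \<delta>) {X \<in> space (double_perc q \<delta>). \<not> X (Inl e)} * measure (double_perc q \<delta>) {X \<in> space (double_perc q \<delta>). \<not> X (Inr e)}"
    using e by (intro double_perc_indep[where J="{Inl e}" and K="{Inr e}"] pred_intros_logic double_perc_coord depends_on_compose[where h=Not]) auto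
  also have "\<dots> = (1 - q) * (1 - \<delta>)"
    using q by (simp add: c[OF InlI[OF e]] c[OF InrI[OF e]])
  finally show ?thesis .
qed

lemma joined_config_measurable: "joined_config \<in> measurable (double_perc q \<delta>) (perc p)"
proof -
  have "(\<lambda>X. X (Inl e) \<or> X (Inr e)) \<in> measurable (double_perc q \<delta>) (measure_pmf (bernoulli_pmf p))" if "e \<in> E" for e
    using double_perc_coord(1)[OF InlI[OF that], of q \<delta>] double_perc_coord(1)[OF InrI[OF that], of q \<delta>] by (simp add: pred_intros_logic)
  then show ?thesis unfolding percolation_def by (rule measurable_restrict)
qed

text \<open>The union of independent configurations of densities \<open>q\<close> and \<open>\<delta>\<close> is percolation of density
\<open>1 - (1 - q)(1 - \<delta>)\<close>, because an edge is closed in the union iff it is closed in both.\<close>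

lemma distr_joined_config:
  assumes q: "0 \<le> q" "q \<le> 1" "0 \<le> \<delta>" "\<delta> \<le> 1"
  shows "distr (double_perc q \<delta>) (perc (1 - (1 - q) * (1 - \<delta>))) joined_config = perc (1 - (1 - q) * (1 - \<delta>))"
proof -
  define p where "p = 1 - (1 - q) * (1 - \<delta>)"
  have p: "0 \<le> p" "p \<le> 1" using q by (auto simp: p_def intro: mult_le_one)
  interpret X: prob_space "double_perc q \<delta>" by (rule prob_space_double_perc)
  interpret B: product_prob_space "\<lambda>_. measure_pmf (bernoulli_pmf p)" E
    by (intro product_prob_spaceI measure_pmf.prob_space_axioms)
  have pr: "Measurable.pred (double_perc q \<delta>) (\<lambda>X. (X (Inl e) \<or> X (Inr e)) \<in> F)"
    "depends_on (double_perc q \<delta>) {Inl e, Inr e} (\<lambda>X. (X (Inl e) \<or> X (Inr e)) \<in> F)" if "e \<in> E" for e F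
  proof -
    have "Measurable.pred (double_perc q \<delta>) (\<lambda>X. X (Inl e) \<or> X (Inr e))"
      using that by (intro pred_intros_logic double_perc_coord) auto
    then show "Measurable.pred (double_perc q \<delta>) (\<lambda>X. (X (Inl e) \<or> X (Inr e)) \<in> F)"
      by (rule measurable_compose) simp
  qed (auto simp: depends_on_def)
  have one: "X.prob {X \<in> space (double_perc q \<delta>). (X (Inl e) \<or> X (Inr e)) \<in> F} = measure (measure_pmf (bernoulli_pmf p)) F"
    if e: "e \<in> E" for e F
  proof -
    have f: "X.prob {X \<in> space (double_perc q \<delta>). \<not> (X (Inl e) \<or> X (Inr e))} = 1 - p"
      using double_perc_both_closed[OF e q] by (simp add: p_def)
    have "{X \<in> space (double_perc q \<delta>). X (Inl e) \<or> X (Inr e)} \<in> sets (double_perc q \<delta>)"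
      using pr(1)[OF e, of "{True}"] by (simp add: pred_def)
    from X.prob_neg[OF this] f
    have t: "X.prob {X \<in> space (double_perc q \<delta>). X (Inl e) \<or> X (Inr e)} = p"
      by linarith
    consider "True \<in> F" "False \<in> F" | "True \<in> F" "False \<notin> F" | "True \<notin> F" "False \<in> F" | "True \<notin> F" "False \<notin> F"
      by blast
    then show ?thesis
    proof cases
      case 1
      have "b \<in> F" for b using 1 by (cases b) simp_all
      then have "F = UNIV" by blast
      then show ?thesis by (simp add: X.prob_space)
    next
      case 2
      have F: "b \<in> F \<longleftrightarrow> b" for b using 2 by (cases b) simp_all
      have "F = {True}" using F by blast
      then have "measure (measure_pmf (bernoulli_pmf p)) F = p" using p by (simp add: measure_pmf_single)
      then show ?thesis unfolding F using t by simp
    next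
      case 3
      have F: "b \<in> F \<longleftrightarrow> \<not> b" for b using 3 by (cases b) simp_all
      have "F = {False}" using F by blast
      then have "measure (measure_pmf (bernoulli_pmf p)) F = 1 - p" using p by (simp add: measure_pmf_single)
      then show ?thesis unfolding F using f by simp
    next
      case 4
      have F: "b \<notin> F" for b using 4 by (cases b) simp_all
      then have "F = {}" by blast
      then show ?thesis by simp
    qed
  qed
  have fin: "X.prob {X \<in> space (double_perc q \<delta>). \<forall>e\<in>J. (X (Inl e) \<or> X (Inr e)) \<in> F e} =
      (\<Prod>e\<in>J. measure (measure_pmf (bernoulli_pmf p)) (F e))" if "finite J" "J \<subseteq> E" for J F
    using that
  proof (induction rule: finite_induct)
    case (insert a J)
    have "X.prob {X \<in> space (double_perc q \<delta>). (X (Inl a) \<or> X (Inr a)) \<in> F a \<and> (\<forall>e\<in>J. (X (Inl e) \<or> X (Inr e)) \<in> F e)} =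
        X.prob {X \<in> space (double_perc q \<delta>). (X (Inl a) \<or> X (Inr a)) \<in> F a} *
        X.prob {X \<in> space (double_perc q \<delta>). \<forall>e\<in>J. (X (Inl e) \<or> X (Inr e)) \<in> F e}"
    proof (rule double_perc_indep[OF _ _ _ pr])
      show "{Inl a, Inr a} \<inter> (J <+> J) = {}" using insert by auto
      show "Measurable.pred (double_perc q \<delta>) (\<lambda>X. \<forall>e\<in>J. (X (Inl e) \<or> X (Inr e)) \<in> F e)"
        using insert pr(1) by (intro pred_intros_finite) auto
      show "depends_on (double_perc q \<delta>) (J <+> J) (\<lambda>X. \<forall>e\<in>J. (X (Inl e) \<or> X (Inr e)) \<in> F e)"
        by (rule depends_onI) (auto simp: Plus_def)
    qed (use insert in auto)
    then show ?case using insert one by (simp add: conj_commute)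
  qed (simp add: X.prob_space)
  have "distr (double_perc q \<delta>) (perc p) joined_config = (\<Pi>\<^sub>M e\<in>E. measure_pmf (bernoulli_pmf p))"
  proof (rule B.PiM_eq)
    fix J F assume J: "finite J" "J \<subseteq> E"
    have m: "prod_emb E (\<lambda>_. measure_pmf (bernoulli_pmf p)) J (Pi\<^sub>E J F) \<in> sets (perc p)"
      unfolding percolation_def using J by (intro sets_PiM_I) auto
    have "emeasure (distr (double_perc q \<delta>) (perc p) joined_config) (prod_emb E (\<lambda>_. measure_pmf (bernoulli_pmf p)) J (Pi\<^sub>E J F))
      = emeasure (double_perc q \<delta>) {X \<in> space (double_perc q \<delta>). \<forall>e\<in>J. (X (Inl e) \<or> X (Inr e)) \<in> F e}"
      unfolding emeasure_distr[OF joined_config_measurable m]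
      using J by (intro arg_cong2[where f=emeasure] refl) (auto simp: prod_emb_def PiE_iff subset_iff)
    also have "\<dots> = (\<Prod>e\<in>J. emeasure (measure_pmf (bernoulli_pmf p)) (F e))"
      unfolding X.emeasure_eq_measure fin[OF J]
      by (simp add: measure_pmf.emeasure_eq_measure prod_ennreal)
    finally show "emeasure (distr (double_perc q \<delta>) (perc p) joined_config) (prod_emb E (\<lambda>_. measure_pmf (bernoulli_pmf p)) J (Pi\<^sub>E J F))
      = (\<Prod>e\<in>J. emeasure (measure_pmf (bernoulli_pmf p)) (F e))" .
  qed (simp add: percolation_def)
  then show ?thesis unfolding p_def[symmetric] by (simp add: percolation_def)
qed

text \<open>Computes percolation probabilities on a larger probability space.\<close>

lemma perc_prob_via:
  assumes "f \<in> measurable M (perc p)" "distr M (perc p) f = perc p" "Measurable.pred (perc p) Q"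
  shows "perc_prob p Q = measure M {X \<in> space M. Q (f X)}"
proof -
  have "perc_prob p Q = measure (distr M (perc p) f) {\<omega>\<in>space (perc p). Q \<omega>}" by (simp only: assms(2))
  also have "\<dots> = measure M (f -` {\<omega>\<in>space (perc p). Q \<omega>} \<inter> space M)"
    using assms by (intro measure_distr) (auto simp: pred_def)
  also have "f -` {\<omega>\<in>space (perc p). Q \<omega>} \<inter> space M = {X \<in> space M. Q (f X)}"
    using measurable_space[OF assms(1)] by auto
  finally show ?thesis .
qed

text \<open>An increasing event gains at least the probability of disjoint scenarios in which it fails
before and holds after the sprinkling \<open>\<eta>\<close>. This plays the role of Russo's formula: the scenarios used
below are that \<open>\<eta>\<close> opens exactly one edge and this edge is pivotal.\<close>

lemma sprinkling:
  assumes q: "0 \<le> q" "q \<le> 1" "0 \<le> \<delta>" "\<delta> \<le> 1" and p: "p = 1 - (1 - q) * (1 - \<delta>)"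
    and Q: "\<And>r. Measurable.pred (perc r) Q" and mono: "\<And>\<omega> \<omega>'. Q \<omega> \<Longrightarrow> (\<And>e. e \<in> E \<Longrightarrow> \<omega> e \<Longrightarrow> \<omega>' e) \<Longrightarrow> Q \<omega>'"
    and I: "finite I" and P: "\<And>i. i \<in> I \<Longrightarrow> Measurable.pred (perc q) (P i)"
    and R: "\<And>i. i \<in> I \<Longrightarrow> Measurable.pred (perc \<delta>) (R i)"
    and piv: "\<And>i \<omega> \<eta>. i \<in> I \<Longrightarrow> P i \<omega> \<Longrightarrow> R i \<eta> \<Longrightarrow> \<not> Q \<omega> \<and> Q (\<lambda>e\<in>E. \<omega> e \<or> \<eta> e)"
    and disj: "\<And>i j \<omega> \<eta>. i \<in> I \<Longrightarrow> j \<in> I \<Longrightarrow> P i \<omega> \<Longrightarrow> R i \<eta> \<Longrightarrow> P j \<omega> \<Longrightarrow> R j \<eta> \<Longrightarrow> i = j"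
  shows "perc_prob q Q + (\<Sum>i\<in>I. perc_prob q (P i) * perc_prob \<delta> (R i)) \<le> perc_prob p Q"
proof -
  interpret X: prob_space "double_perc q \<delta>" by (rule prob_space_double_perc)
  define A where "A i = {X \<in> space (double_perc q \<delta>). P i (first_config X) \<and> R i (second_config X)}" for i
  define A0 where "A0 = {X \<in> space (double_perc q \<delta>). Q (first_config X)}"
  have ml: "Measurable.pred (double_perc q \<delta>) (\<lambda>X. T (first_config X))" if "Measurable.pred (perc q) T" for T
    by (rule measurable_compose[OF first_config_measurable that])
  have mr: "Measurable.pred (double_perc q \<delta>) (\<lambda>X. T (second_config X))" if "Measurable.pred (perc \<delta>) T" for T
    by (rule measurable_compose[OF second_config_measurable that])
  have mj: "Measurable.pred (double_perc q \<delta>) (\<lambda>X. Q (joined_config X))"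
    by (rule measurable_compose[OF joined_config_measurable[of _ _ p] Q])
  have Am: "A i \<in> sets (double_perc q \<delta>)" if "i \<in> I" for i
    unfolding A_def using ml[OF P[OF that]] mr[OF R[OF that]] by (intro predE pred_intros_logic)
  have A0m: "A0 \<in> sets (double_perc q \<delta>)" unfolding A0_def by (intro predE ml Q)
  have pA: "X.prob (A i) = perc_prob q (P i) * perc_prob \<delta> (R i)" if "i \<in> I" for i
  proof -
    have "X.prob (A i) = X.prob {X \<in> space (double_perc q \<delta>). P i (first_config X)} * X.prob {X \<in> space (double_perc q \<delta>). R i (second_config X)}"
      unfolding A_def
    proof (rule double_perc_indep[OF _ _ _ ml[OF P[OF that]] _ mr[OF R[OF that]]])
      show "depends_on (double_perc q \<delta>) (Inl ` E) (\<lambda>X. P i (first_config X))"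
        by (intro depends_onI arg_cong[where f="P i"]) (auto simp: restrict_def)
      show "depends_on (double_perc q \<delta>) (Inr ` E) (\<lambda>X. R i (second_config X))"
        by (intro depends_onI arg_cong[where f="R i"]) (auto simp: restrict_def)
    qed auto
    also have "\<dots> = perc_prob q (P i) * perc_prob \<delta> (R i)"
      using perc_prob_via[OF first_config_measurable distr_first_config P[OF that]] perc_prob_via[OF second_config_measurable distr_second_config R[OF that]] by simp
    finally show ?thesis .
  qed
  have sub: "A0 \<union> (\<Union>i\<in>I. A i) \<subseteq> {X \<in> space (double_perc q \<delta>). Q (joined_config X)}"
  proof -
    have "Q (joined_config X)" if "Q (first_config X)" for X using that by (rule mono) auto
    moreover have "Q (joined_config X)" if "i \<in> I" "P i (first_config X)" "R i (second_config X)" for X i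
    proof -
      have "(\<lambda>e\<in>E. first_config X e \<or> second_config X e) = joined_config X" by (auto simp: fun_eq_iff)
      then show ?thesis using piv[OF that] by simp
    qed
    ultimately show ?thesis by (auto simp: A_def A0_def)
  qed
  have "perc_prob q Q + (\<Sum>i\<in>I. perc_prob q (P i) * perc_prob \<delta> (R i)) = X.prob A0 + X.prob (\<Union>i\<in>I. A i)"
  proof -
    have "X.prob (\<Union>i\<in>I. A i) = (\<Sum>i\<in>I. X.prob (A i))"
      using I Am disj by (intro X.finite_measure_finite_Union) (auto simp: disjoint_family_on_def A_def)
    then show ?thesis using pA perc_prob_via[OF first_config_measurable distr_first_config Q] by (simp add: A0_def)
  qed
  also have "\<dots> = X.prob (A0 \<union> (\<Union>i\<in>I. A i))"
  proof (rule X.finite_measure_Union[symmetric])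
    show "A0 \<inter> (\<Union>i\<in>I. A i) = {}" using piv by (auto simp: A_def A0_def)
  qed (use A0m Am I in auto)
  also have "\<dots> \<le> X.prob {X \<in> space (double_perc q \<delta>). Q (joined_config X)}"
    using sub mj by (intro X.finite_measure_mono) (auto simp: pred_def)
  also have "\<dots> = perc_prob p Q"
    unfolding p by (rule perc_prob_via[OF joined_config_measurable distr_joined_config[OF q] Q, symmetric])
  finally show ?thesis .
qed

lemma perc_prob_increasing:
  assumes "0 \<le> q" "q \<le> p" "p \<le> 1" and Q: "\<And>r. Measurable.pred (perc r) Q"
    and mono: "\<And>\<omega> \<omega>'. Q \<omega> \<Longrightarrow> (\<And>e. e \<in> E \<Longrightarrow> \<omega> e \<Longrightarrow> \<omega>' e) \<Longrightarrow> Q \<omega>'"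
  shows "perc_prob q Q \<le> perc_prob p Q"
proof (cases "q = 1")
  case True then show ?thesis using assms by simp
next
  case False
  define \<delta> where "\<delta> = (p - q) / (1 - q)"
  have \<delta>: "0 \<le> \<delta>" "\<delta> \<le> 1" "p = 1 - (1 - q) * (1 - \<delta>)"
    using assms False by (auto simp: \<delta>_def field_simps)
  have "perc_prob q Q + (\<Sum>i\<in>({}::nat set). perc_prob q (\<lambda>_. False) * perc_prob \<delta> (\<lambda>_. False)) \<le> perc_prob p Q"
    by (rule sprinkling[OF _ _ \<delta> Q mono]) (use assms in auto)
  then show ?thesis by simp
qed

lemma \<tau>_mono: "0 \<le> q \<Longrightarrow> q \<le> p \<Longrightarrow> p \<le> 1 \<Longrightarrow> A \<subseteq> V \<Longrightarrow> \<tau> q A x y \<le> \<tau> p A x y"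
  by (rule perc_prob_increasing) (auto intro: pred_conn conn_mono_open)

text \<open>One factor \<open>1 - \<delta>\<close> more than the exact value, which spares a case distinction on \<open>card F\<close>.\<close>

lemma perc_prob_exactly_one:
  assumes F: "finite F" "F \<subseteq> E" "f \<in> F" and \<delta>: "0 \<le> \<delta>" "\<delta> \<le> 1"
  shows "Measurable.pred (perc \<delta>) (\<lambda>\<eta>. \<forall>e\<in>F. \<eta> e \<longleftrightarrow> e = f)"
    and "\<delta> * (1 - \<delta>) ^ card F \<le> perc_prob \<delta> (\<lambda>\<eta>. \<forall>e\<in>F. \<eta> e \<longleftrightarrow> e = f)"
proof -
  show "Measurable.pred (perc \<delta>) (\<lambda>\<eta>. \<forall>e\<in>F. \<eta> e \<longleftrightarrow> e = f)"
    by (rule pred_finite[OF F(1,2)]) (auto simp: depends_on_def)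
  have "emeasure (perc \<delta>) {\<eta> \<in> space (perc \<delta>). \<forall>e\<in>F. \<eta> e \<in> {e = f}} = (\<Prod>e\<in>F. emeasure (measure_pmf (bernoulli_pmf \<delta>)) {e = f})"
    unfolding percolation_def using F
    by (intro product_prob_space.emeasure_PiM_Collect product_prob_spaceI measure_pmf.prob_space_axioms) auto
  also have "\<dots> = (\<Prod>e\<in>F. ennreal (if e = f then \<delta> else 1 - \<delta>))"
    using \<delta> by (intro prod.cong refl) (auto simp: emeasure_pmf_single)
  also have "\<dots> = ennreal (\<Prod>e\<in>F. if e = f then \<delta> else 1 - \<delta>)"
    using \<delta> by (intro prod_ennreal) auto
  finally have "perc_prob \<delta> (\<lambda>\<eta>. \<forall>e\<in>F. \<eta> e \<longleftrightarrow> e = f) = (\<Prod>e\<in>F. if e = f then \<delta> else 1 - \<delta>)"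
    using \<delta> by (simp add: measure_def enn2real_ennreal prod_nonneg)
  also have "\<dots> = \<delta> * (\<Prod>e\<in>F - {f}. if e = f then \<delta> else 1 - \<delta>)"
    using F by (subst prod.remove[of F f]) auto
  also have "(\<Prod>e\<in>F - {f}. if e = f then \<delta> else 1 - \<delta>) = (1 - \<delta>) ^ (card F - 1)"
    using F by (subst prod.cong[OF refl, where h="\<lambda>_. 1 - \<delta>"]) auto
  finally show "\<delta> * (1 - \<delta>) ^ card F \<le> perc_prob \<delta> (\<lambda>\<eta>. \<forall>e\<in>F. \<eta> e \<longleftrightarrow> e = f)"
    using \<delta> by (simp add: mult_left_mono power_decreasing)
qed

text \<open>Suppose \<open>v\<close> does not escape and let \<open>Z\<close> be the set of vertices that do not escape. A boundary edge
of \<open>Z\<close> whose inner endpoint is connected to \<open>v\<close> inside \<open>Z\<close> is pivotal, and given \<open>Z\<close> the expected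
number of such edges is at least \<open>\<phi> q v Z \<ge> 1\<close>. So opening one edge at random by sprinkling
lets \<open>v\<close> escape with probability at least \<open>c\<close>.\<close>

lemma one_sprinkling_step:
  assumes \<Lambda>: "finite \<Lambda>" "\<Lambda> \<subseteq> V" and v: "v \<in> \<Lambda>"
    and q: "0 \<le> q" "q \<le> 1" "0 \<le> \<delta>" "\<delta> \<le> 1" and p: "p = 1 - (1 - q) * (1 - \<delta>)"
    and \<phi>: "\<And>B. finite B \<Longrightarrow> B \<subseteq> V \<Longrightarrow> v \<in> B \<Longrightarrow> 1 \<le> \<phi> q v B"
    and c: "c = \<delta> * (1 - \<delta>) ^ card {e \<in> E. e \<inter> \<Lambda> \<noteq> {}}"
  shows "1 - perc_prob p (\<lambda>\<omega>. escapes \<omega> \<Lambda> v) \<le> (1 - c) * (1 - perc_prob q (\<lambda>\<omega>. escapes \<omega> \<Lambda> v))"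
proof -
  interpret q: prob_space "perc q" by (rule prob_space_perc)
  define F where "F = {e \<in> E. e \<inter> \<Lambda> \<noteq> {}}"
  have F: "finite F" "F \<subseteq> E" using finite_touching[OF \<Lambda>(1)] by (auto simp: F_def)
  define I where "I = (SIGMA Z:{Z \<in> Pow \<Lambda>. v \<in> Z}. boundary Z)"
  define P where "P = (\<lambda>(Z :: 'a set, (u :: 'a, w :: 'a)) \<omega>. {z \<in> \<Lambda>. \<not> escapes \<omega> \<Lambda> z} = Z \<and> conn \<omega> Z v u)"
  define R where "R = (\<lambda>(Z :: 'a set, (u :: 'a, w :: 'a)) \<eta>. \<forall>e\<in>F. \<eta> e \<longleftrightarrow> e = {u, w})"
  have finZ: "finite {Z \<in> Pow \<Lambda>. v \<in> Z}" using \<Lambda> by simp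
  have I: "finite I" unfolding I_def
    using finZ finite_boundary finite_subset[OF _ \<Lambda>(1)] by (intro finite_SigmaI) auto
  have predZ: "Measurable.pred (perc q) (\<lambda>\<omega>. {z \<in> \<Lambda>. \<not> escapes \<omega> \<Lambda> z} = Z)" for Z
    by (rule pred_finite[OF _ _ depends_unreached]) (auto intro: finite_subset[OF _ finite_touching[OF \<Lambda>(1)]])
  have Idest: "Z \<subseteq> \<Lambda>" "v \<in> Z" "u \<in> Z" "w \<in> V" "w \<notin> Z" "{u, w} \<in> E" "{u, w} \<in> F" if "(Z, (u, w)) \<in> I" for Z u w
    using that by (auto simp: I_def boundary_def F_def)
  have "perc_prob q (\<lambda>\<omega>. escapes \<omega> \<Lambda> v) + (\<Sum>i\<in>I. perc_prob q (P i) * perc_prob \<delta> (R i)) \<le> perc_prob p (\<lambda>\<omega>. escapes \<omega> \<Lambda> v)"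
  proof (rule sprinkling[OF q p pred_escapes[OF \<Lambda>(1)] _ I])
    show "escapes \<omega>' \<Lambda> v" if "escapes \<omega> \<Lambda> v" "\<And>e. e \<in> E \<Longrightarrow> \<omega> e \<Longrightarrow> \<omega>' e" for \<omega> \<omega>'
      using that escapes_mono_open by blast
    fix i assume i: "i \<in> I"
    obtain Z u w where i': "i = (Z, (u, w))" by (metis prod.collapse)
    note d = Idest[OF i[unfolded i']]
    have ZV: "Z \<subseteq> V" using d \<Lambda> by blast
    show "Measurable.pred (perc q) (P i)"
      unfolding P_def i' prod.case using predZ[of Z] pred_conn[OF ZV, where p=q and x=v and y=u] by (intro pred_intros_logic)
    show "Measurable.pred (perc \<delta>) (R i)"
      unfolding R_def i' prod.case using F d q by (intro perc_prob_exactly_one) auto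
    {
      fix \<omega> \<eta> assume *: "P i \<omega>" "R i \<eta>"
      define \<zeta> where "\<zeta> = (\<lambda>e\<in>E. \<omega> e \<or> \<eta> e)"
      have Z: "{z \<in> \<Lambda>. \<not> escapes \<omega> \<Lambda> z} = Z" "conn \<omega> Z v u" using * by (auto simp: P_def i')
      have "\<zeta> {u, w}" using * d by (auto simp: R_def i' \<zeta>_def)
      have u: "escapes \<zeta> \<Lambda> u"
      proof (cases "w \<in> \<Lambda>")
        case True
        then have "escapes \<omega> \<Lambda> w" using Z d by blast
        then have "escapes \<zeta> \<Lambda> w" by (rule escapes_mono_open) (auto simp: \<zeta>_def)
        then show ?thesis using d \<open>\<zeta> {u, w}\<close> by (intro escapes_step[of u \<Lambda> \<zeta> w]) auto
      next
        case False
        then show ?thesis using d \<open>\<zeta> {u, w}\<close> by (intro escapes_base[of u \<Lambda> w \<zeta>]) auto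
      qed
      have "conn \<zeta> Z v u" using Z(2) by (rule conn_mono_open) (auto simp: \<zeta>_def)
      then have "conn \<zeta> \<Lambda> v u" using d(1) by (rule conn_mono)
      then have "escapes \<zeta> \<Lambda> v" using u by (rule escapes_conn)
      then show "\<not> escapes \<omega> \<Lambda> v \<and> escapes (\<lambda>e\<in>E. \<omega> e \<or> \<eta> e) \<Lambda> v"
        using Z d by (auto simp: \<zeta>_def)
    }
    fix j \<omega> \<eta> assume j: "j \<in> I" and *: "P i \<omega>" "R i \<eta>" "P j \<omega>" "R j \<eta>"
    obtain Z' u' w' where j': "j = (Z', (u', w'))" by (metis prod.collapse)
    note d' = Idest[OF j[unfolded j']]
    have "Z = Z'" using * by (simp add: P_def i' j')
    moreover have "{u, w} = {u', w'}"
      using * d d' unfolding R_def i' j' prod.case by blast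
    ultimately show "i = j" using d d' by (auto simp: i' j' doubleton_eq_iff)
  qed
  moreover have "c * (1 - perc_prob q (\<lambda>\<omega>. escapes \<omega> \<Lambda> v)) \<le> (\<Sum>i\<in>I. perc_prob q (P i) * perc_prob \<delta> (R i))"
  proof -
    have c0: "0 \<le> c" using q by (simp add: c)
    have "1 - perc_prob q (\<lambda>\<omega>. escapes \<omega> \<Lambda> v) = perc_prob q (\<lambda>\<omega>. \<not> escapes \<omega> \<Lambda> v)"
      using pred_escapes[OF \<Lambda>(1), where p=q and x=v] by (subst q.prob_neg) (auto simp: pred_def)
    also have "\<dots> = perc_prob q (\<lambda>\<omega>. \<exists>Z\<in>{Z \<in> Pow \<Lambda>. v \<in> Z}. {z \<in> \<Lambda>. \<not> escapes \<omega> \<Lambda> z} = Z)"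
      using v by (intro perc_prob_cong) auto
    also have "\<dots> = (\<Sum>Z\<in>{Z \<in> Pow \<Lambda>. v \<in> Z}. perc_prob q (\<lambda>\<omega>. {z \<in> \<Lambda>. \<not> escapes \<omega> \<Lambda> z} = Z))"
      using finZ predZ by (intro perc_prob_disjoint_union) auto
    finally have "c * (1 - perc_prob q (\<lambda>\<omega>. escapes \<omega> \<Lambda> v)) = (\<Sum>Z\<in>{Z \<in> Pow \<Lambda>. v \<in> Z}. c * perc_prob q (\<lambda>\<omega>. {z \<in> \<Lambda>. \<not> escapes \<omega> \<Lambda> z} = Z))"
      by (simp add: sum_distrib_left)
    also have "\<dots> \<le> (\<Sum>Z\<in>{Z \<in> Pow \<Lambda>. v \<in> Z}. \<Sum>t\<in>boundary Z. perc_prob q (P (Z, t)) * perc_prob \<delta> (R (Z, t)))"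
    proof (rule sum_mono)
      fix Z assume Z: "Z \<in> {Z \<in> Pow \<Lambda>. v \<in> Z}"
      then have ZV: "Z \<subseteq> V" "finite Z" using \<Lambda> finite_subset by auto
      let ?z = "perc_prob q (\<lambda>\<omega>. {z \<in> \<Lambda>. \<not> escapes \<omega> \<Lambda> z} = Z)"
      have "1 \<le> \<phi> q v Z" using \<phi> ZV Z by blast
      also have "\<dots> \<le> 1 * (\<Sum>(u, w)\<in>boundary Z. \<tau> q Z v u)"
        unfolding \<phi>_def using q by (intro mult_right_mono) (auto intro!: sum_nonneg)
      finally have "c * ?z * 1 \<le> c * ?z * (\<Sum>(u, w)\<in>boundary Z. \<tau> q Z v u)"
        using c0 by (intro mult_left_mono) auto
      also have "\<dots> = (\<Sum>(u, w)\<in>boundary Z. ?z * \<tau> q Z v u * c)"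
        by (simp add: sum_distrib_left sum_distrib_right case_prod_unfold mult_ac)
      also have "\<dots> \<le> (\<Sum>t\<in>boundary Z. perc_prob q (P (Z, t)) * perc_prob \<delta> (R (Z, t)))"
      proof (rule sum_mono, clarify)
        fix u w assume uw: "(u, w) \<in> boundary Z"
        have "(Z, (u, w)) \<in> I" using uw Z by (simp add: I_def)
        note d = Idest[OF this]
        have "perc_prob q (P (Z, (u, w))) = ?z * \<tau> q Z v u"
          unfolding P_def prod.case
          by (rule perc_prob_indep[OF _ _ _ predZ depends_unreached pred_conn[OF ZV(1)] depends_conn]) auto
        moreover have "c \<le> perc_prob \<delta> (R (Z, (u, w)))"
          unfolding R_def prod.case c F_def[symmetric] using F d q by (intro perc_prob_exactly_one) auto
        ultimately show "?z * \<tau> q Z v u * c \<le> perc_prob q (P (Z, (u, w))) * perc_prob \<delta> (R (Z, (u, w)))"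
          by (simp add: mult_left_mono)
      qed
      finally show "c * ?z \<le> (\<Sum>t\<in>boundary Z. perc_prob q (P (Z, t)) * perc_prob \<delta> (R (Z, t)))" by simp
    qed
    also have "\<dots> = (\<Sum>i\<in>I. perc_prob q (P i) * perc_prob \<delta> (R i))"
      unfolding I_def using finZ finite_boundary finite_subset[OF _ \<Lambda>(1)]
      by (subst sum.Sigma) (auto simp: case_prod_unfold)
    finally show ?thesis .
  qed
  ultimately show ?thesis by (simp add: algebra_simps)
qed

lemma \<phi>_mono: "0 \<le> q \<Longrightarrow> q \<le> p \<Longrightarrow> p \<le> 1 \<Longrightarrow> B \<subseteq> V \<Longrightarrow> \<phi> q v B \<le> \<phi> p v B"
  unfolding \<phi>_def by (intro mult_mono sum_mono) (auto simp: case_prod_unfold intro!: \<tau>_mono sum_nonneg)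

text \<open>Iterating the sprinkling step integrates the differential inequality for the escape probability. The number of steps is tied to the number
of relevant edges so that the loss \<open>(1 - \<delta>) ^ card F\<close> in each step stays bounded, and the
resulting bound does not depend on \<open>\<Lambda>\<close>.\<close>

lemma escape_probability:
  assumes \<Lambda>: "finite \<Lambda>" "\<Lambda> \<subseteq> V" and v: "v \<in> \<Lambda>"
    and p: "0 \<le> p" "p < p2" "p2 < 1"
    and \<phi>: "\<And>B. finite B \<Longrightarrow> B \<subseteq> V \<Longrightarrow> v \<in> B \<Longrightarrow> 1 \<le> \<phi> p v B"
    and \<rho>: "\<rho> = (1 - p2) / (1 - p)"
  shows "1 - exp (- ((1 - \<rho>) * \<rho>)) \<le> perc_prob p2 (\<lambda>\<omega>. escapes \<omega> \<Lambda> v)"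
proof -
  have \<rho>01: "0 < \<rho>" "\<rho> < 1" using p by (auto simp: \<rho> divide_less_eq)
  define k where "k = card {e \<in> E. e \<inter> \<Lambda> \<noteq> {}}"
  \<comment> \<open>\<open>N\<close> steps with \<open>(1 - \<delta>) ^ N = \<rho>\<close> lead from density \<open>p\<close> to density \<open>p2\<close>; as \<open>k < N\<close>, each of them
    keeps \<open>(1 - \<delta>) ^ k \<ge> \<rho>\<close>.\<close>
  define N where "N = Suc k"
  define \<delta> where "\<delta> = 1 - root N \<rho>"
  have root: "root N \<rho> ^ N = \<rho>" "0 \<le> root N \<rho>" "root N \<rho> \<le> 1"
    using \<rho>01 real_root_pow_pos2[of N \<rho>] by (auto simp del: power_Suc simp: N_def real_root_le_1_iff)
  have \<delta>: "0 \<le> \<delta>" "\<delta> \<le> 1" "(1 - \<delta>) ^ N = \<rho>" using root by (auto simp: \<delta>_def)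
  define c where "c = \<delta> * (1 - \<delta>) ^ k"
  have c: "0 \<le> c" "c \<le> 1" using \<delta> by (auto simp: c_def intro!: mult_le_one power_le_one)
  define f where "f r = perc_prob r (\<lambda>\<omega>. escapes \<omega> \<Lambda> v)" for r
  define q where "q j = 1 - (1 - p) * (1 - \<delta>) ^ j" for j
  have q: "p \<le> q j" "q j \<le> 1" for j
  proof -
    have "(1 - p) * (1 - \<delta>) ^ j \<le> (1 - p) * 1" using p \<delta> by (intro mult_left_mono power_le_one) auto
    then show "p \<le> q j" by (simp add: q_def)
    show "q j \<le> 1" using p \<delta> by (simp add: q_def)
  qed
  have iter: "1 - f (q j) \<le> (1 - c) ^ j" for j
  proof (induction j)
    case 0
    then show ?case by (simp add: f_def)
  next
    case (Suc j)
    have "1 - f (q (Suc j)) \<le> (1 - c) * (1 - f (q j))"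
      unfolding f_def
    proof (rule one_sprinkling_step[OF \<Lambda> v _ _ \<delta>(1,2)])
      show "q (Suc j) = 1 - (1 - q j) * (1 - \<delta>)" by (simp add: q_def)
      show "c = \<delta> * (1 - \<delta>) ^ card {e \<in> E. e \<inter> \<Lambda> \<noteq> {}}" by (simp add: c_def k_def)
      show "1 \<le> \<phi> (q j) v B" if "finite B" "B \<subseteq> V" "v \<in> B" for B
        using \<phi>[OF that] \<phi>_mono[OF p(1) q(1,2) that(2), of v j] by linarith
    qed (use p q[of j] in linarith)+
    also have "\<dots> \<le> (1 - c) * (1 - c) ^ j" using Suc c by (intro mult_left_mono) auto
    finally show ?case by simp
  qed
  have qN: "q N = p2" using p by (simp add: q_def \<delta>(3) \<rho>)
  have "1 - \<rho> \<le> N * \<delta>"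
    using Bernoulli_inequality[of "- \<delta>" N] \<delta> by simp
  then have "(1 - \<rho>) * \<rho> \<le> N * \<delta> * \<rho>" using \<rho>01 by (intro mult_right_mono) auto
  also have "\<rho> \<le> (1 - \<delta>) ^ k"
    unfolding \<delta>(3)[symmetric] using \<delta> by (intro power_decreasing) (auto simp: N_def)
  then have "N * \<delta> * \<rho> \<le> N * c" unfolding c_def using \<delta> by (simp add: mult_left_mono mult.assoc)
  finally have Nc: "(1 - \<rho>) * \<rho> \<le> N * c" .
  have "1 - f p2 \<le> (1 - c) ^ N" using iter[of N] qN by simp
  also have "\<dots> \<le> exp (- c) ^ N"
    using exp_ge_add_one_self[of "- c"] c by (intro power_mono) auto
  also have "\<dots> = exp (- (N * c))" by (simp add: exp_of_nat_mult[symmetric])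
  also have "\<dots> \<le> exp (- ((1 - \<rho>) * \<rho>))" using Nc by simp
  finally show ?thesis by (simp add: f_def)
qed

text \<open>Clusters are subsets of the union of the finite balls, so an infinite one leaves every ball.\<close>

lemma infinite_cluster_iff:
  "infinite {y. conn \<omega> V v y} \<longleftrightarrow> (\<forall>n. \<exists>w\<in>V - wball n. conn \<omega> V v w)"
proof
  assume "infinite {y. conn \<omega> V v y}"
  then have "\<not> {y. conn \<omega> V v y} \<subseteq> wball n" for n using finite_subset[OF _ finite_wball] by blast
  then show "\<forall>n. \<exists>w\<in>V - wball n. conn \<omega> V v w" using conn_in by blast
next
  assume *: "\<forall>n. \<exists>w\<in>V - wball n. conn \<omega> V v w"
  show "infinite {y. conn \<omega> V v y}"
  proof
    assume "finite {y. conn \<omega> V v y}"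
    moreover have "{y. conn \<omega> V v y} \<subseteq> V" using conn_in by blast
    ultimately obtain n where "{y. conn \<omega> V v y} \<subseteq> wball n" using finite_sub_wball by blast
    then show False using * by blast
  qed
qed

lemma pred_escape: "Measurable.pred (perc p) (\<lambda>\<omega>. \<exists>w\<in>V - wball n. conn \<omega> V v w)"
  by (rule pred_countable_Bex[OF countable_Diff[OF countable_V] pred_conn[OF subset_refl]])

lemma pred_infinite_cluster: "Measurable.pred (perc p) (\<lambda>\<omega>. infinite {y. conn \<omega> V v y})"
  unfolding infinite_cluster_iff by (intro pred_intros_countable pred_escape)

lemma infinite_cluster_probability:
  assumes "\<And>n. v \<in> wball n \<Longrightarrow> \<kappa> \<le> perc_prob p (\<lambda>\<omega>. escapes \<omega> (wball n) v)" and v: "v \<in> V"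
  shows "\<kappa> \<le> perc_prob p (\<lambda>\<omega>. infinite {y. conn \<omega> V v y})"
proof -
  interpret prob_space "perc p" by (rule prob_space_perc)
  define A where "A n = {\<omega> \<in> space (perc p). \<exists>w\<in>V - wball n. conn \<omega> V v w}" for n
  note Am = pred_escape
  have eq: "(\<Inter>n. A n) = {\<omega> \<in> space (perc p). infinite {y. conn \<omega> V v y}}"
    unfolding infinite_cluster_iff A_def by blast
  have "(\<lambda>n. measure (perc p) (A n)) \<longlonglongrightarrow> measure (perc p) (\<Inter>n. A n)"
  proof (rule finite_Lim_measure_decseq)
    show "range A \<subseteq> sets (perc p)" using predE[OF Am] by (auto simp: A_def)
    show "decseq A" unfolding decseq_def A_def using wball_mono by blast
  qed
  moreover obtain n0 where n0: "v \<in> wball n0" using wball_exhaust[OF v] by blast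
  have "\<kappa> \<le> measure (perc p) (A n)" if "n \<ge> n0" for n
  proof -
    have "v \<in> wball n" using n0 wball_mono[OF that] by blast
    then have "\<kappa> \<le> perc_prob p (\<lambda>\<omega>. escapes \<omega> (wball n) v)" by (rule assms)
    also have "\<dots> \<le> measure (perc p) (A n)"
      unfolding A_def using escapes_imp_conn[OF _ wball_sub] by (intro perc_prob_mono[OF Am])
    finally show ?thesis .
  qed
  ultimately show ?thesis unfolding eq by (intro LIMSEQ_le_const) auto
qed

lemma conn_all_open:
  assumes "\<And>e. e \<in> E \<Longrightarrow> \<omega> e" "x \<in> V" "set w \<subseteq> S"
  shows "conn \<omega> V x (x \<otimes> wprod w)"
  using assms(2,3)
proof (induction w arbitrary: x)
  case (Cons s w)
  have s: "s \<in> S" "s \<in> V" "wprod w \<in> V" using Cons.prems S_sub by (auto intro!: wprod_closed)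
  have "conn \<omega> V (x \<otimes> s) (x \<otimes> s \<otimes> wprod w)" using Cons s by auto
  moreover have "conn \<omega> V x (x \<otimes> s)"
    using Cons.prems s assms(1) edge_mult by (intro conn_edge) auto
  ultimately show ?case using conn_trans Cons.prems s by (simp add: m_assoc)
qed (simp add: conn_refl)

text \<open>Shows that the infimum defining the critical probability is over a nonempty set, hence at
most \<open>1\<close>.\<close>

lemma percolation_at_one:
  assumes "infinite V" "v \<in> V"
  shows "perc_prob 1 (\<lambda>\<omega>. infinite {y. conn \<omega> V v y}) = 1"
proof -
  interpret prob_space "perc 1" by (rule prob_space_perc)
  have "AE \<omega> in perc 1. \<forall>e\<in>E. \<omega> e"
  proof (subst AE_ball_countable)
    show "\<forall>e\<in>E. AE \<omega> in perc 1. \<omega> e"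
      unfolding percolation_def
    proof (intro ballI AE_PiM_component measure_pmf.prob_space_axioms)
      have "b" if "b \<in> set_pmf (bernoulli_pmf 1)" for b
        using that by (cases b) (auto simp: set_pmf_iff)
      then show "AE b in measure_pmf (bernoulli_pmf 1). b" unfolding AE_measure_pmf_iff by blast
    qed
  qed simp
  then have "AE \<omega> in perc 1. infinite {y. conn \<omega> V v y}"
  proof eventually_elim
    case (elim \<omega>)
    have "V \<subseteq> {y. conn \<omega> V v y}"
    proof
      fix y assume y: "y \<in> V"
      then have "inv v \<otimes> y \<in> V" using assms by simp
      then obtain n where "inv v \<otimes> y \<in> wball n" using wball_exhaust by blast
      then obtain w where "inv v \<otimes> y = wprod w" "set w \<subseteq> S" by (auto simp: wball_def)
      then have "conn \<omega> V v (v \<otimes> (inv v \<otimes> y))" using conn_all_open[of \<omega> v w] elim assms by auto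
      then show "y \<in> {y. conn \<omega> V v y}" using y assms by (simp add: mult_inv_cancel)
    qed
    then show ?case using assms finite_subset by blast
  qed
  then show ?thesis by (rule prob_Collect_eq_1[THEN iffD2, rotated]) (rule predE, rule pred_infinite_cluster)
qed

text \<open>Sharpness of the phase transition: if \<open>\<phi> p v B\<close> were at least \<open>1\<close> for every finite \<open>B\<close>, then by
\<open>escape_probability\<close> the infinite cluster would have positive probability at any \<open>p2 > p\<close>,
contradicting the choice of \<open>p2\<close> below the critical probability.\<close>

theorem subcritical_susceptibility:
  assumes inf: "infinite V" and v: "v \<in> V" and p: "0 \<le> p" "p < critical_prob G v"
  obtains C where "p < 1" "0 \<le> C" "\<And>x Y. x \<in> V \<Longrightarrow> finite Y \<Longrightarrow> Y \<subseteq> V \<Longrightarrow> (\<Sum>y\<in>Y. \<tau> p V x y) \<le> C"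
proof -
  define A where "A = {p \<in> {0..1}. perc_prob p (\<lambda>\<omega>. infinite {y. conn \<omega> V v y}) > 0}"
  have crit: "critical_prob G v = Inf A" by (simp add: critical_prob_def A_def verts_cluster)
  have "1 \<in> A" using percolation_at_one[OF inf v] by (simp add: A_def)
  moreover have bdd: "bdd_below A" by (rule bdd_belowI[of _ 0]) (auto simp: A_def)
  ultimately have le1: "Inf A \<le> 1" by (rule cInf_lower)
  \<comment> \<open>Any density strictly between \<open>p\<close> and the critical one.\<close>
  define p2 where "p2 = (p + Inf A) / 2"
  have p2: "p < p2" "p2 < Inf A" "p2 < 1" "0 \<le> p2" using p le1 by (auto simp: p2_def crit)
  have "p2 \<notin> A" using cInf_lower[OF _ bdd, of p2] p2 by auto
  then have z: "perc_prob p2 (\<lambda>\<omega>. infinite {y. conn \<omega> V v y}) \<le> 0" using p2 by (auto simp: A_def)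
  have "\<exists>B. finite B \<and> B \<subseteq> V \<and> v \<in> B \<and> \<phi> p v B < 1"
  proof (rule ccontr)
    assume "\<not> ?thesis"
    then have \<phi>: "\<And>B. finite B \<Longrightarrow> B \<subseteq> V \<Longrightarrow> v \<in> B \<Longrightarrow> 1 \<le> \<phi> p v B" by (meson not_less)
    define \<rho> where "\<rho> = (1 - p2) / (1 - p)"
    have \<rho>: "0 < \<rho>" "\<rho> < 1" using p2 by (auto simp: \<rho>_def divide_less_eq)
    have "1 - exp (- ((1 - \<rho>) * \<rho>)) \<le> perc_prob p2 (\<lambda>\<omega>. infinite {y. conn \<omega> V v y})"
    proof (rule infinite_cluster_probability[OF _ v])
      fix n assume "v \<in> wball n"
      then show "1 - exp (- ((1 - \<rho>) * \<rho>)) \<le> perc_prob p2 (\<lambda>\<omega>. escapes \<omega> (wball n) v)"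
        using escape_probability[OF finite_wball wball_sub _ p(1) p2(1,3) \<phi> \<rho>_def] by blast
    qed
    moreover have "exp (- ((1 - \<rho>) * \<rho>)) < 1" using \<rho> by simp
    ultimately show False using z by linarith
  qed
  then obtain B where B: "finite B" "B \<subseteq> V" "v \<in> B" "\<phi> p v B < 1" by blast
  show ?thesis
  proof (rule that[of "real (card B) / (1 - \<phi> p v B)"])
    show "p < 1" using p2 by simp
    show "0 \<le> real (card B) / (1 - \<phi> p v B)" using B by simp
    show "(\<Sum>y\<in>Y. \<tau> p V x y) \<le> real (card B) / (1 - \<phi> p v B)" if "x \<in> V" "finite Y" "Y \<subseteq> V" for x Y
      using p p2 B that by (intro susceptibility_bound) auto
  qed
qed

end

context cayley
begin

section \<open>Heat kernel decay\<close>

text \<open>The law of a product of \<open>n\<close> independent uniform generators; since \<open>S\<close> is symmetric, averaging over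
\<open>x \<otimes> s\<close> and over \<open>x \<otimes> inv s\<close> is the same.\<close>

primrec heat_kernel :: "nat \<Rightarrow> 'a \<Rightarrow> real" where
  "heat_kernel 0 x = (if x = \<one> then 1 else 0)"
| "heat_kernel (Suc n) x = (\<Sum>s\<in>S. heat_kernel n (x \<otimes> s)) / card S"

text \<open>All functions summed over the group here have finite support, so that infinite sums can be
manipulated without convergence questions and translations are mere reindexings.\<close>

abbreviation finite_supp :: "('a \<Rightarrow> real) \<Rightarrow> bool" where
  "finite_supp f \<equiv> finite {x \<in> V. f x \<noteq> 0}"

text \<open>The squared \<open>l\<^sup>2\<close> norm of the kernel, which is the return probability at time \<open>2 n\<close>.\<close>

definition energy :: "nat \<Rightarrow> real" where
  "energy n = (\<Sum>\<^sub>\<infinity>x\<in>V. (heat_kernel n x)\<^sup>2)"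

lemma finite_supp_summable: "finite_supp f \<Longrightarrow> f summable_on V"
  by (rule finite_nonzero_values_imp_summable_on)

lemma bij_right_mult: "g \<in> V \<Longrightarrow> bij_betw (\<lambda>x. x \<otimes> g) V V"
  by (rule bij_betw_byWitness[where f'="\<lambda>x. x \<otimes> inv g"]) (auto simp: m_assoc)

lemma bij_inv_mult: "g \<in> V \<Longrightarrow> bij_betw (\<lambda>x. inv x \<otimes> g) V V"
  by (rule bij_betw_byWitness[where f'="\<lambda>x. g \<otimes> inv x"]) (auto simp: m_assoc inv_mult_group mult_inv_cancel inv_mult_cancel)

lemma infsum_right_mult: "g \<in> V \<Longrightarrow> (\<Sum>\<^sub>\<infinity>x\<in>V. f (x \<otimes> g)) = (\<Sum>\<^sub>\<infinity>x\<in>V. f x)"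
  by (rule infsum_reindex_bij_betw[OF bij_right_mult])

lemma finite_supp_bij: "bij_betw h V V \<Longrightarrow> finite_supp f \<Longrightarrow> finite_supp (\<lambda>x. f (h x))"
proof -
  assume h: "bij_betw h V V" and f: "finite_supp f"
  have "h ` {x \<in> V. f (h x) \<noteq> 0} \<subseteq> {x \<in> V. f x \<noteq> 0}"
    using h by (auto simp: bij_betw_def)
  then have "finite (h ` {x \<in> V. f (h x) \<noteq> 0})" using f finite_subset by blast
  moreover have "inj_on h {x \<in> V. f (h x) \<noteq> 0}" using h by (auto simp: bij_betw_def intro: inj_on_subset)
  ultimately show ?thesis by (rule finite_imageD)
qed

lemma finite_supp_right_mult: "g \<in> V \<Longrightarrow> finite_supp f \<Longrightarrow> finite_supp (\<lambda>x. f (x \<otimes> g))"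
  by (rule finite_supp_bij[OF bij_right_mult])

lemma finite_supp_mult: "finite_supp f \<Longrightarrow> finite_supp (\<lambda>x. f x * g x)"
  by (erule finite_subset[rotated]) auto

lemma finite_supp_mult2: "finite_supp g \<Longrightarrow> finite_supp (\<lambda>x. f x * g x)"
  by (erule finite_subset[rotated]) auto

lemma finite_supp_add: "finite_supp f \<Longrightarrow> finite_supp g \<Longrightarrow> finite_supp (\<lambda>x. f x + g x)"
  by (rule finite_subset[of _ "{x \<in> V. f x \<noteq> 0} \<union> {x \<in> V. g x \<noteq> 0}"]) auto

lemma finite_supp_diff: "finite_supp f \<Longrightarrow> finite_supp g \<Longrightarrow> finite_supp (\<lambda>x. f x - g x)"
  by (rule finite_subset[of _ "{x \<in> V. f x \<noteq> 0} \<union> {x \<in> V. g x \<noteq> 0}"]) auto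

lemma finite_supp_square: "finite_supp f \<Longrightarrow> finite_supp (\<lambda>x. (f x)\<^sup>2)"
  by (erule finite_subset[rotated]) auto

lemma finite_supp_sum: "finite I \<Longrightarrow> (\<And>i. i \<in> I \<Longrightarrow> finite_supp (f i)) \<Longrightarrow> finite_supp (\<lambda>x. \<Sum>i\<in>I. f i x)"
proof (induction rule: finite_induct)
  case (insert i I)
  then have "finite_supp (\<lambda>x. f i x + (\<Sum>i\<in>I. f i x))" by (intro finite_supp_add) auto
  then show ?case using insert by simp
qed simp

lemma heat_kernel_finite_supp: "finite_supp (heat_kernel n)"
proof (induction n)
  case 0 show ?case by (rule finite_subset[of _ "{\<one>}"]) auto
next
  case (Suc n)
  have "finite_supp (\<lambda>x. \<Sum>s\<in>S. heat_kernel n (x \<otimes> s))"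
    using Suc S_fin by (intro finite_supp_sum finite_supp_right_mult) auto
  from finite_supp_mult[OF this, of "\<lambda>_. 1 / card S"] show ?case by (simp add: heat_kernel.simps)
qed

lemma heat_kernel_nonneg: "0 \<le> heat_kernel n x"
  by (induction n arbitrary: x) (auto intro!: sum_nonneg divide_nonneg_nonneg)

lemma infsum_finite_sum:
  fixes f :: "'i \<Rightarrow> 'a \<Rightarrow> real"
  assumes "finite I" "\<And>i. i \<in> I \<Longrightarrow> finite_supp (f i)"
  shows "(\<Sum>\<^sub>\<infinity>x\<in>V. \<Sum>i\<in>I. f i x) = (\<Sum>i\<in>I. \<Sum>\<^sub>\<infinity>x\<in>V. f i x)"
  using assms
proof (induction rule: finite_induct)
  case (insert i I)
  have "(\<Sum>\<^sub>\<infinity>x\<in>V. f i x + (\<Sum>i\<in>I. f i x)) = (\<Sum>\<^sub>\<infinity>x\<in>V. f i x) + (\<Sum>\<^sub>\<infinity>x\<in>V. \<Sum>i\<in>I. f i x)"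
    using insert by (intro infsum_add finite_supp_summable finite_supp_sum) auto
  then show ?case using insert by simp
qed simp

lemma infsum_finite_supp_diff:
  assumes "finite_supp f" "finite_supp g"
  shows "(\<Sum>\<^sub>\<infinity>x\<in>V. f x - g x) = (\<Sum>\<^sub>\<infinity>x\<in>V. f x) - (\<Sum>\<^sub>\<infinity>x\<in>V. g x)"
proof -
  have "finite_supp (\<lambda>x. - g x)" using assms(2) by simp
  then have "(\<Sum>\<^sub>\<infinity>x\<in>V. f x + - g x) = (\<Sum>\<^sub>\<infinity>x\<in>V. f x) + (\<Sum>\<^sub>\<infinity>x\<in>V. - g x)"
    using assms(1) by (intro infsum_add finite_supp_summable)
  then show ?thesis by (simp add: infsum_uminus)
qed

context
  assumes S_ne: "S \<noteq> {}"
begin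

lemma card_S_pos: "0 < card S"
  using S_ne S_fin by (simp add: card_gt_0_iff)

lemma heat_kernel_total: "(\<Sum>\<^sub>\<infinity>x\<in>V. heat_kernel n x) = 1"
proof (induction n)
  case 0
  have "(\<Sum>\<^sub>\<infinity>x\<in>V. heat_kernel 0 x) = (\<Sum>\<^sub>\<infinity>x\<in>{\<one>}. heat_kernel 0 x)"
    by (rule infsum_cong_neutral) auto
  then show ?case by simp
next
  case (Suc n)
  have "(\<Sum>\<^sub>\<infinity>x\<in>V. heat_kernel (Suc n) x) = (\<Sum>\<^sub>\<infinity>x\<in>V. \<Sum>s\<in>S. heat_kernel n (x \<otimes> s)) / card S"
    unfolding heat_kernel.simps divide_inverse by (rule infsum_cmult_left')
  also have "(\<Sum>\<^sub>\<infinity>x\<in>V. \<Sum>s\<in>S. heat_kernel n (x \<otimes> s)) = (\<Sum>s\<in>S. \<Sum>\<^sub>\<infinity>x\<in>V. heat_kernel n (x \<otimes> s))"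
    using S_fin heat_kernel_finite_supp by (intro infsum_finite_sum finite_supp_right_mult) auto
  also have "\<dots> = (\<Sum>s\<in>S. 1)"
    by (intro sum.cong refl) (simp add: infsum_right_mult Suc)
  finally show ?case using card_S_pos by simp
qed

lemma energy_0: "energy 0 = 1"
proof -
  have "energy 0 = (\<Sum>\<^sub>\<infinity>x\<in>{\<one>}. (heat_kernel 0 x)\<^sup>2)"
    unfolding energy_def by (rule infsum_cong_neutral) auto
  then show ?thesis by simp
qed

lemma energy_nonneg: "0 \<le> energy n"
  unfolding energy_def by (rule infsum_nonneg) simp

text \<open>The right-hand side is the sum of all squared differences over ordered pairs.\<close>

lemma pair_variance:
  fixes a :: "'x \<Rightarrow> real"
  assumes "finite T" "s \<in> T" "t \<in> T"
  shows "(a s - a t)\<^sup>2 \<le> 2 * (card T * (\<Sum>i\<in>T. (a i)\<^sup>2) - (\<Sum>i\<in>T. a i)\<^sup>2)"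
proof -
  have "(a s - a t)\<^sup>2 \<le> (\<Sum>j\<in>T. (a s - a j)\<^sup>2)"
    using assms by (intro member_le_sum[of t T "\<lambda>j. (a s - a j)\<^sup>2"]) auto
  also have "\<dots> \<le> (\<Sum>i\<in>T. \<Sum>j\<in>T. (a i - a j)\<^sup>2)"
    using assms by (intro member_le_sum[of s T "\<lambda>i. \<Sum>j\<in>T. (a i - a j)\<^sup>2"]) (auto intro: sum_nonneg)
  also have "\<dots> = (\<Sum>i\<in>T. \<Sum>j\<in>T. (a i)\<^sup>2 + (a j)\<^sup>2 - 2 * (a i * a j))"
    by (simp add: power2_diff mult.assoc)
  also have "\<dots> = 2 * (card T * (\<Sum>i\<in>T. (a i)\<^sup>2)) - 2 * (\<Sum>i\<in>T. \<Sum>j\<in>T. a i * a j)"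
    by (simp add: sum.distrib sum_subtractf sum_distrib_left)
  also have "(\<Sum>i\<in>T. \<Sum>j\<in>T. a i * a j) = (\<Sum>i\<in>T. a i)\<^sup>2"
    by (simp add: power2_eq_square sum_product)
  finally show ?thesis by simp
qed

text \<open>The squared \<open>l\<^sup>2\<close> distance between the kernel and its right translate by \<open>g\<close>.\<close>

definition shift_energy :: "nat \<Rightarrow> 'a \<Rightarrow> real" where
  "shift_energy n g = (\<Sum>\<^sub>\<infinity>x\<in>V. (heat_kernel n x - heat_kernel n (x \<otimes> g))\<^sup>2)"

lemma finite_supp_shift_energy: "g \<in> V \<Longrightarrow> finite_supp (\<lambda>x. (heat_kernel n x - heat_kernel n (x \<otimes> g))\<^sup>2)"
  by (intro finite_supp_square finite_supp_diff heat_kernel_finite_supp finite_supp_right_mult)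

text \<open>The loss of \<open>l\<^sup>2\<close> norm in one step is a sum of variances over neighbours, and it dominates the difference
between any two neighbours of a vertex. Two letters appear because neighbours of a vertex are two
steps apart; this also avoids all parity problems of the walk.\<close>

lemma shift_energy_two_letters:
  assumes "s \<in> S" "t \<in> S"
  shows "shift_energy n (s \<otimes> t) \<le> 2 * (real (card S))\<^sup>2 * (energy n - energy (Suc n))"
proof -
  let ?k = "real (card S)"
  have sq: "(\<Sum>\<^sub>\<infinity>x\<in>V. (\<Sum>i\<in>S. (heat_kernel n (x \<otimes> i))\<^sup>2)) = ?k * energy n"
  proof -
    have "(\<Sum>\<^sub>\<infinity>x\<in>V. (\<Sum>i\<in>S. (heat_kernel n (x \<otimes> i))\<^sup>2)) = (\<Sum>i\<in>S. \<Sum>\<^sub>\<infinity>x\<in>V. (heat_kernel n (x \<otimes> i))\<^sup>2)"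
      using S_fin heat_kernel_finite_supp by (intro infsum_finite_sum finite_supp_square finite_supp_right_mult) auto
    also have "\<dots> = (\<Sum>i\<in>S. energy n)"
      unfolding energy_def by (intro sum.cong refl infsum_right_mult[where f="\<lambda>x. (heat_kernel n x)\<^sup>2"]) auto
    finally show ?thesis by simp
  qed
  have tot: "(\<Sum>\<^sub>\<infinity>x\<in>V. (\<Sum>i\<in>S. heat_kernel n (x \<otimes> i))\<^sup>2) = ?k\<^sup>2 * energy (Suc n)"
  proof -
    have "(\<Sum>i\<in>S. heat_kernel n (x \<otimes> i))\<^sup>2 = ?k\<^sup>2 * (heat_kernel (Suc n) x)\<^sup>2" for x
      using card_S_pos by (simp add: power_divide)
    then show ?thesis unfolding energy_def by (simp add: infsum_cmult_right')
  qed
  have f1: "finite_supp (\<lambda>x. \<Sum>i\<in>S. (heat_kernel n (x \<otimes> i))\<^sup>2)"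
    using S_fin heat_kernel_finite_supp by (intro finite_supp_sum finite_supp_square finite_supp_right_mult) auto
  have f2: "finite_supp (\<lambda>x. (\<Sum>i\<in>S. heat_kernel n (x \<otimes> i))\<^sup>2)"
    using S_fin heat_kernel_finite_supp by (intro finite_supp_square finite_supp_sum finite_supp_right_mult) auto
  have "shift_energy n (s \<otimes> t) = (\<Sum>\<^sub>\<infinity>x\<in>V. (heat_kernel n (x \<otimes> inv s) - heat_kernel n (x \<otimes> inv s \<otimes> (s \<otimes> t)))\<^sup>2)"
    unfolding shift_energy_def using assms
    by (intro infsum_right_mult[where f="\<lambda>x. (heat_kernel n x - heat_kernel n (x \<otimes> (s \<otimes> t)))\<^sup>2", symmetric]) auto
  also have "\<dots> = (\<Sum>\<^sub>\<infinity>x\<in>V. (heat_kernel n (x \<otimes> inv s) - heat_kernel n (x \<otimes> t))\<^sup>2)"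
    using assms by (intro infsum_cong) (simp add: m_assoc inv_mult_cancel)
  also have "\<dots> \<le> (\<Sum>\<^sub>\<infinity>x\<in>V. 2 * (?k * (\<Sum>i\<in>S. (heat_kernel n (x \<otimes> i))\<^sup>2) - (\<Sum>i\<in>S. heat_kernel n (x \<otimes> i))\<^sup>2))"
  proof (rule infsum_mono)
    show "(\<lambda>x. (heat_kernel n (x \<otimes> inv s) - heat_kernel n (x \<otimes> t))\<^sup>2) summable_on V"
      using assms by (intro finite_supp_summable finite_supp_square finite_supp_diff finite_supp_right_mult heat_kernel_finite_supp) auto
    show "(\<lambda>x. 2 * (?k * (\<Sum>i\<in>S. (heat_kernel n (x \<otimes> i))\<^sup>2) - (\<Sum>i\<in>S. heat_kernel n (x \<otimes> i))\<^sup>2)) summable_on V"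
      using f1 f2 by (intro finite_supp_summable finite_supp_mult2 finite_supp_diff)
    show "(heat_kernel n (x \<otimes> inv s) - heat_kernel n (x \<otimes> t))\<^sup>2 \<le> 2 * (?k * (\<Sum>i\<in>S. (heat_kernel n (x \<otimes> i))\<^sup>2) - (\<Sum>i\<in>S. heat_kernel n (x \<otimes> i))\<^sup>2)" for x
      using pair_variance[OF S_fin S_inv[OF assms(1)] assms(2), of "\<lambda>i. heat_kernel n (x \<otimes> i)"] .
  qed
  also have "\<dots> = 2 * (?k * (?k * energy n) - ?k\<^sup>2 * energy (Suc n))"
  proof -
    have "(\<Sum>\<^sub>\<infinity>x\<in>V. ?k * (\<Sum>i\<in>S. (heat_kernel n (x \<otimes> i))\<^sup>2) - (\<Sum>i\<in>S. heat_kernel n (x \<otimes> i))\<^sup>2) =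
       (\<Sum>\<^sub>\<infinity>x\<in>V. ?k * (\<Sum>i\<in>S. (heat_kernel n (x \<otimes> i))\<^sup>2)) - (\<Sum>\<^sub>\<infinity>x\<in>V. (\<Sum>i\<in>S. heat_kernel n (x \<otimes> i))\<^sup>2)"
      using f1 f2 by (intro infsum_finite_supp_diff finite_supp_mult2)
    then show ?thesis unfolding infsum_cmult_right' sq tot by simp
  qed
  finally show ?thesis by (simp add: power2_eq_square algebra_simps)
qed

lemma shift_energy_nonneg: "0 \<le> shift_energy n g"
  unfolding shift_energy_def by (rule infsum_nonneg) simp

lemma energy_decreasing: "energy (Suc n) \<le> energy n"
proof -
  obtain s where s: "s \<in> S" using S_ne by blast
  have "0 \<le> 2 * (real (card S))\<^sup>2 * (energy n - energy (Suc n))"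
    using shift_energy_two_letters[OF s s, of n] shift_energy_nonneg[of n "s \<otimes> s"] by linarith
  then show ?thesis using card_S_pos by (simp add: zero_le_mult_iff)
qed

lemma energy_antimono: "n \<le> m \<Longrightarrow> energy m \<le> energy n"
  by (rule lift_Suc_antimono_le[of energy]) (rule energy_decreasing)

lemma energy_le_1: "energy n \<le> 1"
  using energy_antimono[of 0 n] by (simp add: energy_0)

text \<open>Pseudo-Poincare inequality: telescoping along the word and the triangle inequality in \<open>l\<^sup>2\<close> give a
factor quadratic in the length. The induction uses
\<open>(a + b)\<^sup>2 \<le> (1 + m) a\<^sup>2 + (1 + 1/m) b\<^sup>2\<close>, whose weights turn \<open>m\<^sup>2\<close> into \<open>(m + 1)\<^sup>2\<close>.\<close>

lemma shift_energy_even_word: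
  assumes "set w \<subseteq> S" "length w = 2 * m"
  shows "shift_energy n (wprod w) \<le> (real m)\<^sup>2 * (2 * (real (card S))\<^sup>2 * (energy n - energy (Suc n)))"
  using assms
proof (induction m arbitrary: w)
  case 0
  have "shift_energy n \<one> = (\<Sum>\<^sub>\<infinity>x\<in>V. 0)" unfolding shift_energy_def by (intro infsum_cong) simp
  then show ?case using 0 by simp
next
  case (Suc m)
  let ?e = "2 * (real (card S))\<^sup>2 * (energy n - energy (Suc n))"
  obtain s t w' where w: "w = s # t # w'" using Suc.prems(2) by (cases w; cases "tl w") auto
  have st: "s \<in> S" "t \<in> S" "set w' \<subseteq> S" "length w' = 2 * m" using Suc.prems w by auto
  define c where "c = s \<otimes> t"
  define g where "g = wprod w'"
  have V: "c \<in> V" "g \<in> V" "wprod w = c \<otimes> g"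
    using st S_sub by (auto simp: c_def g_def w m_assoc intro!: wprod_closed)
  have dc: "shift_energy n c \<le> ?e" using shift_energy_two_letters[OF st(1,2)] by (simp add: c_def)
  have dg: "shift_energy n g \<le> (real m)\<^sup>2 * ?e" using Suc.IH[OF st(3,4)] by (simp add: g_def)
  have shift: "(\<Sum>\<^sub>\<infinity>x\<in>V. (heat_kernel n (x \<otimes> c) - heat_kernel n (x \<otimes> c \<otimes> g))\<^sup>2) = shift_energy n g"
    unfolding shift_energy_def using V by (intro infsum_right_mult[where f="\<lambda>x. (heat_kernel n x - heat_kernel n (x \<otimes> g))\<^sup>2"])
  show ?case
  proof (cases "m = 0")
    case True
    then have "w' = []" using st by simp
    then have "wprod w = c" using V by (simp add: g_def)
    then show ?thesis using dc True by simp
  next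
    case False
    then have m: "0 < real m" by simp
    \<comment> \<open>Equality holds for \<open>b = m a\<close>, the case of equal increments along the word.\<close>
    have ineq: "(a + b)\<^sup>2 \<le> (1 + real m) * a\<^sup>2 + (1 + 1 / real m) * b\<^sup>2" for a b :: real
    proof -
      have "0 \<le> (real m * a - b)\<^sup>2 / real m" using m by simp
      also have "\<dots> = (1 + real m) * a\<^sup>2 + (1 + 1 / real m) * b\<^sup>2 - (a + b)\<^sup>2"
        using m by (simp add: field_simps power2_eq_square)
      finally show ?thesis by simp
    qed
    have fc: "finite_supp (\<lambda>x. (heat_kernel n x - heat_kernel n (x \<otimes> c))\<^sup>2)" using V finite_supp_shift_energy by blast
    have fg: "finite_supp (\<lambda>x. (heat_kernel n (x \<otimes> c) - heat_kernel n (x \<otimes> c \<otimes> g))\<^sup>2)"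
      using finite_supp_right_mult[OF V(1) finite_supp_shift_energy[OF V(2), of n]] .
    have "shift_energy n (wprod w) \<le> (\<Sum>\<^sub>\<infinity>x\<in>V. (1 + real m) * (heat_kernel n x - heat_kernel n (x \<otimes> c))\<^sup>2
        + (1 + 1 / real m) * (heat_kernel n (x \<otimes> c) - heat_kernel n (x \<otimes> c \<otimes> g))\<^sup>2)"
      unfolding shift_energy_def
    proof (rule infsum_mono)
      show "(\<lambda>x. (heat_kernel n x - heat_kernel n (x \<otimes> wprod w))\<^sup>2) summable_on V"
        using V by (intro finite_supp_summable finite_supp_shift_energy) auto
      show "(\<lambda>x. (1 + real m) * (heat_kernel n x - heat_kernel n (x \<otimes> c))\<^sup>2
        + (1 + 1 / real m) * (heat_kernel n (x \<otimes> c) - heat_kernel n (x \<otimes> c \<otimes> g))\<^sup>2) summable_on V"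
        using fc fg by (intro finite_supp_summable finite_supp_add finite_supp_mult2)
      fix x assume x: "x \<in> V"
      have "x \<otimes> c \<otimes> g = x \<otimes> wprod w" using x V by (simp add: m_assoc)
      then show "(heat_kernel n x - heat_kernel n (x \<otimes> wprod w))\<^sup>2 \<le> (1 + real m) * (heat_kernel n x - heat_kernel n (x \<otimes> c))\<^sup>2
        + (1 + 1 / real m) * (heat_kernel n (x \<otimes> c) - heat_kernel n (x \<otimes> c \<otimes> g))\<^sup>2"
        using ineq[of "heat_kernel n x - heat_kernel n (x \<otimes> c)" "heat_kernel n (x \<otimes> c) - heat_kernel n (x \<otimes> c \<otimes> g)"] by simp
    qed
    also have "\<dots> = (\<Sum>\<^sub>\<infinity>x\<in>V. (1 + real m) * (heat_kernel n x - heat_kernel n (x \<otimes> c))\<^sup>2)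
        + (\<Sum>\<^sub>\<infinity>x\<in>V. (1 + 1 / real m) * (heat_kernel n (x \<otimes> c) - heat_kernel n (x \<otimes> c \<otimes> g))\<^sup>2)"
      using fc fg by (intro infsum_add finite_supp_summable finite_supp_mult2)
    also have "\<dots> = (1 + real m) * shift_energy n c + (1 + 1 / real m) * shift_energy n g"
      unfolding infsum_cmult_right' shift by (simp add: shift_energy_def)
    also have "\<dots> \<le> (1 + real m) * ?e + (1 + 1 / real m) * ((real m)\<^sup>2 * ?e)"
      using dc dg m by (intro add_mono mult_left_mono) auto
    also have "\<dots> = (real (Suc m))\<^sup>2 * ?e"
    proof -
      have "(1 + real m) * e + (1 + 1 / real m) * ((real m)\<^sup>2 * e) = (real (Suc m))\<^sup>2 * e" for e
        using m by (simp add: field_simps power2_eq_square)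
      then show ?thesis .
    qed
    finally show ?thesis .
  qed
qed

text \<open>Words of length exactly \<open>2 m\<close>; inserting \<open>s\<close> and \<open>inv s\<close> shows that the sets increase with \<open>m\<close>.\<close>

definition even_words :: "nat \<Rightarrow> 'a set" where
  "even_words m = wprod ` {w. set w \<subseteq> S \<and> length w = 2 * m}"

lemma finite_even_words: "finite (even_words m)"
  unfolding even_words_def using S_fin by (intro finite_imageI finite_lists_length_eq)

lemma even_words_sub: "even_words m \<subseteq> V"
  using S_sub by (auto simp: even_words_def intro!: wprod_closed)

lemma even_words_Suc: "even_words m \<subseteq> even_words (Suc m)"
proof
  fix x assume "x \<in> even_words m"
  then obtain w where w: "x = wprod w" "set w \<subseteq> S" "length w = 2 * m" by (auto simp: even_words_def)
  obtain s where s: "s \<in> S" using S_ne by blast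
  have "wprod w \<in> V" using w S_sub by (auto intro!: wprod_closed)
  then have "wprod (s # inv s # w) = x" using s w by (simp add: mult_inv_cancel)
  then show "x \<in> even_words (Suc m)"
    unfolding even_words_def using w s S_inv by (intro image_eqI[of _ _ "s # inv s # w"]) auto
qed

lemma even_words_mono: "m \<le> n \<Longrightarrow> even_words m \<subseteq> even_words n"
  by (rule lift_Suc_mono_le[of even_words]) (rule even_words_Suc)

text \<open>A word of odd length becomes even after appending a fixed letter.\<close>

lemma card_wball_even_words: "m \<ge> 1 \<Longrightarrow> card (wball m) \<le> 2 * card (even_words m)"
proof -
  assume m: "m \<ge> 1"
  obtain s where s: "s \<in> S" using S_ne by blast
  have "wball m \<subseteq> even_words m \<union> (\<lambda>x. x \<otimes> inv s) ` even_words m"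
  proof
    fix x assume "x \<in> wball m"
    then obtain w where w: "x = wprod w" "set w \<subseteq> S" "length w \<le> m" by (auto simp: wball_def)
    have xV: "x \<in> V" using w S_sub by (auto intro!: wprod_closed)
    show "x \<in> even_words m \<union> (\<lambda>x. x \<otimes> inv s) ` even_words m"
    proof (cases "even (length w)")
      case True
      then have "x \<in> even_words (length w div 2)" using w by (auto simp: even_words_def)
      moreover have "length w div 2 \<le> m" using w(3) by arith
      ultimately show ?thesis using even_words_mono by blast
    next
      case False
      have "wprod (w @ [s]) = x \<otimes> s" using w s S_sub by (subst wprod_append) auto
      then have "x \<otimes> s \<in> even_words ((length w + 1) div 2)"
        unfolding even_words_def using w s False by (intro image_eqI[of _ _ "w @ [s]"]) auto
      moreover have "(length w + 1) div 2 \<le> m" using w(3) m by arith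
      ultimately have "x \<otimes> s \<in> even_words m" using even_words_mono by blast
      moreover have "x = x \<otimes> s \<otimes> inv s" using s xV by (simp add: m_assoc)
      ultimately show ?thesis by blast
    qed
  qed
  then have "card (wball m) \<le> card (even_words m \<union> (\<lambda>x. x \<otimes> inv s) ` even_words m)"
    using finite_even_words by (intro card_mono) auto
  also have "\<dots> \<le> card (even_words m) + card ((\<lambda>x. x \<otimes> inv s) ` even_words m)" by (rule card_Un_le)
  also have "\<dots> \<le> card (even_words m) + card (even_words m)" using card_image_le[OF finite_even_words] by simp
  finally show ?thesis by simp
qed

text \<open>Polarisation, using that translation preserves the \<open>l\<^sup>2\<close> norm.\<close>

lemma correlation:
  assumes g: "g \<in> V"
  shows "energy n = (\<Sum>\<^sub>\<infinity>x\<in>V. heat_kernel n x * heat_kernel n (x \<otimes> g)) + shift_energy n g / 2"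
proof -
  have f: "finite_supp (\<lambda>x. (heat_kernel n x)\<^sup>2)" "finite_supp (\<lambda>x. (heat_kernel n (x \<otimes> g))\<^sup>2)" "finite_supp (\<lambda>x. heat_kernel n x * heat_kernel n (x \<otimes> g))"
    by (intro finite_supp_square heat_kernel_finite_supp, intro finite_supp_square finite_supp_right_mult[OF g] heat_kernel_finite_supp, intro finite_supp_mult heat_kernel_finite_supp)
  have "shift_energy n g = (\<Sum>\<^sub>\<infinity>x\<in>V. ((heat_kernel n x)\<^sup>2 + (heat_kernel n (x \<otimes> g))\<^sup>2) - 2 * (heat_kernel n x * heat_kernel n (x \<otimes> g)))"
    unfolding shift_energy_def by (intro infsum_cong) (simp add: power2_diff)
  also have "\<dots> = (\<Sum>\<^sub>\<infinity>x\<in>V. (heat_kernel n x)\<^sup>2 + (heat_kernel n (x \<otimes> g))\<^sup>2) - (\<Sum>\<^sub>\<infinity>x\<in>V. 2 * (heat_kernel n x * heat_kernel n (x \<otimes> g)))"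
    by (rule infsum_finite_supp_diff[OF finite_supp_add[OF f(1,2)] finite_supp_mult2[OF f(3)]])
  also have "(\<Sum>\<^sub>\<infinity>x\<in>V. (heat_kernel n x)\<^sup>2 + (heat_kernel n (x \<otimes> g))\<^sup>2) =
      (\<Sum>\<^sub>\<infinity>x\<in>V. (heat_kernel n x)\<^sup>2) + (\<Sum>\<^sub>\<infinity>x\<in>V. (heat_kernel n (x \<otimes> g))\<^sup>2)"
    by (rule infsum_add[OF finite_supp_summable[OF f(1)] finite_supp_summable[OF f(2)]])
  also have "(\<Sum>\<^sub>\<infinity>x\<in>V. (heat_kernel n (x \<otimes> g))\<^sup>2) = (\<Sum>\<^sub>\<infinity>x\<in>V. (heat_kernel n x)\<^sup>2)"
    by (rule infsum_right_mult[OF g, of "\<lambda>x. (heat_kernel n x)\<^sup>2"])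
  finally have "shift_energy n g = energy n + energy n - 2 * (\<Sum>\<^sub>\<infinity>x\<in>V. heat_kernel n x * heat_kernel n (x \<otimes> g))"
    unfolding infsum_cmult_right' energy_def .
  then show ?thesis by linarith
qed

text \<open>Average the polarisation identity over the even words of length \<open>2 m\<close>: the correlations sum up to at
most \<open>1\<close> since the kernel has mass \<open>1\<close>, and the differences are controlled by the pseudo-Poincare
inequality. This is the Nash inequality before optimising over \<open>m\<close>.\<close>

lemma energy_recursion:
  assumes m: "m \<ge> 1"
  shows "energy n \<le> 1 / card (even_words m) + (real (card S))\<^sup>2 * (real m)\<^sup>2 * (energy n - energy (Suc n))"
proof -
  let ?A = "even_words m"
  have A: "finite ?A" "?A \<subseteq> V" using finite_even_words even_words_sub by auto
  have "wball m \<noteq> {}" using one_wball by blast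
  then have "card (wball m) > 0" unfolding card_gt_0_iff by simp
  then have cA: "0 < real (card ?A)" using card_wball_even_words[OF m] by linarith
  have "card ?A * energy n = (\<Sum>g\<in>?A. (\<Sum>\<^sub>\<infinity>x\<in>V. heat_kernel n x * heat_kernel n (x \<otimes> g)) + shift_energy n g / 2)"
  proof -
    have "(\<Sum>g\<in>?A. energy n) = (\<Sum>g\<in>?A. (\<Sum>\<^sub>\<infinity>x\<in>V. heat_kernel n x * heat_kernel n (x \<otimes> g)) + shift_energy n g / 2)"
      using A(2) by (intro sum.cong refl correlation) blast
    then show ?thesis by simp
  qed
  also have "\<dots> = (\<Sum>g\<in>?A. \<Sum>\<^sub>\<infinity>x\<in>V. heat_kernel n x * heat_kernel n (x \<otimes> g)) + (\<Sum>g\<in>?A. shift_energy n g / 2)"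
    by (rule sum.distrib)
  also have "(\<Sum>g\<in>?A. shift_energy n g / 2) \<le> (\<Sum>g\<in>?A. (real m)\<^sup>2 * (2 * (real (card S))\<^sup>2 * (energy n - energy (Suc n))) / 2)"
    by (intro sum_mono divide_right_mono) (auto simp: even_words_def intro!: shift_energy_even_word)
  also have "\<dots> = card ?A * ((real (card S))\<^sup>2 * (real m)\<^sup>2 * (energy n - energy (Suc n)))"
    by simp
  also have "(\<Sum>g\<in>?A. \<Sum>\<^sub>\<infinity>x\<in>V. heat_kernel n x * heat_kernel n (x \<otimes> g)) = (\<Sum>\<^sub>\<infinity>x\<in>V. \<Sum>g\<in>?A. heat_kernel n x * heat_kernel n (x \<otimes> g))"
    using A by (intro infsum_finite_sum[symmetric] finite_supp_mult heat_kernel_finite_supp) auto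
  also have "\<dots> \<le> (\<Sum>\<^sub>\<infinity>x\<in>V. heat_kernel n x)"
  proof (rule infsum_mono)
    show "(\<lambda>x. \<Sum>g\<in>?A. heat_kernel n x * heat_kernel n (x \<otimes> g)) summable_on V"
      using A by (intro finite_supp_summable finite_supp_sum finite_supp_mult heat_kernel_finite_supp)
    show "heat_kernel n summable_on V" by (intro finite_supp_summable heat_kernel_finite_supp)
    fix x assume x: "x \<in> V"
    have inj: "inj_on (\<lambda>g. x \<otimes> g) ?A"
      using x A(2) by (intro inj_onI) (metis inv_mult_cancel subsetD)
    have "(\<Sum>g\<in>?A. heat_kernel n (x \<otimes> g)) = (\<Sum>y\<in>(\<lambda>g. x \<otimes> g) ` ?A. heat_kernel n y)"
      by (simp add: sum.reindex[OF inj])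
    also have "\<dots> \<le> (\<Sum>\<^sub>\<infinity>y\<in>V. heat_kernel n y)"
      using A x heat_kernel_nonneg by (intro finite_sum_le_infsum finite_supp_summable heat_kernel_finite_supp) auto
    finally have "heat_kernel n x * (\<Sum>g\<in>?A. heat_kernel n (x \<otimes> g)) \<le> heat_kernel n x * 1"
      unfolding heat_kernel_total by (intro mult_left_mono heat_kernel_nonneg)
    then show "(\<Sum>g\<in>?A. heat_kernel n x * heat_kernel n (x \<otimes> g)) \<le> heat_kernel n x" by (simp add: sum_distrib_left)
  qed
  finally have "card ?A * energy n \<le> 1 + card ?A * ((real (card S))\<^sup>2 * (real m)\<^sup>2 * (energy n - energy (Suc n)))"
    by (simp add: heat_kernel_total)
  then have "energy n \<le> (1 + card ?A * ((real (card S))\<^sup>2 * (real m)\<^sup>2 * (energy n - energy (Suc n)))) / card ?A"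
    using cA by (simp add: pos_le_divide_eq mult.commute)
  then show ?thesis using cA by (simp add: add_divide_distrib)
qed

text \<open>The rate \<open>n\<close> to the power \<open>- 5/2\<close> along powers of \<open>4\<close>. With \<open>m = 2 ^ j\<close>, as long as the energy exceeds twice the
volume term, the recursion makes it decrease by the factor \<open>1 - 1 / (2 k\<^sup>2 m\<^sup>2)\<close> per step, and
the number of steps up to the next power of \<open>4\<close> is \<open>12 k\<^sup>2 m\<^sup>2\<close>; hence the factor \<open>exp (- 6) < 1/32\<close>.\<close>

lemma energy_decay:
  assumes c: "c > 0" and growth: "\<And>m. m \<ge> 1 \<Longrightarrow> c * real m ^ 5 \<le> card (wball m)"
  shows "energy (4 * (card S)\<^sup>2 * 4 ^ j) \<le> max 1 (128 / c) / 32 ^ j"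
proof (induction j)
  case 0 then show ?case using energy_le_1[of "4 * (card S)\<^sup>2"] by simp
next
  case (Suc j)
  let ?k = "real (card S)" and ?K = "max 1 (128 / c)"
  define N where "N = 4 * (card S)\<^sup>2 * 4 ^ j"
  define m :: nat where "m = 2 ^ j"
  have m: "m \<ge> 1" "real m ^ 5 = 32 ^ j" "(real m)\<^sup>2 = 4 ^ j"
  proof -
    have "((2::real) ^ j) ^ 5 = (2 ^ 5) ^ j" "((2::real) ^ j)\<^sup>2 = (2\<^sup>2) ^ j"
      by (metis power_mult mult.commute)+
    then show "real m ^ 5 = 32 ^ j" "(real m)\<^sup>2 = 4 ^ j" by (simp_all add: m_def)
  qed (simp add: m_def)
  have k: "?k > 0" using card_S_pos by simp
  have IH: "energy N \<le> ?K / 32 ^ j" using Suc by (simp add: N_def)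
  have rec: "energy n \<le> 2 / c / 32 ^ j + ?k\<^sup>2 * 4 ^ j * (energy n - energy (Suc n))" for n
  proof -
    have "c * 32 ^ j \<le> 2 * real (card (even_words m))"
      using growth[OF m(1)] card_wball_even_words[OF m(1)] m(2) by simp
    moreover have "0 < c * 32 ^ j" using c by simp
    ultimately have "1 / card (even_words m) \<le> 1 / (c * 32 ^ j / 2)"
      by (intro divide_left_mono mult_pos_pos) linarith+
    then show ?thesis using energy_recursion[OF m(1), of n] m(3) by simp
  qed
  have "energy (4 * N) \<le> ?K / 32 ^ Suc j"
  proof (cases "energy (4 * N) \<le> 4 / c / 32 ^ j")
    case True
    also have "4 / c / 32 ^ j = (128 / c) / 32 ^ Suc j" using c by (simp add: field_simps)
    also have "\<dots> \<le> ?K / 32 ^ Suc j" by (intro divide_right_mono) auto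
    finally show ?thesis .
  next
    case False
    \<comment> \<open>The energy stays above twice the volume term up to time \<open>4 N\<close> and so decreases geometrically.\<close>
    define r where "r = 1 - 1 / (2 * ?k\<^sup>2 * 4 ^ j)"
    have kj: "1 \<le> ?k\<^sup>2 * 4 ^ j"
    proof -
      have "1 * 1 \<le> ?k\<^sup>2 * 4 ^ j" using card_S_pos by (intro mult_mono) (auto simp: one_le_power)
      then show ?thesis by simp
    qed
    have pos: "0 < 2 * ?k\<^sup>2 * 4 ^ j" using k by simp
    have "1 \<le> 2 * (?k\<^sup>2 * 4 ^ j)" using kj by linarith
    then have "1 \<le> 2 * ?k\<^sup>2 * 4 ^ j" unfolding mult.assoc .
    then have "1 / (2 * ?k\<^sup>2 * 4 ^ j) \<le> 1"
      by (rule divide_le_eq_1_pos[OF pos, THEN iffD2])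
    then have r0: "0 \<le> r" by (simp add: r_def)
    have step: "energy (Suc n) \<le> energy n * r" if "n \<le> 4 * N" for n
    proof -
      have "4 / c / 32 ^ j < energy n" using False energy_antimono[OF that] by linarith
      then have "energy n / 2 \<le> ?k\<^sup>2 * 4 ^ j * (energy n - energy (Suc n))" using rec[of n] by linarith
      then have "energy n / 2 / (?k\<^sup>2 * 4 ^ j) \<le> energy n - energy (Suc n)"
        using less_le_trans[OF zero_less_one kj] by (simp add: pos_divide_le_eq mult.commute)
      then show ?thesis by (simp add: r_def algebra_simps)
    qed
    have "energy (N + i) \<le> energy N * r ^ i" if "i \<le> 3 * N" for i
      using that
    proof (induction i)
      case (Suc i)
      have "energy (N + Suc i) \<le> energy (N + i) * r" using step[of "N + i"] Suc.prems by simp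
      also have "\<dots> \<le> energy N * r ^ i * r" using Suc r0 by (intro mult_right_mono) auto
      finally show ?case by (simp add: mult_ac)
    qed simp
    from this[of "3 * N"] have "energy (4 * N) \<le> energy N * r ^ (3 * N)" by simp
    also have "r ^ (3 * N) \<le> 1 / 32"
    proof -
      have "r \<le> exp (- (1 / (2 * ?k\<^sup>2 * 4 ^ j)))"
        using exp_ge_add_one_self[of "- (1 / (2 * ?k\<^sup>2 * 4 ^ j))"] by (simp add: r_def)
      then have "r ^ (3 * N) \<le> exp (- (1 / (2 * ?k\<^sup>2 * 4 ^ j))) ^ (3 * N)"
        using r0 by (rule power_mono)
      also have "\<dots> = exp (real (3 * N) * (- (1 / (2 * ?k\<^sup>2 * 4 ^ j))))"
        by (rule exp_of_nat_mult[symmetric])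
      also have "real (3 * N) * (- (1 / (2 * ?k\<^sup>2 * 4 ^ j))) = - 6"
        using k by (simp add: N_def)
      also have "exp (- 6 :: real) \<le> 1 / 32"
      proof -
        have "(2 :: real) ^ 6 \<le> exp 1 ^ 6" using exp_ge_add_one_self[of "1::real"] by (intro power_mono) auto
        also have "\<dots> = exp 6" by (simp add: exp_of_nat_mult[symmetric])
        finally have "32 \<le> exp (6 :: real)" by simp
        then have "1 / exp (6 :: real) \<le> 1 / 32" by (intro divide_left_mono) auto
        then show ?thesis by (simp add: exp_minus inverse_eq_divide)
      qed
      finally show ?thesis .
    qed
    then have "energy N * r ^ (3 * N) \<le> ?K / 32 ^ j * (1 / 32)"
      using IH energy_nonneg[of N] r0 c by (intro mult_mono) auto
    finally show ?thesis by simp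
  qed
  then show ?case by (simp add: N_def mult_ac)
qed

text \<open>Over the \<open>j\<close>-th block of times, up to \<open>R * 4 ^ Suc j\<close>, the sum is of order \<open>16 ^ j / 32 ^ j\<close>. It is at this
point that growth of order more than four is needed.\<close>

lemma energy_summable:
  assumes c: "c > 0" and growth: "\<And>m. m \<ge> 1 \<Longrightarrow> c * real m ^ 5 \<le> card (wball m)"
  shows "summable (\<lambda>n. (real n + 1) * energy n)"
proof -
  define R where "R = 4 * (card S)\<^sup>2"
  define K where "K = max 1 (128 / c)"
  have R: "R \<ge> 1" using card_S_pos by (simp add: R_def)
  have K: "K \<ge> 1" by (simp add: K_def)
  let ?a = "\<lambda>n. (real n + 1) * energy n"
  have a0: "0 \<le> ?a n" for n using energy_nonneg by simp
  have "(\<Sum>n<R * 4 ^ J. ?a n) \<le> (real R)\<^sup>2 + 16 * (real R)\<^sup>2 * K * (\<Sum>j<J. (1/2) ^ j)" for J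
  proof (induction J)
    case 0
    have "(\<Sum>n<R. ?a n) \<le> (\<Sum>n<R. real R * 1)"
      using energy_le_1 energy_nonneg by (intro sum_mono mult_mono) auto
    then show ?case by (simp add: power2_eq_square)
  next
    case (Suc J)
    have "(\<Sum>n<R * 4 ^ Suc J. ?a n) = (\<Sum>n<R * 4 ^ J. ?a n) + (\<Sum>n=R * 4 ^ J..<R * 4 ^ Suc J. ?a n)"
      by (subst lessThan_atLeast0, subst lessThan_atLeast0, rule sum.atLeastLessThan_concat[symmetric]) auto
    also have "(\<Sum>n=R * 4 ^ J..<R * 4 ^ Suc J. ?a n) \<le> (\<Sum>n=R * 4 ^ J..<R * 4 ^ Suc J. real (R * 4 ^ Suc J) * (K / 32 ^ J))"
    proof (rule sum_mono)
      fix n assume n: "n \<in> {R * 4 ^ J..<R * 4 ^ Suc J}"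
      have "energy n \<le> energy (R * 4 ^ J)" using n by (intro energy_antimono) auto
      also have "\<dots> \<le> K / 32 ^ J" using energy_decay[OF c growth, of J] by (simp add: R_def K_def)
      finally have e: "energy n \<le> K / 32 ^ J" .
      have "Suc n \<le> R * 4 ^ Suc J" using n by simp
      then have "real (Suc n) \<le> real (R * 4 ^ Suc J)" by (rule of_nat_mono)
      then have "real n + 1 \<le> real (R * 4 ^ Suc J)" by simp
      then show "?a n \<le> real (R * 4 ^ Suc J) * (K / 32 ^ J)"
        using e energy_nonneg by (intro mult_mono) auto
    qed
    also have "\<dots> = real (R * 4 ^ Suc J - R * 4 ^ J) * (real (R * 4 ^ Suc J) * (K / 32 ^ J))" by simp
    also have "\<dots> \<le> real (R * 4 ^ Suc J) * (real (R * 4 ^ Suc J) * (K / 32 ^ J))"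
      using K by (intro mult_right_mono) auto
    also have "\<dots> = 16 * (real R)\<^sup>2 * K * (1/2) ^ J"
    proof -
      have "(4::real) ^ J * 4 ^ J * 2 ^ J = 32 ^ J" by (simp add: power_mult_distrib[symmetric])
      then show ?thesis by (simp add: power2_eq_square field_simps)
    qed
    finally show ?case using Suc by (simp add: algebra_simps)
  qed
  moreover have "(\<Sum>j<J. (1/2::real) ^ j) \<le> 2" for J
    using sum_le_suminf[of "\<lambda>j. (1/2::real) ^ j" "{..<J}"] by (simp add: suminf_geometric)
  ultimately have "(\<Sum>n<R * 4 ^ J. ?a n) \<le> (real R)\<^sup>2 + 16 * (real R)\<^sup>2 * K * 2" for J
  proof -
    have "16 * (real R)\<^sup>2 * K * (\<Sum>j<J. (1/2::real) ^ j) \<le> 16 * (real R)\<^sup>2 * K * 2"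
      using K \<open>\<And>J. (\<Sum>j<J. (1/2::real) ^ j) \<le> 2\<close>[of J] by (intro mult_left_mono) auto
    with \<open>\<And>J. (\<Sum>n<R * 4 ^ J. ?a n) \<le> _ J\<close>[of J] show ?thesis by linarith
  qed
  note bnd = this
  show ?thesis
  proof (rule bounded_imp_summable)
    show "0 \<le> ?a n" for n by (rule a0)
    fix n
    have "n < 4 ^ n" by (rule less_exp[of n, THEN less_le_trans]) (simp add: power_mono)
    then have "Suc n \<le> R * 4 ^ n" using R by (metis Suc_leI le_trans mult_le_mono1 nat_mult_1)
    then have "(\<Sum>k\<le>n. ?a k) \<le> (\<Sum>k<R * 4 ^ n. ?a k)"
      using a0 by (intro sum_mono2) auto
    then show "(\<Sum>k\<le>n. ?a k) \<le> (real R)\<^sup>2 + 16 * (real R)\<^sup>2 * K * 2" using bnd[of n] by linarith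
  qed
qed

lemma chapman_kolmogorov:
  assumes "x \<in> V"
  shows "heat_kernel (n + m) x = (\<Sum>\<^sub>\<infinity>y\<in>V. heat_kernel n y * heat_kernel m (inv y \<otimes> x))"
  using assms
proof (induction m arbitrary: x)
  case 0
  have "(\<Sum>\<^sub>\<infinity>y\<in>V. heat_kernel n y * heat_kernel 0 (inv y \<otimes> x)) = (\<Sum>\<^sub>\<infinity>y\<in>{x}. heat_kernel n y * heat_kernel 0 (inv y \<otimes> x))"
  proof (rule infsum_cong_neutral)
    fix y assume y: "y \<in> V - {x}"
    have "inv y \<otimes> x \<noteq> \<one>"
    proof
      assume *: "inv y \<otimes> x = \<one>"
      have "y \<otimes> (inv y \<otimes> x) = x" using y 0 by (intro mult_inv_cancel) auto
      moreover have "y \<otimes> \<one> = y" using y by (intro r_one) auto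
      ultimately show False using * y by simp
    qed
    then show "heat_kernel n y * heat_kernel 0 (inv y \<otimes> x) = 0" by simp
  qed (use 0 in auto)
  then show ?case using 0 by simp
next
  case (Suc m)
  have "heat_kernel (n + Suc m) x = (\<Sum>s\<in>S. heat_kernel (n + m) (x \<otimes> s)) / card S" by simp
  also have "(\<Sum>s\<in>S. heat_kernel (n + m) (x \<otimes> s)) = (\<Sum>s\<in>S. \<Sum>\<^sub>\<infinity>y\<in>V. heat_kernel n y * heat_kernel m (inv y \<otimes> (x \<otimes> s)))"
    using Suc by (intro sum.cong refl) auto
  also have "\<dots> = (\<Sum>\<^sub>\<infinity>y\<in>V. \<Sum>s\<in>S. heat_kernel n y * heat_kernel m (inv y \<otimes> (x \<otimes> s)))"
    using S_fin by (intro infsum_finite_sum[symmetric] finite_supp_mult heat_kernel_finite_supp)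
  also have "\<dots> / card S = (\<Sum>\<^sub>\<infinity>y\<in>V. (\<Sum>s\<in>S. heat_kernel n y * heat_kernel m (inv y \<otimes> (x \<otimes> s))) / card S)"
    unfolding divide_inverse by (rule infsum_cmult_left'[symmetric])
  also have "\<dots> = (\<Sum>\<^sub>\<infinity>y\<in>V. heat_kernel n y * heat_kernel (Suc m) (inv y \<otimes> x))"
    using Suc.prems by (intro infsum_cong) (simp add: sum_distrib_left m_assoc)
  finally show ?case .
qed

text \<open>Chapman-Kolmogorov and the inequality between arithmetic and geometric mean.\<close>

lemma heat_kernel_even_le: "x \<in> V \<Longrightarrow> heat_kernel (n + n) x \<le> energy n"
proof -
  assume x: "x \<in> V"
  have bij: "bij_betw (\<lambda>y. inv y \<otimes> x) V V" by (rule bij_inv_mult[OF x])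
  have f: "finite_supp (\<lambda>y. (heat_kernel n y)\<^sup>2)" "finite_supp (\<lambda>y. (heat_kernel n (inv y \<otimes> x))\<^sup>2)"
    by (auto intro!: finite_supp_square heat_kernel_finite_supp finite_supp_bij[OF bij])
  have "heat_kernel (n + n) x = (\<Sum>\<^sub>\<infinity>y\<in>V. heat_kernel n y * heat_kernel n (inv y \<otimes> x))" by (rule chapman_kolmogorov[OF x])
  also have "\<dots> \<le> (\<Sum>\<^sub>\<infinity>y\<in>V. 1/2 * ((heat_kernel n y)\<^sup>2 + (heat_kernel n (inv y \<otimes> x))\<^sup>2))"
  proof (rule infsum_mono)
    show "(\<lambda>y. heat_kernel n y * heat_kernel n (inv y \<otimes> x)) summable_on V" by (intro finite_supp_summable finite_supp_mult heat_kernel_finite_supp)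
    show "(\<lambda>y. 1/2 * ((heat_kernel n y)\<^sup>2 + (heat_kernel n (inv y \<otimes> x))\<^sup>2)) summable_on V"
      using f by (intro finite_supp_summable finite_supp_mult2 finite_supp_add)
    show "heat_kernel n y * heat_kernel n (inv y \<otimes> x) \<le> 1/2 * ((heat_kernel n y)\<^sup>2 + (heat_kernel n (inv y \<otimes> x))\<^sup>2)" for y
      using sum_squares_bound[of "heat_kernel n y" "heat_kernel n (inv y \<otimes> x)"] by simp
  qed
  also have "\<dots> = 1/2 * ((\<Sum>\<^sub>\<infinity>y\<in>V. (heat_kernel n y)\<^sup>2) + (\<Sum>\<^sub>\<infinity>y\<in>V. (heat_kernel n (inv y \<otimes> x))\<^sup>2))"
    unfolding infsum_cmult_right' using f by (subst infsum_add) (auto intro!: finite_supp_summable)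
  also have "(\<Sum>\<^sub>\<infinity>y\<in>V. (heat_kernel n (inv y \<otimes> x))\<^sup>2) = energy n"
    unfolding energy_def by (rule infsum_reindex_bij_betw[OF bij, where f="\<lambda>y. (heat_kernel n y)\<^sup>2"])
  finally show ?thesis by (simp add: energy_def)
qed

lemma heat_kernel_le: "x \<in> V \<Longrightarrow> heat_kernel n x \<le> energy (n div 2)"
proof (cases "even n")
  case True
  assume "x \<in> V"
  moreover obtain m where "n = m + m" using True by (metis evenE mult_2)
  ultimately show ?thesis using heat_kernel_even_le[of x m] by simp
next
  case False
  assume x: "x \<in> V"
  obtain m where m: "n = Suc (m + m)" using False by (metis oddE mult_2 Suc_eq_plus1)
  have "heat_kernel n x \<le> (\<Sum>s\<in>S. energy m) / card S"
    unfolding m heat_kernel.simps using x by (intro divide_right_mono sum_mono heat_kernel_even_le) auto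
  also have "\<dots> = energy m" using card_S_pos by simp
  finally show ?thesis using m by simp
qed

text \<open>The form of on-diagonal decay used later: a uniform bound on the kernel with finite first moment.\<close>

theorem heat_kernel_decay:
  assumes c: "c > 0" and growth: "\<And>m. m \<ge> 1 \<Longrightarrow> c * real m ^ 5 \<le> card (wball m)"
  obtains b where "\<And>n x. x \<in> V \<Longrightarrow> heat_kernel n x \<le> b n" "\<And>n. 0 \<le> b n" "summable (\<lambda>n. (real n + 1) * b n)"
proof
  show "heat_kernel n x \<le> energy (n div 2)" if "x \<in> V" for n x by (rule heat_kernel_le[OF that])
  show "0 \<le> energy (n div 2)" for n by (rule energy_nonneg)
  let ?a = "\<lambda>n. (real n + 1) * energy n"
  have sm: "summable ?a" by (rule energy_summable[OF c growth])
  have "(\<Sum>n<2 * N. (real n + 1) * energy (n div 2)) \<le> 4 * (\<Sum>i<N. ?a i)" for N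
  proof (induction N)
    case (Suc N)
    have "(\<Sum>n<2 * Suc N. (real n + 1) * energy (n div 2)) =
        (\<Sum>n<2 * N. (real n + 1) * energy (n div 2)) + (4 * real N + 3) * energy N"
      by (simp add: algebra_simps)
    also have "\<dots> \<le> 4 * (\<Sum>i<N. ?a i) + (4 * real N + 4) * energy N"
      using Suc energy_nonneg[of N] by (intro add_mono mult_right_mono) auto
    finally show ?case by (simp add: algebra_simps)
  qed simp
  also have "4 * (\<Sum>i<N. ?a i) \<le> 4 * suminf ?a" for N
    using sm energy_nonneg by (intro mult_left_mono sum_le_suminf) auto
  finally have bnd: "(\<Sum>n<2 * N. (real n + 1) * energy (n div 2)) \<le> 4 * suminf ?a" for N .
  show "summable (\<lambda>n. (real n + 1) * energy (n div 2))"
  proof (rule bounded_imp_summable)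
    show "0 \<le> (real n + 1) * energy (n div 2)" for n using energy_nonneg by simp
    fix n
    have "(\<Sum>k\<le>n. (real k + 1) * energy (k div 2)) \<le> (\<Sum>k<2 * Suc n. (real k + 1) * energy (k div 2))"
      using energy_nonneg by (intro sum_mono2) auto
    also have "\<dots> \<le> 4 * suminf ?a" by (rule bnd)
    finally show "(\<Sum>k\<le>n. (real k + 1) * energy (k div 2)) \<le> 4 * suminf ?a" .
  qed
qed

end

end

text \<open>\<open>v\<close> is the starting vertex of the walk.\<close>

locale cayley_walk = cayley +
  fixes v :: 'a
  assumes v: "v \<in> carrier \<Gamma>" and S_ne: "S \<noteq> {}"
begin

section \<open>The two-sided walk\<close>

text \<open>Independent uniform increments indexed by all integers. On this space shifts and splicings of the
walk become injections of the index set, which preserve the measure; and all sample points have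
letters in \<open>S\<close>.\<close>

definition \<Xi> :: "(int \<Rightarrow> 'a) measure" where
  "\<Xi> = (\<Pi>\<^sub>M i\<in>UNIV. uniform_count_measure S)"

lemma space_\<Xi>: "space \<Xi> = {\<xi>. \<forall>i. \<xi> i \<in> S}"
  by (auto simp: \<Xi>_def space_PiM space_uniform_count_measure PiE_iff)

lemma prob_space_letter: "prob_space (uniform_count_measure S)"
  using S_fin S_ne by (intro prob_space_uniform_count_measure)

lemma prob_space_\<Xi>: "prob_space \<Xi>"
  unfolding \<Xi>_def by (intro prob_space_PiM prob_space_letter)

lemma \<Xi>_finite_measurable:
  "finite J \<Longrightarrow> depends_on \<Xi> J f \<Longrightarrow> f \<in> measurable \<Xi> (count_space UNIV)"
  unfolding \<Xi>_def using S_fin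
  by (intro measurable_depends_on_finite[where J=J]) (auto simp: space_uniform_count_measure sets_uniform_count_measure)

primrec forward :: "(int \<Rightarrow> 'a) \<Rightarrow> nat \<Rightarrow> 'a" where
  "forward \<xi> 0 = v"
| "forward \<xi> (Suc n) = forward \<xi> n \<otimes> \<xi> (int n)"

text \<open>The increment with index \<open>- n - 1\<close> leads from time \<open>- n - 1\<close> to time \<open>- n\<close>, so it is inverted when read backwards.\<close>

primrec backward :: "(int \<Rightarrow> 'a) \<Rightarrow> nat \<Rightarrow> 'a" where
  "backward \<xi> 0 = v"
| "backward \<xi> (Suc n) = backward \<xi> n \<otimes> inv (\<xi> (- int n - 1))"

definition pos :: "(int \<Rightarrow> 'a) \<Rightarrow> int \<Rightarrow> 'a" where
  "pos \<xi> = two_sided (forward \<xi>) (backward \<xi>)"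

lemma pos_0 [simp]: "pos \<xi> 0 = v"
  by (simp add: pos_def two_sided_def)

lemma \<xi>_in: "\<xi> \<in> space \<Xi> \<Longrightarrow> \<xi> i \<in> S"
  by (simp add: space_\<Xi>)

lemma forward_in: "\<xi> \<in> space \<Xi> \<Longrightarrow> forward \<xi> n \<in> V"
  by (induction n) (auto simp: v \<xi>_in)

lemma backward_in: "\<xi> \<in> space \<Xi> \<Longrightarrow> backward \<xi> n \<in> V"
  by (induction n) (auto simp: v \<xi>_in)

lemma pos_in [simp]: "\<xi> \<in> space \<Xi> \<Longrightarrow> pos \<xi> k \<in> V"
  by (simp add: pos_def two_sided_def forward_in backward_in)

lemma pos_step: "\<xi> \<in> space \<Xi> \<Longrightarrow> pos \<xi> (k + 1) = pos \<xi> k \<otimes> \<xi> k"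
proof (cases "k \<ge> 0")
  case True
  then obtain n where "k = int n" using nonneg_int_cases by blast
  then show ?thesis by (simp add: pos_def two_sided_def nat_add_distrib)
next
  case False
  assume \<xi>: "\<xi> \<in> space \<Xi>"
  define n where "n = nat (- k - 1)"
  have k: "nat (- k) = Suc n" "- int n - 1 = k" "k + 1 = - int n" using False by (auto simp: n_def)
  have "pos \<xi> k = backward \<xi> (Suc n)" using False by (simp only: pos_def two_sided_def k if_False)
  then have "pos \<xi> k = backward \<xi> n \<otimes> inv (\<xi> k)" by (simp add: k(2))
  moreover have "pos \<xi> (k + 1) = backward \<xi> n"
    unfolding k(3) by (cases "n = 0") (simp_all add: pos_def two_sided_def)
  ultimately show ?thesis using \<xi> backward_in \<xi>_in[OF \<xi>] by (simp add: m_assoc)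
qed

text \<open>\<open>s\<close> is a walk with increments \<open>\<xi>\<close> from an arbitrary starting vertex.\<close>

definition has_increments :: "(int \<Rightarrow> 'a) \<Rightarrow> (int \<Rightarrow> 'a) \<Rightarrow> bool" where
  "has_increments s \<xi> \<longleftrightarrow> (\<forall>k. s k \<in> V \<and> s (k + 1) = s k \<otimes> \<xi> k)"

lemma has_increments_pos: "\<xi> \<in> space \<Xi> \<Longrightarrow> has_increments (pos \<xi>) \<xi>"
  by (simp add: has_increments_def pos_step)

text \<open>The increments on an interval of times determine the walk on it up to a left translation.\<close>

lemma has_increments_unique_on:
  assumes s: "has_increments s \<xi>" and s': "has_increments s' \<xi>'" and g: "g \<in> V" and 0: "s' 0 = g \<otimes> s 0"
    and eq: "\<And>i. a \<le> i \<Longrightarrow> i < b \<Longrightarrow> \<xi> i = \<xi>' i" and \<xi>: "\<xi> \<in> space \<Xi>" "\<xi>' \<in> space \<Xi>"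
    and k: "a \<le> k" "k \<le> b" "a \<le> 0" "0 \<le> b"
  shows "s' k = g \<otimes> s k"
proof -
  have up: "s' (int n) = g \<otimes> s (int n)" if "int n \<le> b" for n
    using that
  proof (induction n)
    case (Suc n)
    have "s' (int n + 1) = g \<otimes> s (int n) \<otimes> \<xi> (int n)"
      using Suc s' eq[of "int n"] k by (simp add: has_increments_def)
    also have "\<dots> = g \<otimes> s (int n + 1)"
      using s g \<xi>_in[OF \<xi>(1), of "int n"] by (simp add: has_increments_def m_assoc)
    finally show ?case by (simp add: add.commute)
  qed (simp add: 0)
  have down: "s' (- int n) = g \<otimes> s (- int n)" if "a \<le> - int n" for n
    using that
  proof (induction n)
    case (Suc n)
    let ?m = "- int (Suc n)"
    have e: "\<xi> ?m = \<xi>' ?m" using Suc.prems k eq[of ?m] by simp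
    have x: "\<xi> ?m \<in> V" using \<xi>_in[OF \<xi>(1)] by blast
    have 1: "s' (?m + 1) = s' ?m \<otimes> \<xi> ?m" "s (?m + 1) = s ?m \<otimes> \<xi> ?m" "s' ?m \<in> V" "s ?m \<in> V"
      using s s' e by (simp_all only: has_increments_def)
    have "s' (?m + 1) = g \<otimes> s (?m + 1)" using Suc by simp
    then have "s' ?m \<otimes> \<xi> ?m = (g \<otimes> s ?m) \<otimes> \<xi> ?m" using 1 g x by (simp add: m_assoc)
    then show ?case using 1 g x by (metis m_closed right_cancel)
  qed (simp add: 0)
  show ?thesis
  proof (cases "k \<ge> 0")
    case True then show ?thesis using up[of "nat k"] k by simp
  next
    case False then show ?thesis using down[of "nat (- k)"] k by simp
  qed
qed

lemma has_increments_unique: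
  assumes s: "has_increments s \<xi>" and \<xi>: "\<xi> \<in> space \<Xi>"
  shows "s k = (s 0 \<otimes> inv v) \<otimes> pos \<xi> k"
proof (rule has_increments_unique_on[OF has_increments_pos[OF \<xi>] s, where a="min 0 k" and b="max 0 k"])
  have "s 0 \<in> V" using s by (simp add: has_increments_def)
  then show "s 0 \<otimes> inv v \<in> V" "s 0 = (s 0 \<otimes> inv v) \<otimes> pos \<xi> 0"
    using v by (simp_all add: m_assoc)
qed (use \<xi> in auto)

definition shift :: "int \<Rightarrow> (int \<Rightarrow> 'a) \<Rightarrow> int \<Rightarrow> 'a" where
  "shift n \<xi> = (\<lambda>i. \<xi> (n + i))"

lemma has_increments_shift: "has_increments s \<xi> \<Longrightarrow> has_increments (\<lambda>k. s (n + k)) (shift n \<xi>)"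
  by (simp add: has_increments_def shift_def add.assoc[symmetric])

lemma depends_pos: "depends_on \<Xi> {min 0 k..<max 0 k} (\<lambda>\<xi>. pos \<xi> k)"
proof (rule depends_onI)
  fix \<xi> \<xi>' assume \<xi>: "\<xi> \<in> space \<Xi>" "\<xi>' \<in> space \<Xi>" and eq: "\<And>i. i \<in> {min 0 k..<max 0 k} \<Longrightarrow> \<xi> i = \<xi>' i"
  have "pos \<xi>' k = \<one> \<otimes> pos \<xi> k"
    by (rule has_increments_unique_on[OF has_increments_pos[OF \<xi>(1)] has_increments_pos[OF \<xi>(2)], where a="min 0 k" and b="max 0 k"])
       (use \<xi> eq v in auto)
  then show "pos \<xi> k = pos \<xi>' k" using \<xi> by simp
qed

primrec increment :: "(int \<Rightarrow> 'a) \<Rightarrow> int \<Rightarrow> nat \<Rightarrow> 'a" where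
  "increment \<xi> k 0 = \<one>"
| "increment \<xi> k (Suc n) = increment \<xi> k n \<otimes> \<xi> (k + int n)"

lemma increment_in: "\<xi> \<in> space \<Xi> \<Longrightarrow> increment \<xi> k n \<in> V"
  by (induction n) (auto simp: \<xi>_in)

lemma increment_wball: "\<xi> \<in> space \<Xi> \<Longrightarrow> increment \<xi> k n \<in> wball n"
proof (induction n)
  case (Suc n)
  then show ?case using wball_mult[of "increment \<xi> k n" n "\<xi> (k + int n)" 1] S_wball \<xi>_in by simp
qed simp

lemma pos_increment: "\<xi> \<in> space \<Xi> \<Longrightarrow> pos \<xi> (k + int n) = pos \<xi> k \<otimes> increment \<xi> k n"
proof (induction n)
  case (Suc n)
  have "pos \<xi> (k + int (Suc n)) = pos \<xi> (k + int n + 1)" by (simp add: algebra_simps)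
  also have "\<dots> = pos \<xi> k \<otimes> increment \<xi> k n \<otimes> \<xi> (k + int n)" using Suc by (simp add: pos_step)
  finally show ?case using Suc.prems increment_in \<xi>_in by (simp add: m_assoc)
qed simp

lemma depends_increment: "depends_on \<Xi> {k..<k + int n} (\<lambda>\<xi>. increment \<xi> k n)"
proof (induction n)
  case (Suc n)
  have "depends_on \<Xi> {k..<k + int (Suc n)} (\<lambda>\<xi>. increment \<xi> k n \<otimes> \<xi> (k + int n))"
    by (rule depends_on_compose2[OF depends_on_mono[OF Suc]]) (auto simp: depends_on_def)
  then show ?case by simp
qed (simp add: depends_on_def)

lemma increment_measurable: "(\<lambda>\<xi>. increment \<xi> k n) \<in> measurable \<Xi> (count_space UNIV)"
  by (rule \<Xi>_finite_measurable[OF _ depends_increment]) simp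

lemma \<Xi>_pred: "f \<in> measurable \<Xi> (count_space UNIV) \<Longrightarrow> Measurable.pred \<Xi> (\<lambda>\<xi>. Q (f \<xi>))"
  by (erule measurable_compose) simp

abbreviation walk_prob :: "((int \<Rightarrow> 'a) \<Rightarrow> bool) \<Rightarrow> real" where
  "walk_prob Q \<equiv> measure \<Xi> {\<xi> \<in> space \<Xi>. Q \<xi>}"

lemma letter_prob: "s \<in> S \<Longrightarrow> walk_prob (\<lambda>\<xi>. \<xi> i = s) = 1 / card S"
proof -
  assume s: "s \<in> S"
  have "emeasure \<Xi> {\<xi> \<in> space \<Xi>. \<xi> i \<in> {s}} = emeasure (uniform_count_measure S) {s}"
    unfolding \<Xi>_def using s
    by (intro product_prob_space.emeasure_PiM_Collect_single product_prob_spaceI prob_space_letter)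
       (auto simp: sets_uniform_count_measure)
  then show ?thesis using s S_fin
    by (simp add: measure_def emeasure_uniform_count_measure)
qed

lemma \<Xi>_indep:
  assumes "J \<inter> K = {}" "Measurable.pred \<Xi> P" "depends_on \<Xi> J P" "Measurable.pred \<Xi> Q" "depends_on \<Xi> K Q"
  shows "walk_prob (\<lambda>\<xi>. P \<xi> \<and> Q \<xi>) = walk_prob P * walk_prob Q"
  using assms unfolding \<Xi>_def by (intro PiM_indep_events[where J=J and K=K] prob_space_letter predE) auto

text \<open>Identifies the law of the displacement over any \<open>n\<close> consecutive steps.\<close>

lemma increment_law: "x \<in> V \<Longrightarrow> walk_prob (\<lambda>\<xi>. increment \<xi> k n = x) = heat_kernel n x"
proof (induction n arbitrary: x)
  case 0
  interpret prob_space \<Xi> by (rule prob_space_\<Xi>)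
  show ?case by (auto simp: prob_space)
next
  case (Suc n)
  interpret prob_space \<Xi> by (rule prob_space_\<Xi>)
  have m1: "Measurable.pred \<Xi> (\<lambda>\<xi>. increment \<xi> k n = y)" for y by (rule \<Xi>_pred[OF increment_measurable])
  have d2: "depends_on \<Xi> {k + int n} (\<lambda>\<xi>. \<xi> (k + int n))" by (simp add: depends_on_def)
  have m2: "Measurable.pred \<Xi> (\<lambda>\<xi>. \<xi> (k + int n) = s)" for s by (rule \<Xi>_pred[OF \<Xi>_finite_measurable[OF _ d2]]) simp
  have eq: "{\<xi> \<in> space \<Xi>. increment \<xi> k (Suc n) = x} =
      (\<Union>s\<in>S. {\<xi> \<in> space \<Xi>. increment \<xi> k n = x \<otimes> inv s \<and> \<xi> (k + int n) = s})"
  proof (intro Set.set_eqI iffI)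
    fix \<xi> assume *: "\<xi> \<in> {\<xi> \<in> space \<Xi>. increment \<xi> k (Suc n) = x}"
    have "increment \<xi> k n \<in> V" "\<xi> (k + int n) \<in> S" using * increment_in \<xi>_in by auto
    moreover from this have "increment \<xi> k n = x \<otimes> inv (\<xi> (k + int n))" using * by (auto simp: m_assoc)
    ultimately show "\<xi> \<in> (\<Union>s\<in>S. {\<xi> \<in> space \<Xi>. increment \<xi> k n = x \<otimes> inv s \<and> \<xi> (k + int n) = s})" using * by auto
  next
    fix \<xi> assume "\<xi> \<in> (\<Union>s\<in>S. {\<xi> \<in> space \<Xi>. increment \<xi> k n = x \<otimes> inv s \<and> \<xi> (k + int n) = s})"
    then show "\<xi> \<in> {\<xi> \<in> space \<Xi>. increment \<xi> k (Suc n) = x}" using Suc.prems by (auto simp: m_assoc)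
  qed
  have "walk_prob (\<lambda>\<xi>. increment \<xi> k (Suc n) = x) = (\<Sum>s\<in>S. walk_prob (\<lambda>\<xi>. increment \<xi> k n = x \<otimes> inv s \<and> \<xi> (k + int n) = s))"
    unfolding eq using S_fin predE[OF pred_intros_logic(3)[OF m1 m2]]
    by (intro finite_measure_finite_Union) (auto simp: disjoint_family_on_def)
  also have "\<dots> = (\<Sum>s\<in>S. heat_kernel n (x \<otimes> inv s) * (1 / card S))"
  proof (rule sum.cong[OF refl])
    fix s assume s: "s \<in> S"
    have "walk_prob (\<lambda>\<xi>. increment \<xi> k n = x \<otimes> inv s \<and> \<xi> (k + int n) = s) =
        walk_prob (\<lambda>\<xi>. increment \<xi> k n = x \<otimes> inv s) * walk_prob (\<lambda>\<xi>. \<xi> (k + int n) = s)"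
      by (rule \<Xi>_indep[OF _ m1 depends_on_compose[OF depends_increment] m2 depends_on_compose[OF d2]]) auto
    also have "walk_prob (\<lambda>\<xi>. increment \<xi> k n = x \<otimes> inv s) = heat_kernel n (x \<otimes> inv s)" using Suc s by auto
    finally show "walk_prob (\<lambda>\<xi>. increment \<xi> k n = x \<otimes> inv s \<and> \<xi> (k + int n) = s) = heat_kernel n (x \<otimes> inv s) * (1 / card S)"
      using letter_prob[OF s] by simp
  qed
  also have "\<dots> = (\<Sum>s\<in>S. heat_kernel n (x \<otimes> s) * (1 / card S))"
    by (rule sum.reindex_bij_witness[of _ "\<lambda>s. inv s" "\<lambda>s. inv s"]) (auto simp: S_inv)
  finally show ?case by (simp add: sum_divide_distrib)
qed

lemma reindex_measurable: "(\<lambda>\<xi> n. \<xi> (f n)) \<in> measurable \<Xi> \<Xi>"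
proof -
  have "(\<lambda>\<xi>. \<lambda>n\<in>UNIV. \<xi> (f n)) \<in> measurable \<Xi> \<Xi>"
    unfolding \<Xi>_def by (intro measurable_restrict measurable_component_singleton) auto
  then show ?thesis by (simp only: restrict_UNIV)
qed

lemma distr_reindex: "inj f \<Longrightarrow> distr \<Xi> \<Xi> (\<lambda>\<xi> n. \<xi> (f n)) = \<Xi>"
  using distr_PiM_reindex[of UNIV "\<lambda>_. uniform_count_measure S" f UNIV]
  unfolding \<Xi>_def by (simp add: prob_space_letter restrict_UNIV)

lemma inj_shift: "inj (\<lambda>i. n + i :: int)"
  by (simp add: inj_def)

lemma shift_space: "\<xi> \<in> space \<Xi> \<Longrightarrow> shift n \<xi> \<in> space \<Xi>"
  by (simp add: space_\<Xi> shift_def)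

lemma integral_shift:
  fixes f :: "(int \<Rightarrow> 'a) \<Rightarrow> real"
  assumes "f \<in> borel_measurable \<Xi>" shows "(\<integral>\<xi>. f (shift n \<xi>) \<partial>\<Xi>) = (\<integral>\<xi>. f \<xi> \<partial>\<Xi>)"
proof -
  have "(\<integral>\<xi>. f \<xi> \<partial>distr \<Xi> \<Xi> (\<lambda>\<xi> i. \<xi> (n + i))) = (\<integral>\<xi>. f (\<lambda>i. \<xi> (n + i)) \<partial>\<Xi>)"
    by (rule integral_distr[OF reindex_measurable assms])
  then show ?thesis by (simp add: distr_reindex[OF inj_shift] shift_def)
qed

section \<open>Links between distant positions\<close>

definition joint :: "real \<Rightarrow> ((int \<Rightarrow> 'a) \<times> ('a set \<Rightarrow> bool)) measure" where
  "joint p = \<Xi> \<Otimes>\<^sub>M perc p"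

lemma prob_space_joint: "prob_space (joint p)"
proof -
  interpret pair_prob_space \<Xi> "perc p"
    by (simp add: pair_prob_space_def pair_sigma_finite_def prob_space_\<Xi> prob_space_perc prob_space_imp_sigma_finite)
  show ?thesis unfolding joint_def by (rule prob_space_axioms)
qed

lemma space_joint: "space (joint p) = space \<Xi> \<times> space (perc p)"
  by (simp add: joint_def space_pair_measure)

abbreviation joint_prob :: "real \<Rightarrow> ((int \<Rightarrow> 'a) \<Rightarrow> ('a set \<Rightarrow> bool) \<Rightarrow> bool) \<Rightarrow> real" where
  "joint_prob p Q \<equiv> measure (joint p) {x \<in> space (joint p). Q (fst x) (snd x)}"

text \<open>The type of vertices may be uncountable and then its discrete sigma-algebra does not behave well under products; measurability comes from the countable set
of values that the walk takes.\<close>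

lemma pred_joint:
  assumes X: "X \<in> measurable \<Xi> (count_space UNIV)" "\<And>\<xi>. \<xi> \<in> space \<Xi> \<Longrightarrow> X \<xi> \<in> C" "countable C"
    and Q: "\<And>c. c \<in> C \<Longrightarrow> Measurable.pred (perc p) (Q c)"
  shows "Measurable.pred (joint p) (\<lambda>x. Q (X (fst x)) (snd x))"
proof -
  have "Measurable.pred (joint p) (\<lambda>x. \<exists>c\<in>C. X (fst x) = c \<and> Q c (snd x))"
  proof (rule pred_countable_Bex[OF X(3)])
    fix c assume c: "c \<in> C"
    have "Measurable.pred (joint p) (\<lambda>x. X (fst x) = c)"
      unfolding joint_def by (rule measurable_compose[OF measurable_fst \<Xi>_pred[OF X(1)]])
    moreover have "Measurable.pred (joint p) (\<lambda>x. Q c (snd x))"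
      unfolding joint_def by (rule measurable_compose[OF measurable_snd Q[OF c]])
    ultimately show "Measurable.pred (joint p) (\<lambda>x. X (fst x) = c \<and> Q c (snd x))" by (rule pred_intros_logic)
  qed
  then show ?thesis
    by (rule measurable_cong[THEN iffD1, rotated]) (use X(2) in \<open>auto simp: space_joint\<close>)
qed

lemma joint_fubini:
  assumes Q: "Measurable.pred (joint p) (\<lambda>x. Q (fst x) (snd x))"
  shows "(\<lambda>\<xi>. perc_prob p (Q \<xi>)) \<in> borel_measurable \<Xi>" "joint_prob p Q = (\<integral>\<xi>. perc_prob p (Q \<xi>) \<partial>\<Xi>)"
    "\<And>\<xi>. \<xi> \<in> space \<Xi> \<Longrightarrow> Measurable.pred (perc p) (Q \<xi>)"
proof -
  interpret P: prob_space "perc p" by (rule prob_space_perc)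
  interpret X: prob_space \<Xi> by (rule prob_space_\<Xi>)
  interpret JP: prob_space "joint p" by (rule prob_space_joint)
  let ?A = "{x \<in> space (joint p). Q (fst x) (snd x)}"
  have A: "?A \<in> sets (\<Xi> \<Otimes>\<^sub>M perc p)" using predE[OF Q] by (simp add: joint_def)
  have sec: "Pair \<xi> -` ?A = {\<omega> \<in> space (perc p). Q \<xi> \<omega>}" if "\<xi> \<in> space \<Xi>" for \<xi>
    using that by (auto simp: space_joint)
  have "(\<lambda>\<xi>. emeasure (perc p) (Pair \<xi> -` ?A)) \<in> borel_measurable \<Xi>"
    by (rule P.measurable_emeasure_Pair[OF A])
  then have "(\<lambda>\<xi>. enn2real (emeasure (perc p) (Pair \<xi> -` ?A))) \<in> borel_measurable \<Xi>" by measurable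
  then show m: "(\<lambda>\<xi>. perc_prob p (Q \<xi>)) \<in> borel_measurable \<Xi>"
    by (rule measurable_cong[THEN iffD1, rotated]) (simp only: sec measure_def)
  have "emeasure (joint p) ?A = (\<integral>\<^sup>+\<xi>. emeasure (perc p) (Pair \<xi> -` ?A) \<partial>\<Xi>)"
    unfolding joint_def by (rule P.emeasure_pair_measure_alt[OF A[unfolded joint_def]])
  also have "\<dots> = (\<integral>\<^sup>+\<xi>. ennreal (perc_prob p (Q \<xi>)) \<partial>\<Xi>)"
    by (intro nn_integral_cong) (simp only: sec P.emeasure_eq_measure)
  also have "\<dots> = ennreal (\<integral>\<xi>. perc_prob p (Q \<xi>) \<partial>\<Xi>)"
    using m perc_prob_le_1 by (intro nn_integral_eq_integral X.integrable_const_bound[where B=1]) auto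
  finally show "joint_prob p Q = (\<integral>\<xi>. perc_prob p (Q \<xi>) \<partial>\<Xi>)"
    by (simp add: JP.emeasure_eq_measure integral_nonneg_AE)
  show "Measurable.pred (perc p) (Q \<xi>)" if "\<xi> \<in> space \<Xi>" for \<xi>
    using sets_Pair1[OF A, of \<xi>] unfolding sec[OF that] pred_def .
qed

lemma pos2_measurable: "(\<lambda>\<xi>. (pos \<xi> i, pos \<xi> j)) \<in> measurable \<Xi> (count_space UNIV)"
  by (rule \<Xi>_finite_measurable[of "{min 0 i..<max 0 i} \<union> {min 0 j..<max 0 j}"])
     (auto intro!: depends_on_compose2[where h=Pair] depends_on_mono[OF depends_pos])

lemma pred_link: "Measurable.pred (joint p) (\<lambda>x. conn (snd x) V (pos (fst x) i) (pos (fst x) j))"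
  using pred_joint[OF pos2_measurable, where C="V \<times> V" and Q="\<lambda>(x, y) \<omega>. conn \<omega> V x y"]
  by (simp add: case_prod_unfold countable_SIGMA pred_conn)

text \<open>Given the walk, the probability is \<open>\<tau>\<close> of the displacement. Summing over the displacement, the heat kernel is bounded
by its maximum and the sum of \<open>\<tau>\<close> by the susceptibility.\<close>

lemma link_probability:
  assumes b: "\<And>x. x \<in> V \<Longrightarrow> heat_kernel n x \<le> b" "0 \<le> b"
    and C: "\<And>x Y. x \<in> V \<Longrightarrow> finite Y \<Longrightarrow> Y \<subseteq> V \<Longrightarrow> (\<Sum>y\<in>Y. \<tau> p V x y) \<le> C"
  shows "joint_prob p (\<lambda>\<xi> \<omega>. conn \<omega> V (pos \<xi> k) (pos \<xi> (k + int n))) \<le> b * C"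
proof -
  interpret X: prob_space \<Xi> by (rule prob_space_\<Xi>)
  have m: "{\<xi> \<in> space \<Xi>. increment \<xi> k n = x} \<in> sets \<Xi>" for x
    by (rule predE[OF \<Xi>_pred[OF increment_measurable]])
  have "joint_prob p (\<lambda>\<xi> \<omega>. conn \<omega> V (pos \<xi> k) (pos \<xi> (k + int n))) = (\<integral>\<xi>. \<tau> p V (pos \<xi> k) (pos \<xi> (k + int n)) \<partial>\<Xi>)"
    by (rule joint_fubini[OF pred_link])
  also have "\<dots> = (\<integral>\<xi>. (\<Sum>x\<in>wball n. \<tau> p V \<one> x * indicator {\<xi> \<in> space \<Xi>. increment \<xi> k n = x} \<xi>) \<partial>\<Xi>)"
  proof (intro Bochner_Integration.integral_cong refl)
    fix \<xi> assume \<xi>: "\<xi> \<in> space \<Xi>"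
    have "\<tau> p V (pos \<xi> k) (pos \<xi> (k + int n)) = \<tau> p V (pos \<xi> k \<otimes> \<one>) (pos \<xi> k \<otimes> increment \<xi> k n)"
      using \<xi> by (simp add: pos_increment)
    also have "\<dots> = \<tau> p V \<one> (increment \<xi> k n)"
      using \<xi> increment_in by (intro \<tau>_translate_V) auto
    also have "\<dots> = (\<Sum>x\<in>wball n. if x = increment \<xi> k n then \<tau> p V \<one> x else 0)"
      using increment_wball[OF \<xi>] by (subst sum.delta) auto
    also have "\<dots> = (\<Sum>x\<in>wball n. \<tau> p V \<one> x * indicator {\<xi> \<in> space \<Xi>. increment \<xi> k n = x} \<xi>)"
      using \<xi> by (intro sum.cong refl) (auto simp: indicator_def)
    finally show "\<tau> p V (pos \<xi> k) (pos \<xi> (k + int n)) =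
      (\<Sum>x\<in>wball n. \<tau> p V \<one> x * indicator {\<xi> \<in> space \<Xi>. increment \<xi> k n = x} \<xi>)" .
  qed
  also have "\<dots> = (\<Sum>x\<in>wball n. (\<integral>\<xi>. \<tau> p V \<one> x * indicator {\<xi> \<in> space \<Xi>. increment \<xi> k n = x} \<xi> \<partial>\<Xi>))"
    using m by (intro Bochner_Integration.integral_sum integrable_mult_right integrable_real_indicator) (auto simp: X.emeasure_eq_measure)
  also have "\<dots> = (\<Sum>x\<in>wball n. \<tau> p V \<one> x * walk_prob (\<lambda>\<xi>. increment \<xi> k n = x))"
  proof (intro sum.cong refl)
    fix x
    have "{\<xi> \<in> space \<Xi>. increment \<xi> k n = x} \<inter> space \<Xi> = {\<xi> \<in> space \<Xi>. increment \<xi> k n = x}" by blast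
    then show "(\<integral>\<xi>. \<tau> p V \<one> x * indicator {\<xi> \<in> space \<Xi>. increment \<xi> k n = x} \<xi> \<partial>\<Xi>) = \<tau> p V \<one> x * walk_prob (\<lambda>\<xi>. increment \<xi> k n = x)"
      by (simp only: Bochner_Integration.integral_mult_right_zero Bochner_Integration.integral_indicator)
  qed
  also have "\<dots> \<le> (\<Sum>x\<in>wball n. \<tau> p V \<one> x * b)"
  proof (intro sum_mono mult_left_mono)
    fix x assume "x \<in> wball n"
    then have "x \<in> V" using wball_sub by blast
    then show "walk_prob (\<lambda>\<xi>. increment \<xi> k n = x) \<le> b" using b increment_law by simp
  qed simp
  also have "\<dots> = (\<Sum>x\<in>wball n. \<tau> p V \<one> x) * b" by (simp add: sum_distrib_right)
  also have "\<dots> \<le> C * b" using C[of \<one> "wball n"] b wball_sub by (intro mult_right_mono) auto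
  finally show ?thesis by (simp add: mult.commute)
qed

text \<open>A pair of times \<open>- i\<close> and \<open>j\<close> with \<open>i + j = l\<close> is linked with probability at most \<open>b l * C\<close>, and there
are \<open>l + 1\<close> such pairs. The union bound over \<open>l \<ge> K\<close> is below \<open>1\<close> for large \<open>K\<close>.\<close>

lemma no_far_links:
  assumes b: "\<And>n x. x \<in> V \<Longrightarrow> heat_kernel n x \<le> b n" "\<And>n. 0 \<le> b n" "summable (\<lambda>n. (real n + 1) * b n)"
    and C: "0 \<le> C" "\<And>x Y. x \<in> V \<Longrightarrow> finite Y \<Longrightarrow> Y \<subseteq> V \<Longrightarrow> (\<Sum>y\<in>Y. \<tau> p V x y) \<le> C"
  shows "\<exists>K::nat. 0 < joint_prob p (\<lambda>\<xi> \<omega>. \<forall>i j. K \<le> i \<longrightarrow> K \<le> j \<longrightarrow> \<not> conn \<omega> V (pos \<xi> (- int i)) (pos \<xi> (int j)))"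
proof -
  interpret JP: prob_space "joint p" by (rule prob_space_joint)
  let ?a = "\<lambda>n. (real n + 1) * b n * C"
  have sa: "summable ?a" using b(3) by (rule summable_mult2)
  obtain K where K: "norm (\<Sum>i. ?a (i + K)) < 1" using suminf_exist_split[OF zero_less_one sa] by blast
  define L where "L l = {x \<in> space (joint p). \<exists>i\<in>{..l}. conn (snd x) V (pos (fst x) (- int i)) (pos (fst x) (int (l - i)))}" for l
  have Lm: "Measurable.pred (joint p) (\<lambda>x. \<exists>i\<in>{..l}. conn (snd x) V (pos (fst x) (- int i)) (pos (fst x) (int (l - i))))" for l
    by (rule pred_countable_Bex[OF _ pred_link]) simp
  have Ls: "L l \<in> sets (joint p)" for l unfolding L_def by (rule predE[OF Lm])
  have Ll: "measure (joint p) (L l) \<le> ?a l" for l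
  proof -
    have "L l = (\<Union>i\<in>{..l}. {x \<in> space (joint p). conn (snd x) V (pos (fst x) (- int i)) (pos (fst x) (int (l - i)))})"
      unfolding L_def by blast
    then have "measure (joint p) (L l) \<le> (\<Sum>i\<in>{..l}. joint_prob p (\<lambda>\<xi> \<omega>. conn \<omega> V (pos \<xi> (- int i)) (pos \<xi> (int (l - i)))))"
      using predE[OF pred_link] by (simp only:) (intro JP.finite_measure_subadditive_finite, auto)
    also have "\<dots> \<le> (\<Sum>i\<in>{..l}. b l * C)"
    proof (rule sum_mono)
      fix i assume "i \<in> {..l}"
      then have "int (l - i) = - int i + int l" by simp
      then show "joint_prob p (\<lambda>\<xi> \<omega>. conn \<omega> V (pos \<xi> (- int i)) (pos \<xi> (int (l - i)))) \<le> b l * C"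
        using link_probability[OF b(1,2) C(2), where n=l and k="- int i"] by simp
    qed
    finally show ?thesis by (simp add: algebra_simps)
  qed
  have sumL: "summable (\<lambda>l. measure (joint p) (L (l + K)))"
    by (rule summable_comparison_test'[OF summable_ignore_initial_segment[OF sa, of K], of 0])
       (simp only: real_norm_def abs_of_nonneg[OF measure_nonneg] Ll)
  let ?Q = "\<lambda>x. \<exists>i\<in>{K..}. \<exists>j\<in>{K..}. conn (snd x) V (pos (fst x) (- int i)) (pos (fst x) (int j))"
  have Qm: "Measurable.pred (joint p) ?Q" by (intro pred_countable_Bex pred_link) auto
  have "{x \<in> space (joint p). ?Q x} \<subseteq> (\<Union>l. L (l + K))"
  proof
    fix x assume "x \<in> {x \<in> space (joint p). ?Q x}"
    then obtain i j where ij: "x \<in> space (joint p)" "K \<le> i" "K \<le> j" "conn (snd x) V (pos (fst x) (- int i)) (pos (fst x) (int j))"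
      by auto
    have "x \<in> L (i + j)" unfolding L_def using ij by (auto intro!: bexI[of _ i])
    moreover have "i + j = (i + j - K) + K" using ij by simp
    ultimately show "x \<in> (\<Union>l. L (l + K))" by (metis UN_I UNIV_I)
  qed
  then have "measure (joint p) {x \<in> space (joint p). ?Q x} \<le> measure (joint p) (\<Union>l. L (l + K))"
    using Ls by (intro JP.finite_measure_mono sets.countable_UN) auto
  also have "\<dots> \<le> (\<Sum>l. measure (joint p) (L (l + K)))"
    using Ls sumL by (intro JP.finite_measure_subadditive_countably) auto
  also have "\<dots> \<le> (\<Sum>l. ?a (l + K))"
    by (rule suminf_le[OF Ll sumL summable_ignore_initial_segment[OF sa]])
  also have "\<dots> < 1" using K by simp
  finally have lt: "measure (joint p) {x \<in> space (joint p). ?Q x} < 1" .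
  have "measure (joint p) {x \<in> space (joint p). \<not> ?Q x} = 1 - measure (joint p) {x \<in> space (joint p). ?Q x}"
    by (rule JP.prob_neg[OF predE[OF Qm]])
  then have "0 < measure (joint p) {x \<in> space (joint p). \<not> ?Q x}" using lt by simp
  moreover have "{x \<in> space (joint p). \<not> ?Q x} =
      {x \<in> space (joint p). \<forall>i j. K \<le> i \<longrightarrow> K \<le> j \<longrightarrow> \<not> conn (snd x) V (pos (fst x) (- int i)) (pos (fst x) (int j))}"
    by blast
  ultimately show ?thesis by (intro exI[of _ K]) (simp only:)
qed

end

section \<open>Cut times have positive probability\<close>

context cayley
begin

lemma conn_isolated: "conn \<omega> A x y \<Longrightarrow> (\<And>e. e \<in> E \<Longrightarrow> y \<in> e \<Longrightarrow> \<not> \<omega> e) \<Longrightarrow> x = y"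
  by (cases rule: conn.cases) blast+

text \<open>Closing the edges of \<open>F\<close> by hand turns a configuration in \<open>Q\<close> into another one in \<open>Q\<close>, and the modified
configuration is independent of the actual state of the edges of \<open>F\<close>.\<close>

lemma close_edges:
  assumes F: "finite F" "F \<subseteq> E" and p: "0 \<le> p" "p < 1" and Q: "Measurable.pred (perc p) Q"
    and decr: "\<And>\<omega> \<omega>'. Q \<omega> \<Longrightarrow> (\<And>e. e \<in> E \<Longrightarrow> \<omega>' e \<Longrightarrow> \<omega> e) \<Longrightarrow> Q \<omega>'" and pos: "0 < perc_prob p Q"
  shows "0 < perc_prob p (\<lambda>\<omega>. (\<forall>e\<in>F. \<not> \<omega> e) \<and> Q \<omega>)"
proof -
  define cl where "cl \<omega> = (\<lambda>e\<in>E. \<omega> e \<and> e \<notin> F)" for \<omega> :: "'a set \<Rightarrow> bool"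
  have cl_m: "cl \<in> measurable (perc p) (perc p)"
  proof -
    have "(\<lambda>\<omega>. \<omega> e \<and> e \<notin> F) \<in> measurable (perc p) (measure_pmf (bernoulli_pmf p))" if "e \<in> E" for e
    proof -
      have "Measurable.pred (perc p) (\<lambda>\<omega>. \<omega> e \<and> e \<notin> F)"
        using that by (intro pred_finite[of "{e}"]) (auto simp: depends_on_def)
      then show ?thesis by simp
    qed
    then have "(\<lambda>\<omega>. \<lambda>e\<in>E. \<omega> e \<and> e \<notin> F) \<in> measurable (perc p) (perc p)"
      unfolding percolation_def by (rule measurable_restrict)
    then show ?thesis unfolding cl_def[abs_def] .
  qed
  have closed_m: "Measurable.pred (perc p) (\<lambda>\<omega>. \<forall>e\<in>F. \<not> \<omega> e)" "depends_on (perc p) F (\<lambda>\<omega>. \<forall>e\<in>F. \<not> \<omega> e)"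
    using F by (auto intro!: pred_finite[of F] simp: depends_on_def)
  have Qcl: "Measurable.pred (perc p) (\<lambda>\<omega>. Q (cl \<omega>))" by (rule measurable_compose[OF cl_m Q])
  have "depends_on (perc p) (E - F) cl"
    by (rule depends_onI) (auto simp: cl_def restrict_def fun_eq_iff)
  then have Qcl_dep: "depends_on (perc p) (E - F) (\<lambda>\<omega>. Q (cl \<omega>))" by (rule depends_on_compose)
  have "emeasure (perc p) {\<omega> \<in> space (perc p). \<forall>e\<in>F. \<omega> e \<in> {False}} = (\<Prod>e\<in>F. emeasure (measure_pmf (bernoulli_pmf p)) {False})"
    unfolding percolation_def using F
    by (intro product_prob_space.emeasure_PiM_Collect product_prob_spaceI measure_pmf.prob_space_axioms) auto
  also have "\<dots> = ennreal ((1 - p) ^ card F)"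
    using p by (simp add: emeasure_pmf_single ennreal_power)
  finally have "perc_prob p (\<lambda>\<omega>. \<forall>e\<in>F. \<not> \<omega> e) = (1 - p) ^ card F"
    using p by (simp add: measure_def)
  then have c0: "0 < perc_prob p (\<lambda>\<omega>. \<forall>e\<in>F. \<not> \<omega> e)" using p by simp
  have "perc_prob p Q \<le> perc_prob p (\<lambda>\<omega>. Q (cl \<omega>))"
  proof (rule perc_prob_mono[OF Qcl])
    fix \<omega> assume "Q \<omega>"
    then show "Q (cl \<omega>)" by (rule decr) (simp add: cl_def)
  qed
  then have "0 < perc_prob p (\<lambda>\<omega>. Q (cl \<omega>))" using pos by linarith
  then have "0 < perc_prob p (\<lambda>\<omega>. \<forall>e\<in>F. \<not> \<omega> e) * perc_prob p (\<lambda>\<omega>. Q (cl \<omega>))" using c0 by simp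
  also have "\<dots> = perc_prob p (\<lambda>\<omega>. (\<forall>e\<in>F. \<not> \<omega> e) \<and> Q (cl \<omega>))"
    by (rule perc_prob_indep[OF F(2) _ _ closed_m Qcl Qcl_dep, symmetric]) auto
  also have "\<dots> = perc_prob p (\<lambda>\<omega>. (\<forall>e\<in>F. \<not> \<omega> e) \<and> Q \<omega>)"
  proof (rule perc_prob_cong)
    fix \<omega> assume \<omega>: "\<omega> \<in> space (perc p)"
    have "cl \<omega> = \<omega>" if "\<forall>e\<in>F. \<not> \<omega> e"
    proof
      show "cl \<omega> e = \<omega> e" for e
        using that \<omega> unfolding space_perc cl_def restrict_def extensional_def by (cases "e \<in> E") auto
    qed
    then show "((\<forall>e\<in>F. \<not> \<omega> e) \<and> Q (cl \<omega>)) = ((\<forall>e\<in>F. \<not> \<omega> e) \<and> Q \<omega>)" by metis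
  qed
  finally show ?thesis .
qed

text \<open>The event that \<open>0\<close> is a cut time of \<open>s\<close>; for other times, \<open>s\<close> is shifted. It is an event for
arbitrary trajectories and invariant under joint translation.\<close>

definition cut_time :: "(int \<Rightarrow> 'a) \<Rightarrow> ('a set \<Rightarrow> bool) \<Rightarrow> bool" where
  "cut_time s \<omega> \<longleftrightarrow> (\<forall>a b :: nat. \<not> conn \<omega> V (s (- int a)) (s (1 + int b)))"

lemma pred_cut_time: "Measurable.pred (perc p) (cut_time s)"
  unfolding cut_time_def[abs_def] by (intro pred_intros_countable pred_intros_logic pred_conn) auto

lemma cut_time_translate:
  assumes "g \<in> V" "\<And>k. s k \<in> V"
  shows "perc_prob p (cut_time (\<lambda>k. g \<otimes> s k)) = perc_prob p (cut_time s)"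
proof -
  have "cut_time (\<lambda>k. g \<otimes> s k) \<omega> \<longleftrightarrow> cut_time s (translate g \<omega>)" for \<omega>
    unfolding cut_time_def using assms by (simp only: conn_translate[OF subset_refl] translate_V)
  then have "perc_prob p (cut_time (\<lambda>k. g \<otimes> s k)) = perc_prob p (\<lambda>\<omega>. cut_time s (translate g \<omega>))" by (intro perc_prob_cong) blast
  also have "\<dots> = perc_prob p (cut_time s)" by (rule perc_prob_translate[OF assms(1) pred_cut_time])
  finally show ?thesis .
qed

text \<open>Indices of the increments of the spliced walk: those before time \<open>- i\<close>, then \<open>l\<close> of them from time \<open>a\<close>
on, then those from time \<open>j\<close> on.\<close>

definition splice :: "int \<Rightarrow> int \<Rightarrow> int \<Rightarrow> int \<Rightarrow> int \<Rightarrow> int" where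
  "splice i a l j n = (if n < 0 then n - i else if n < l then a + n else j + n - l)"

text \<open>The three blocks are disjoint. This is why the spliced walk has the same law as the original.\<close>

lemma inj_splice: "- i \<le> a \<Longrightarrow> a + l \<le> j \<Longrightarrow> 0 \<le> l \<Longrightarrow> inj (splice i a l j)"
  by (rule injI) (auto simp: splice_def split: if_splits)

text \<open>Let \<open>b\<close> be the first time in the middle part at a vertex of the far future, and \<open>a\<close> the last time before \<open>b\<close> at
a vertex of the far past. Between \<open>a\<close> and \<open>b\<close> the middle part visits neither, and all its vertices
are isolated, so links could only occur between far past and far future.\<close>

lemma splice_cut:
  fixes K :: nat
  assumes closed: "\<And>e. e \<in> E \<Longrightarrow> e \<inter> s ` {- int K..int K} \<noteq> {} \<Longrightarrow> \<not> \<omega> e"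
    and unlinked: "\<And>i j. K \<le> i \<Longrightarrow> K \<le> j \<Longrightarrow> \<not> conn \<omega> V (s (- int i)) (s (int j))"
    and s: "\<And>k. s k \<in> V"
  shows "\<exists>i a l j. - i \<le> a \<and> a + l \<le> j \<and> 1 \<le> l \<and> s (- i) = s a \<and> s (a + l) = s j \<and>
    cut_time (\<lambda>k. if k \<le> 0 then s (k - i) else if k \<le> l then s (a + k) else s (j + k - l)) \<omega>"
proof -
  define T1 where "T1 k \<longleftrightarrow> (\<exists>j\<ge>K. s k = s (int j))" for k
  define T2 where "T2 k \<longleftrightarrow> (\<exists>i\<ge>K. s k = s (- int i))" for k
  have disj: "\<not> (T1 k \<and> T2 k)" for k
    using unlinked conn_refl[of "s k" V \<omega>] s unfolding T1_def T2_def by metis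
  have T2_0: "T2 (int 0 - int K)" unfolding T2_def by (intro exI[of _ K]) simp
  have T1_K: "T1 (int (2 * K) - int K)" unfolding T1_def by (intro exI[of _ K]) simp
  \<comment> \<open>Times of the middle part are counted from \<open>- K\<close>, so that \<open>LEAST\<close> and \<open>Max\<close> apply to natural numbers.\<close>
  define b where "b = (LEAST n. T1 (int n - int K))"
  have b: "T1 (int b - int K)" "b \<le> 2 * K" "\<And>n. n < b \<Longrightarrow> \<not> T1 (int n - int K)"
    unfolding b_def
    using LeastI[of "\<lambda>n. T1 (int n - int K)", OF T1_K] Least_le[of "\<lambda>n. T1 (int n - int K)", OF T1_K]
      not_less_Least[of _ "\<lambda>n. T1 (int n - int K)"] by blast+
  have b0: "0 < b" using b(1) T2_0 disj by (cases "b = 0") auto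
  define A where "A = {n. n < b \<and> T2 (int n - int K)}"
  have A: "finite A" "0 \<in> A" using b0 T2_0 by (auto simp: A_def)
  define a where "a = Max A"
  have "a \<in> A" unfolding a_def using A by (intro Max_in) auto
  then have a: "a < b" "T2 (int a - int K)" by (auto simp: A_def)
  have between: "\<not> T2 (int n - int K)" if "a < n" "n < b" for n
  proof
    assume "T2 (int n - int K)"
    then have "n \<in> A" using that by (simp add: A_def)
    then have "n \<le> a" unfolding a_def using A by simp
    then show False using that by simp
  qed
  obtain i where i: "K \<le> i" "s (int a - int K) = s (- int i)" using a(2) by (auto simp: T2_def)
  obtain j where j: "K \<le> j" "s (int b - int K) = s (int j)" using b(1) by (auto simp: T1_def)
  define l where "l = int b - int a"
  let ?a = "int a - int K"
  let ?s = "\<lambda>k. if k \<le> 0 then s (k - int i) else if k \<le> l then s (?a + k) else s (int j + k - l)"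
  have "\<not> conn \<omega> V (?s (- int m)) (?s (1 + int n))" for m n
  proof
    assume c: "conn \<omega> V (?s (- int m)) (?s (1 + int n))"
    have x: "?s (- int m) = s (- int (m + i))" by simp
    consider "1 + int n < l" | "1 + int n = l" | "l < 1 + int n" by linarith
    then show False
    proof cases
      case 1
      define t where "t = a + 1 + n"
      have t: "a < t" "t < b" "?s (1 + int n) = s (int t - int K)"
        using 1 by (auto simp: t_def l_def algebra_simps)
      have "int t - int K \<in> {- int K..int K}" using t b(2) by auto
      then have "\<not> \<omega> e" if "e \<in> E" "s (int t - int K) \<in> e" for e
        using closed[OF that(1)] that(2) by blast
      then have "s (- int (m + i)) = s (int t - int K)"
        using conn_isolated[OF c] unfolding x t(3) by blast
      then have "T2 (int t - int K)" unfolding T2_def using i(1) by (intro exI[of _ "m + i"]) simp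
      then show False using between t by blast
    next
      case 2
      then have "?s (1 + int n) = s (int b - int K)" by (simp add: l_def)
      then have "conn \<omega> V (s (- int (m + i))) (s (int j))" using c x j(2) by simp
      then show False using unlinked[of "m + i" j] i j by simp
    next
      case 3
      define t where "t = nat (int j + (1 + int n) - l)"
      have t: "int t = int j + (1 + int n) - l" "K \<le> t" using 3 j(1) by (auto simp: t_def)
      have "?s (1 + int n) = s (int t)" using 3 t(1) by simp
      then have "conn \<omega> V (s (- int (m + i))) (s (int t))" using c x by simp
      then show False using unlinked[of "m + i" t] i t by simp
    qed
  qed
  then have "cut_time ?s \<omega>" unfolding cut_time_def by blast
  then show ?thesis
    using i j a b(2)
    by (intro exI[of _ "int i"] exI[of _ ?a] exI[of _ l] exI[of _ "int j"]) (simp add: l_def)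
qed

end

context cayley_walk
begin

lemma pred_cut_time_joint: "Measurable.pred (joint p) (\<lambda>x. cut_time (\<lambda>k. pos (fst x) (n + k)) (snd x))"
  unfolding cut_time_def by (intro pred_intros_countable pred_intros_logic pred_link)

text \<open>If \<open>0\<close> were almost surely not a cut time, the same would hold for all spliced walks, as there are
countably many splicings and each preserves the law. But for a walk whose far past and far future are unlinked with positive
probability, closing the finitely many edges around the middle part makes \<open>0\<close> a cut time of one of them.\<close>

lemma cut_positive_probability:
  fixes K :: nat
  assumes p: "0 \<le> p" "p < 1"
    and far: "0 < joint_prob p (\<lambda>\<xi> \<omega>. \<forall>i j. K \<le> i \<longrightarrow> K \<le> j \<longrightarrow> \<not> conn \<omega> V (pos \<xi> (- int i)) (pos \<xi> (int j)))"
  shows "0 < joint_prob p (\<lambda>\<xi> \<omega>. cut_time (pos \<xi>) \<omega>)"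
proof (rule ccontr)
  assume "\<not> 0 < joint_prob p (\<lambda>\<xi> \<omega>. cut_time (pos \<xi>) \<omega>)"
  then have zero: "joint_prob p (\<lambda>\<xi> \<omega>. cut_time (pos \<xi>) \<omega>) = 0" using measure_nonneg[of "joint p"] by (meson less_le not_less order_antisym)
  interpret X: prob_space \<Xi> by (rule prob_space_\<Xi>)
  interpret P: prob_space "perc p" by (rule prob_space_perc)
  have cutJ: "Measurable.pred (joint p) (\<lambda>x. cut_time (pos (fst x)) (snd x))" using pred_cut_time_joint[where p=p and n=0] by simp
  define h where "h \<xi> = perc_prob p (cut_time (pos \<xi>))" for \<xi>
  have hm: "h \<in> borel_measurable \<Xi>" unfolding h_def[abs_def] by (rule joint_fubini(1)[OF cutJ])
  have "(\<integral>\<xi>. h \<xi> \<partial>\<Xi>) = 0" unfolding h_def using joint_fubini(2)[OF cutJ] zero by simp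
  moreover have "integrable \<Xi> h"
    using hm perc_prob_le_1 by (intro X.integrable_const_bound[where B=1]) (auto simp: h_def)
  ultimately have h0: "AE \<xi> in \<Xi>. h \<xi> = 0"
    by (subst (asm) integral_nonneg_eq_0_iff_AE) (auto simp: h_def)
  have "AE \<xi> in \<Xi>. \<forall>i a l j. - i \<le> a \<and> a + l \<le> j \<and> 1 \<le> l \<longrightarrow> h (\<lambda>n. \<xi> (splice i a l j n)) = 0"
  proof (intro AE_all_countable[THEN iffD2] allI)
    fix i a l j :: int
    show "AE \<xi> in \<Xi>. - i \<le> a \<and> a + l \<le> j \<and> 1 \<le> l \<longrightarrow> h (\<lambda>n. \<xi> (splice i a l j n)) = 0"
    proof (cases "- i \<le> a \<and> a + l \<le> j \<and> 1 \<le> l")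
      case True
      then have "inj (splice i a l j)" by (intro inj_splice) auto
      then have "AE \<xi> in distr \<Xi> \<Xi> (\<lambda>\<xi> n. \<xi> (splice i a l j n)). h \<xi> = 0"
        using h0 by (simp only: distr_reindex)
      from AE_distrD[OF reindex_measurable this] show ?thesis by simp
    next
      case False
      then show ?thesis by (intro AE_I2) blast
    qed
  qed
  moreover have "\<not> (AE \<xi> in \<Xi>. perc_prob p (\<lambda>\<omega>. \<forall>i j. K \<le> i \<longrightarrow> K \<le> j \<longrightarrow> \<not> conn \<omega> V (pos \<xi> (- int i)) (pos \<xi> (int j))) = 0)"
  proof
    assume *: "AE \<xi> in \<Xi>. perc_prob p (\<lambda>\<omega>. \<forall>i j. K \<le> i \<longrightarrow> K \<le> j \<longrightarrow> \<not> conn \<omega> V (pos \<xi> (- int i)) (pos \<xi> (int j))) = 0"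
    have m: "Measurable.pred (joint p) (\<lambda>x. \<forall>i j. K \<le> i \<longrightarrow> K \<le> j \<longrightarrow> \<not> conn (snd x) V (pos (fst x) (- int i)) (pos (fst x) (int j)))"
      by (intro pred_intros_countable pred_intros_logic pred_link) auto
    have "joint_prob p (\<lambda>\<xi> \<omega>. \<forall>i j. K \<le> i \<longrightarrow> K \<le> j \<longrightarrow> \<not> conn \<omega> V (pos \<xi> (- int i)) (pos \<xi> (int j))) = 0"
      unfolding joint_fubini(2)[OF m] by (rule integral_eq_zero_AE[OF *])
    then show False using far by simp
  qed
  ultimately have "\<exists>\<xi>\<in>space \<Xi>. (\<forall>i a l j. - i \<le> a \<and> a + l \<le> j \<and> 1 \<le> l \<longrightarrow> h (\<lambda>n. \<xi> (splice i a l j n)) = 0) \<and>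
     perc_prob p (\<lambda>\<omega>. \<forall>i j. K \<le> i \<longrightarrow> K \<le> j \<longrightarrow> \<not> conn \<omega> V (pos \<xi> (- int i)) (pos \<xi> (int j))) \<noteq> 0"
    (is "\<exists>\<xi>\<in>_. ?good \<xi> \<and> ?U \<xi> \<noteq> 0")
  proof -
    assume g: "AE \<xi> in \<Xi>. ?good \<xi>" and n: "\<not> (AE \<xi> in \<Xi>. ?U \<xi> = 0)"
    show ?thesis
    proof (rule ccontr)
      assume c: "\<not> ?thesis"
      have "AE \<xi> in \<Xi>. ?U \<xi> = 0"
        using g AE_space by eventually_elim (use c in blast)
      then show False using n by blast
    qed
  qed
  then obtain \<xi> where \<xi>: "\<xi> \<in> space \<Xi>" and good: "\<And>i a l j. - i \<le> a \<and> a + l \<le> j \<and> 1 \<le> l \<Longrightarrow> h (\<lambda>n. \<xi> (splice i a l j n)) = 0"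
    and U: "?U \<xi> \<noteq> 0" by blast
  define s where "s = pos \<xi>"
  have sV: "s k \<in> V" for k using \<xi> by (simp add: s_def)
  have s_step: "s (k + 1) = s k \<otimes> \<xi> k" for k using \<xi> by (simp add: s_def pos_step)
  define F where "F = {e \<in> E. e \<inter> s ` {- int K..int K} \<noteq> {}}"
  have F: "finite F" "F \<subseteq> E" unfolding F_def by (auto intro: finite_touching)
  define Uw where "Uw \<omega> \<longleftrightarrow> (\<forall>i j. K \<le> i \<longrightarrow> K \<le> j \<longrightarrow> \<not> conn \<omega> V (s (- int i)) (s (int j)))" for \<omega>
  have Um: "Measurable.pred (perc p) Uw"
    unfolding Uw_def[abs_def] by (intro pred_intros_countable pred_intros_logic pred_conn) auto
  have "0 < perc_prob p Uw" using U measure_nonneg[of "perc p"] unfolding Uw_def[abs_def] s_def by (simp add: less_le)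
  moreover have "Uw \<omega>'" if "Uw \<omega>" "\<And>e. e \<in> E \<Longrightarrow> \<omega>' e \<Longrightarrow> \<omega> e" for \<omega> \<omega>'
    using that conn_mono_open[of \<omega>' V _ _ \<omega>] unfolding Uw_def by blast
  ultimately have pos: "0 < perc_prob p (\<lambda>\<omega>. (\<forall>e\<in>F. \<not> \<omega> e) \<and> Uw \<omega>)"
    by (intro close_edges[OF F p Um]) auto
  define path where "path i a l j = (\<lambda>k. if k \<le> 0 then s (k - i) else if k \<le> l then s (a + k) else s (j + k - l))" for i a l j
  have path0: "perc_prob p (cut_time (path i a l j)) = 0"
    if c: "- i \<le> a" "a + l \<le> j" "1 \<le> l" and e: "s (- i) = s a" "s (a + l) = s j" for i a l j
  proof -
    let ?\<xi> = "\<lambda>n. \<xi> (splice i a l j n)"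
    have \<xi>': "?\<xi> \<in> space \<Xi>" using \<xi> by (simp add: space_\<Xi>)
    have "has_increments (path i a l j) ?\<xi>"
      unfolding has_increments_def
    proof (intro allI conjI)
      fix k :: int
      show "path i a l j k \<in> V" using sV by (simp add: path_def)
      consider "k < 0" | "k = 0" | "0 < k" "k < l" | "k = l" | "l < k" using c by linarith
      then show "path i a l j (k + 1) = path i a l j k \<otimes> ?\<xi> k"
      proof cases
        case 1 then show ?thesis using s_step[of "k - i"] by (simp add: path_def splice_def algebra_simps)
      next
        case 2 then show ?thesis using s_step[of a] c e by (simp add: path_def splice_def)
      next
        case 3 then show ?thesis using s_step[of "a + k"] by (simp add: path_def splice_def algebra_simps)
      next
        case 4 then show ?thesis using s_step[of j] c e by (simp add: path_def splice_def)
      next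
        case 5 then show ?thesis using s_step[of "j + k - l"] c by (simp add: path_def splice_def algebra_simps)
      qed
    qed
    then have "path i a l j k = (path i a l j 0 \<otimes> inv v) \<otimes> pos ?\<xi> k" for k
      by (rule has_increments_unique[OF _ \<xi>'])
    then have "path i a l j = (\<lambda>k. (path i a l j 0 \<otimes> inv v) \<otimes> pos ?\<xi> k)" by blast
    then have "perc_prob p (cut_time (path i a l j)) = perc_prob p (cut_time (\<lambda>k. (path i a l j 0 \<otimes> inv v) \<otimes> pos ?\<xi> k))" by metis
    also have "\<dots> = perc_prob p (cut_time (pos ?\<xi>))"
      using sV v \<xi>' by (intro cut_time_translate) (auto simp: path_def)
    also have "\<dots> = 0" using good[of i a l j] c by (simp add: h_def)
    finally show ?thesis .
  qed
  have "AE \<omega> in perc p. \<forall>i a l j. - i \<le> a \<and> a + l \<le> j \<and> 1 \<le> l \<and> s (- i) = s a \<and> s (a + l) = s j \<longrightarrow> \<not> cut_time (path i a l j) \<omega>"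
  proof (intro AE_all_countable[THEN iffD2] allI)
    fix i a l j :: int
    show "AE \<omega> in perc p. - i \<le> a \<and> a + l \<le> j \<and> 1 \<le> l \<and> s (- i) = s a \<and> s (a + l) = s j \<longrightarrow> \<not> cut_time (path i a l j) \<omega>"
    proof (cases "- i \<le> a \<and> a + l \<le> j \<and> 1 \<le> l \<and> s (- i) = s a \<and> s (a + l) = s j")
      case True
      then have "AE \<omega> in perc p. \<omega> \<notin> {\<omega> \<in> space (perc p). cut_time (path i a l j) \<omega>}"
        using path0 by (subst P.prob_eq_0[symmetric]) (auto intro: predE pred_cut_time)
      then show ?thesis using AE_space by eventually_elim auto
    next
      case False
      then show ?thesis by (intro AE_I2) blast
    qed
  qed
  then have "AE \<omega> in perc p. \<omega> \<notin> {\<omega> \<in> space (perc p). (\<forall>e\<in>F. \<not> \<omega> e) \<and> Uw \<omega>}"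
  proof eventually_elim
    case (elim \<omega>)
    show ?case
    proof
      assume "\<omega> \<in> {\<omega> \<in> space (perc p). (\<forall>e\<in>F. \<not> \<omega> e) \<and> Uw \<omega>}"
      then have c: "\<forall>e\<in>F. \<not> \<omega> e" and u: "Uw \<omega>" by auto
      have "\<exists>i a l j. - i \<le> a \<and> a + l \<le> j \<and> 1 \<le> l \<and> s (- i) = s a \<and> s (a + l) = s j \<and> cut_time (path i a l j) \<omega>"
        unfolding path_def
      proof (rule splice_cut[where K=K])
        show "\<not> \<omega> e" if "e \<in> E" "e \<inter> s ` {- int K..int K} \<noteq> {}" for e using c that by (simp add: F_def)
        show "\<not> conn \<omega> V (s (- int i)) (s (int j))" if "K \<le> i" "K \<le> j" for i j using u that by (simp add: Uw_def)
      qed (rule sV)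
      then show False using elim by blast
    qed
  qed
  moreover have "{\<omega> \<in> space (perc p). (\<forall>e\<in>F. \<not> \<omega> e) \<and> Uw \<omega>} \<in> sets (perc p)"
    using F by (intro predE pred_intros_logic Um pred_finite[of F]) (auto simp: depends_on_def)
  ultimately have "perc_prob p (\<lambda>\<omega>. (\<forall>e\<in>F. \<not> \<omega> e) \<and> Uw \<omega>) = 0" by (subst P.prob_eq_0)
  then show False using pos by simp
qed

end

section \<open>Infinitely many cut times\<close>

context cayley
begin

text \<open>The event that \<open>0\<close> appears to be a cut time when looking only at times within \<open>R\<close> and at edges within
distance \<open>R\<close> of the current position. Being implied by \<open>cut_time\<close>, it serves as an upper bound.\<close>

definition local_cut_time :: "nat \<Rightarrow> (int \<Rightarrow> 'a) \<Rightarrow> ('a set \<Rightarrow> bool) \<Rightarrow> bool" where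
  "local_cut_time R s \<omega> \<longleftrightarrow> (\<forall>a\<in>{..R}. \<forall>b\<in>{..R}.
     \<not> conn \<omega> ((\<lambda>x. s 0 \<otimes> x) ` wball R) (s (- int a)) (s (1 + int b)))"

lemma ball_sub: "x \<in> V \<Longrightarrow> (\<lambda>y. x \<otimes> y) ` wball R \<subseteq> V"
  using wball_sub by blast

lemma depends_local_cut_time: "depends_on (perc p) {e \<in> E. e \<subseteq> (\<lambda>x. s 0 \<otimes> x) ` wball R} (local_cut_time R s)"
proof (rule depends_onI)
  fix \<omega> \<omega>' :: "'a set \<Rightarrow> bool"
  assume "\<And>e. e \<in> {e \<in> E. e \<subseteq> (\<lambda>x. s 0 \<otimes> x) ` wball R} \<Longrightarrow> \<omega> e = \<omega>' e"
  then have "conn \<omega> ((\<lambda>x. s 0 \<otimes> x) ` wball R) x y = conn \<omega>' ((\<lambda>x. s 0 \<otimes> x) ` wball R) x y" for x y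
    by (intro conn_cong) blast
  then show "local_cut_time R s \<omega> = local_cut_time R s \<omega>'" by (simp only: local_cut_time_def)
qed

lemma pred_local_cut_time: "Measurable.pred (perc p) (local_cut_time R s)"
  by (rule pred_finite[OF _ _ depends_local_cut_time]) (auto intro!: finite_inside finite_imageI)

lemma local_cut_time_translate:
  assumes g: "g \<in> V" and s: "\<And>k. s k \<in> V"
  shows "perc_prob p (local_cut_time R (\<lambda>k. g \<otimes> s k)) = perc_prob p (local_cut_time R s)"
proof -
  have "(\<lambda>x. g \<otimes> s 0 \<otimes> x) ` wball R = (\<lambda>x. g \<otimes> x) ` (\<lambda>x. s 0 \<otimes> x) ` wball R"
  proof -
    have "(\<lambda>x. g \<otimes> s 0 \<otimes> x) ` wball R = (\<lambda>x. g \<otimes> (s 0 \<otimes> x)) ` wball R"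
      using g s wball_sub[of R] by (intro image_cong refl m_assoc) blast+
    then show ?thesis by (simp add: image_image)
  qed
  then have "local_cut_time R (\<lambda>k. g \<otimes> s k) \<omega> \<longleftrightarrow> local_cut_time R s (translate g \<omega>)" for \<omega>
    unfolding local_cut_time_def using g s by (simp only: conn_translate[OF ball_sub])
  then have "perc_prob p (local_cut_time R (\<lambda>k. g \<otimes> s k)) = perc_prob p (\<lambda>\<omega>. local_cut_time R s (translate g \<omega>))" by (intro perc_prob_cong) blast
  also have "\<dots> = perc_prob p (local_cut_time R s)" by (rule perc_prob_translate[OF g pred_local_cut_time])
  finally show ?thesis .
qed

lemma local_cut_time_cong:
  assumes "\<And>k. - int R \<le> k \<Longrightarrow> k \<le> int R + 1 \<Longrightarrow> s k = s' k"
  shows "local_cut_time R s = local_cut_time R s'"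
proof -
  have "s 0 = s' 0" using assms by simp
  moreover have "s (- int a) = s' (- int a)" "s (1 + int a) = s' (1 + int a)" if "a \<in> {..R}" for a
    using that by (auto intro!: assms)
  ultimately show ?thesis unfolding local_cut_time_def fun_eq_iff by auto
qed

lemma cut_time_imp_local_cut_time: "s 0 \<in> V \<Longrightarrow> cut_time s \<omega> \<Longrightarrow> local_cut_time R s \<omega>"
  unfolding local_cut_time_def cut_time_def using conn_mono[OF _ ball_sub] by blast

lemma local_cut_time_antimono: "R \<le> R' \<Longrightarrow> local_cut_time R' s \<omega> \<Longrightarrow> local_cut_time R s \<omega>"
proof -
  assume R: "R \<le> R'"
  have sub: "(\<lambda>x. s 0 \<otimes> x) ` wball R \<subseteq> (\<lambda>x. s 0 \<otimes> x) ` wball R'" using wball_mono[OF R] by blast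
  assume *: "local_cut_time R' s \<omega>"
  show "local_cut_time R s \<omega>"
    unfolding local_cut_time_def
  proof (intro ballI notI)
    fix a b assume "a \<in> {..R}" "b \<in> {..R}" "conn \<omega> ((\<lambda>x. s 0 \<otimes> x) ` wball R) (s (- int a)) (s (1 + int b))"
    then have "a \<in> {..R'}" "b \<in> {..R'}" "conn \<omega> ((\<lambda>x. s 0 \<otimes> x) ` wball R') (s (- int a)) (s (1 + int b))"
      using R conn_mono[OF _ sub] by simp_all
    then show False using * unfolding local_cut_time_def by blast
  qed
qed

text \<open>A link is witnessed by a finite path between two positions, hence seen in a large enough window.\<close>

lemma cut_time_iff_local_cut_time:
  assumes s: "s 0 \<in> V"
  shows "cut_time s \<omega> \<longleftrightarrow> (\<forall>R. local_cut_time R s \<omega>)"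
proof
  assume *: "\<forall>R. local_cut_time R s \<omega>"
  show "cut_time s \<omega>"
    unfolding cut_time_def
  proof (intro allI notI)
    fix a b assume "conn \<omega> V (s (- int a)) (s (1 + int b))"
    then obtain m where m: "conn \<omega> (V \<inter> wball m) (s (- int a)) (s (1 + int b))" using conn_exhaust by blast
    obtain n where n: "inv (s 0) \<in> wball n" using wball_exhaust s by blast
    define R where "R = a + b + (n + m)"
    have "V \<inter> wball m \<subseteq> (\<lambda>x. s 0 \<otimes> x) ` wball R"
    proof
      fix x assume x: "x \<in> V \<inter> wball m"
      then have "inv (s 0) \<otimes> x \<in> wball R"
        using wball_mult[OF n, of x m] wball_mono[of "n + m" R] by (auto simp: R_def)
      moreover have "x = s 0 \<otimes> (inv (s 0) \<otimes> x)" using x s by (simp add: mult_inv_cancel)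
      ultimately show "x \<in> (\<lambda>x. s 0 \<otimes> x) ` wball R" by blast
    qed
    then have "conn \<omega> ((\<lambda>x. s 0 \<otimes> x) ` wball R) (s (- int a)) (s (1 + int b))" by (rule conn_mono[OF m])
    moreover have "a \<in> {..R}" "b \<in> {..R}" by (auto simp: R_def)
    ultimately show False using * unfolding local_cut_time_def by blast
  qed
qed (use cut_time_imp_local_cut_time s in blast)

end

context cayley_walk
begin

lemma pred_local_cut_time_joint: "Measurable.pred (joint p) (\<lambda>x. local_cut_time R (\<lambda>k. pos (fst x) (n + k)) (snd x))"
proof -
  have m: "(\<lambda>\<xi>. (pos \<xi> i, pos \<xi> j, pos \<xi> k)) \<in> measurable \<Xi> (count_space UNIV)" for i j k
    by (rule \<Xi>_finite_measurable[of "{min 0 i..<max 0 i} \<union> ({min 0 j..<max 0 j} \<union> {min 0 k..<max 0 k})"])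
       (auto intro!: depends_on_compose2[where h=Pair] depends_on_mono[OF depends_pos])
  have "Measurable.pred (joint p) (\<lambda>x. conn (snd x) ((\<lambda>y. pos (fst x) i \<otimes> y) ` wball R) (pos (fst x) j) (pos (fst x) k))" for i j k
    using pred_joint[OF m[of i j k], where C="V \<times> V \<times> V" and Q="\<lambda>(z, x, y) \<omega>. conn \<omega> ((\<lambda>y. z \<otimes> y) ` wball R) x y"]
    by (simp add: case_prod_unfold countable_SIGMA pred_conn ball_sub mem_Times_iff)
  then show ?thesis unfolding local_cut_time_def by (intro pred_intros_finite pred_intros_logic) auto
qed

lemma pos_shift:
  assumes \<xi>: "\<xi> \<in> space \<Xi>"
  shows "pos \<xi> (n + k) = (pos \<xi> n \<otimes> inv v) \<otimes> pos (shift n \<xi>) k"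
  using has_increments_unique[OF has_increments_shift[OF has_increments_pos[OF \<xi>]] shift_space[OF \<xi>], of n k] by simp

text \<open>Shifting time changes the increments by a measure-preserving shift and the walk by a translation,
to which the percolation is insensitive.\<close>

lemma stationary:
  assumes m: "\<And>n. Measurable.pred (joint p) (\<lambda>x. T (\<lambda>k. pos (fst x) (n + k)) (snd x))"
    and inv: "\<And>g s. g \<in> V \<Longrightarrow> (\<And>k. s k \<in> V) \<Longrightarrow> perc_prob p (T (\<lambda>k. g \<otimes> s k)) = perc_prob p (T s)"
  shows "joint_prob p (\<lambda>\<xi>. T (\<lambda>k. pos \<xi> (n + k))) = joint_prob p (\<lambda>\<xi>. T (pos \<xi>))"
    and "(\<integral>\<xi>. perc_prob p (T (\<lambda>k. pos \<xi> (n + k))) \<partial>\<Xi>) = joint_prob p (\<lambda>\<xi>. T (pos \<xi>))"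
proof -
  have m0: "Measurable.pred (joint p) (\<lambda>x. T (pos (fst x)) (snd x))" using m[of 0] by simp
  have "(\<integral>\<xi>. perc_prob p (T (\<lambda>k. pos \<xi> (n + k))) \<partial>\<Xi>) = (\<integral>\<xi>. perc_prob p (T (pos (shift n \<xi>))) \<partial>\<Xi>)"
  proof (intro Bochner_Integration.integral_cong refl)
    fix \<xi> assume \<xi>: "\<xi> \<in> space \<Xi>"
    have "(\<lambda>k. pos \<xi> (n + k)) = (\<lambda>k. (pos \<xi> n \<otimes> inv v) \<otimes> pos (shift n \<xi>) k)"
      using pos_shift[OF \<xi>] by blast
    moreover have "perc_prob p (T (\<lambda>k. (pos \<xi> n \<otimes> inv v) \<otimes> pos (shift n \<xi>) k)) = perc_prob p (T (pos (shift n \<xi>)))"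
      using \<xi> v shift_space[OF \<xi>] by (intro inv) auto
    ultimately show "perc_prob p (T (\<lambda>k. pos \<xi> (n + k))) = perc_prob p (T (pos (shift n \<xi>)))" by simp
  qed
  also have "\<dots> = (\<integral>\<xi>. perc_prob p (T (pos \<xi>)) \<partial>\<Xi>)"
    using integral_shift[OF joint_fubini(1)[OF m0]] .
  also have "\<dots> = joint_prob p (\<lambda>\<xi>. T (pos \<xi>))" using joint_fubini(2)[OF m0] by simp
  finally show *: "(\<integral>\<xi>. perc_prob p (T (\<lambda>k. pos \<xi> (n + k))) \<partial>\<Xi>) = joint_prob p (\<lambda>\<xi>. T (pos \<xi>))" .
  show "joint_prob p (\<lambda>\<xi>. T (\<lambda>k. pos \<xi> (n + k))) = joint_prob p (\<lambda>\<xi>. T (pos \<xi>))"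
    using joint_fubini(2)[OF m[of n]] * by simp
qed

lemma local_cut_time_limit: "(\<lambda>R. joint_prob p (\<lambda>\<xi>. local_cut_time R (pos \<xi>))) \<longlonglongrightarrow> joint_prob p (\<lambda>\<xi>. cut_time (pos \<xi>))"
proof -
  interpret JP: prob_space "joint p" by (rule prob_space_joint)
  let ?A = "\<lambda>R. {x \<in> space (joint p). local_cut_time R (pos (fst x)) (snd x)}"
  have "(\<lambda>R. measure (joint p) (?A R)) \<longlonglongrightarrow> measure (joint p) (\<Inter>R. ?A R)"
  proof (rule JP.finite_Lim_measure_decseq)
    show "range ?A \<subseteq> sets (joint p)" using predE[OF pred_local_cut_time_joint[where n=0]] by auto
    show "decseq ?A" unfolding decseq_def using local_cut_time_antimono by blast
  qed
  moreover have "(\<Inter>R. ?A R) = {x \<in> space (joint p). cut_time (pos (fst x)) (snd x)}"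
  proof -
    have "cut_time (pos (fst x)) (snd x) \<longleftrightarrow> (\<forall>R. local_cut_time R (pos (fst x)) (snd x))" if "x \<in> space (joint p)" for x
      using cut_time_iff_local_cut_time[of "pos (fst x)" "snd x"] v by simp
    then show ?thesis by blast
  qed
  ultimately show ?thesis by simp
qed

text \<open>The increments in the window determine the positions in the window up to translation.\<close>

lemma depends_window:
  "depends_on \<Xi> {n - int R..<n + int R + 1} (\<lambda>\<xi>. perc_prob p (local_cut_time R (\<lambda>k. pos \<xi> (n + k))))"
proof (rule depends_onI)
  fix \<xi> \<xi>' assume \<xi>: "\<xi> \<in> space \<Xi>" "\<xi>' \<in> space \<Xi>" and eq: "\<And>i. i \<in> {n - int R..<n + int R + 1} \<Longrightarrow> \<xi> i = \<xi>' i"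
  define g where "g = pos \<xi>' n \<otimes> inv (pos \<xi> n)"
  have g: "g \<in> V" "pos \<xi>' (n + 0) = g \<otimes> pos \<xi> (n + 0)" using \<xi> by (simp_all add: g_def m_assoc)
  have "pos \<xi>' (n + k) = g \<otimes> pos \<xi> (n + k)" if "- int R \<le> k" "k \<le> int R + 1" for k
    by (rule has_increments_unique_on[OF has_increments_shift[OF has_increments_pos[OF \<xi>(1)], of n] has_increments_shift[OF has_increments_pos[OF \<xi>(2)], of n] g,
          where a="- int R" and b="int R + 1"])
       (use that eq \<xi> shift_space in \<open>auto simp: shift_def\<close>)
  then have "local_cut_time R (\<lambda>k. pos \<xi>' (n + k)) = local_cut_time R (\<lambda>k. g \<otimes> pos \<xi> (n + k))"
    by (intro local_cut_time_cong)
  then show "perc_prob p (local_cut_time R (\<lambda>k. pos \<xi> (n + k))) = perc_prob p (local_cut_time R (\<lambda>k. pos \<xi>' (n + k)))"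
    using local_cut_time_translate[OF g(1), of "\<lambda>k. pos \<xi> (n + k)" p R] \<xi> by simp
qed

text \<open>Given the walk, if the two positions are more than \<open>2 R\<close> apart, the events depend on disjoint sets of
edges, and their conditional probabilities depend on increments in disjoint windows. The error term bounds
the probability that the positions are closer.\<close>

lemma local_cut_time_independent:
  fixes b :: real
  assumes b: "\<And>x. x \<in> V \<Longrightarrow> heat_kernel n x \<le> b" and far: "2 * R + 1 \<le> n" and j: "j = i + int n"
  shows "joint_prob p (\<lambda>\<xi> \<omega>. local_cut_time R (\<lambda>k. pos \<xi> (i + k)) \<omega> \<and> local_cut_time R (\<lambda>k. pos \<xi> (j + k)) \<omega>) \<le>
    (joint_prob p (\<lambda>\<xi>. local_cut_time R (pos \<xi>)))\<^sup>2 + card (wball (2 * R)) * b"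
proof -
  interpret X: prob_space \<Xi> by (rule prob_space_\<Xi>)
  let ?h = "\<lambda>i \<xi>. perc_prob p (local_cut_time R (\<lambda>k. pos \<xi> (i + k)))"
  let ?N = "{\<xi> \<in> space \<Xi>. increment \<xi> i n \<in> wball (2 * R)}"
  have hm: "?h i \<in> borel_measurable \<Xi>" for i by (rule joint_fubini(1)[OF pred_local_cut_time_joint])
  have N: "?N \<in> sets \<Xi>" by (rule predE[OF \<Xi>_pred[OF increment_measurable]])
  have m: "Measurable.pred (joint p) (\<lambda>x. local_cut_time R (\<lambda>k. pos (fst x) (i + k)) (snd x) \<and> local_cut_time R (\<lambda>k. pos (fst x) (j + k)) (snd x))"
    by (intro pred_intros_logic pred_local_cut_time_joint)
  have hint: "integrable \<Xi> (\<lambda>\<xi>. ?h i \<xi> * ?h j \<xi>)"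
    using hm perc_prob_le_1 by (intro X.integrable_const_bound[where B=1]) (auto intro!: mult_le_one)
  have Nint: "integrable \<Xi> (indicator ?N :: _ \<Rightarrow> real)"
    using N by (intro integrable_real_indicator) (auto simp: X.emeasure_eq_measure)
  have "joint_prob p (\<lambda>\<xi> \<omega>. local_cut_time R (\<lambda>k. pos \<xi> (i + k)) \<omega> \<and> local_cut_time R (\<lambda>k. pos \<xi> (j + k)) \<omega>) =
      (\<integral>\<xi>. perc_prob p (\<lambda>\<omega>. local_cut_time R (\<lambda>k. pos \<xi> (i + k)) \<omega> \<and> local_cut_time R (\<lambda>k. pos \<xi> (j + k)) \<omega>) \<partial>\<Xi>)"
    by (rule joint_fubini(2)[OF m])
  also have "\<dots> \<le> (\<integral>\<xi>. ?h i \<xi> * ?h j \<xi> + indicator ?N \<xi> \<partial>\<Xi>)"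
  proof (rule integral_mono)
    show "integrable \<Xi> (\<lambda>\<xi>. perc_prob p (\<lambda>\<omega>. local_cut_time R (\<lambda>k. pos \<xi> (i + k)) \<omega> \<and> local_cut_time R (\<lambda>k. pos \<xi> (j + k)) \<omega>))"
      using joint_fubini(1)[OF m] perc_prob_le_1 by (intro X.integrable_const_bound[where B=1]) auto
    show "integrable \<Xi> (\<lambda>\<xi>. ?h i \<xi> * ?h j \<xi> + indicator ?N \<xi>)"
      by (rule Bochner_Integration.integrable_add[OF hint Nint])
    fix \<xi> assume \<xi>: "\<xi> \<in> space \<Xi>"
    show "perc_prob p (\<lambda>\<omega>. local_cut_time R (\<lambda>k. pos \<xi> (i + k)) \<omega> \<and> local_cut_time R (\<lambda>k. pos \<xi> (j + k)) \<omega>) \<le> ?h i \<xi> * ?h j \<xi> + indicator ?N \<xi>"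
    proof (cases "increment \<xi> i n \<in> wball (2 * R)")
      case True
      then have "indicator ?N \<xi> = (1 :: real)" using \<xi> by simp
      moreover have "0 \<le> ?h i \<xi> * ?h j \<xi>" by simp
      ultimately show ?thesis using perc_prob_le_1[of p "\<lambda>\<omega>. local_cut_time R (\<lambda>k. pos \<xi> (i + k)) \<omega> \<and> local_cut_time R (\<lambda>k. pos \<xi> (j + k)) \<omega>"] by linarith
    next
      case False
      let ?B = "\<lambda>i. (\<lambda>x. pos \<xi> (i + 0) \<otimes> x) ` wball R"
      have "?B i \<inter> ?B j = {}"
      proof (rule ccontr)
        assume "?B i \<inter> ?B j \<noteq> {}"
        then obtain x y where xy: "x \<in> wball R" "y \<in> wball R" "pos \<xi> i \<otimes> x = pos \<xi> j \<otimes> y" by auto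
        have V: "x \<in> V" "y \<in> V" "increment \<xi> i n \<in> V" "pos \<xi> i \<in> V" using xy wball_sub increment_in[OF \<xi>] \<xi> by auto
        have "pos \<xi> i \<otimes> x = pos \<xi> i \<otimes> (increment \<xi> i n \<otimes> y)"
          using xy(3) V pos_increment[OF \<xi>, of i n] by (simp add: j m_assoc)
        then have "x = increment \<xi> i n \<otimes> y" using V by simp
        then have "x \<otimes> inv y = increment \<xi> i n" using V by (simp add: m_assoc)
        moreover have "x \<otimes> inv y \<in> wball (R + R)" using xy by (intro wball_mult wball_inv)
        ultimately show False using False by (simp add: mult_2)
      qed
      moreover have "e \<noteq> {}" if "e \<in> E" for e using that by (auto elim: edge_cases)
      ultimately have disj: "{e \<in> E. e \<subseteq> ?B i} \<inter> {e \<in> E. e \<subseteq> ?B j} = {}" by blast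
      have "perc_prob p (\<lambda>\<omega>. local_cut_time R (\<lambda>k. pos \<xi> (i + k)) \<omega> \<and> local_cut_time R (\<lambda>k. pos \<xi> (j + k)) \<omega>) = ?h i \<xi> * ?h j \<xi>"
        by (rule perc_prob_indep[OF _ _ disj pred_local_cut_time depends_local_cut_time[where s="\<lambda>k. pos \<xi> (i + k)"]
              pred_local_cut_time depends_local_cut_time[where s="\<lambda>k. pos \<xi> (j + k)"]]) auto
      then show ?thesis by simp
    qed
  qed
  also have "\<dots> = (\<integral>\<xi>. ?h i \<xi> * ?h j \<xi> \<partial>\<Xi>) + walk_prob (\<lambda>\<xi>. increment \<xi> i n \<in> wball (2 * R))"
  proof -
    have "?N \<inter> space \<Xi> = ?N" by blast
    then have "(\<integral>\<xi>. indicator ?N \<xi> \<partial>\<Xi>) = walk_prob (\<lambda>\<xi>. increment \<xi> i n \<in> wball (2 * R))"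
      by (simp only: Bochner_Integration.integral_indicator)
    then show ?thesis using Bochner_Integration.integral_add[OF hint Nint] by simp
  qed
  also have "(\<integral>\<xi>. ?h i \<xi> * ?h j \<xi> \<partial>\<Xi>) = (\<integral>\<xi>. ?h i \<xi> \<partial>\<Xi>) * (\<integral>\<xi>. ?h j \<xi> \<partial>\<Xi>)"
    unfolding \<Xi>_def
  proof (rule PiM_indep_functions[where J="{i - int R..<i + int R + 1}" and K="{j - int R..<j + int R + 1}" and B=1])
    show "{i - int R..<i + int R + 1} \<inter> {j - int R..<j + int R + 1} = {}" using far j by auto
  qed (use prob_space_letter hm depends_window perc_prob_le_1 in \<open>auto simp: \<Xi>_def[symmetric]\<close>)
  also have "(\<integral>\<xi>. ?h i \<xi> \<partial>\<Xi>) * (\<integral>\<xi>. ?h j \<xi> \<partial>\<Xi>) = (joint_prob p (\<lambda>\<xi>. local_cut_time R (pos \<xi>)))\<^sup>2"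
    unfolding power2_eq_square
    by (intro arg_cong2[where f="(*)"] stationary(2)[OF pred_local_cut_time_joint local_cut_time_translate])
  also have "walk_prob (\<lambda>\<xi>. increment \<xi> i n \<in> wball (2 * R)) \<le> card (wball (2 * R)) * b"
  proof -
    have "?N = (\<Union>x\<in>wball (2 * R). {\<xi> \<in> space \<Xi>. increment \<xi> i n = x})" by blast
    then have "walk_prob (\<lambda>\<xi>. increment \<xi> i n \<in> wball (2 * R)) \<le> (\<Sum>x\<in>wball (2 * R). walk_prob (\<lambda>\<xi>. increment \<xi> i n = x))"
      using predE[OF \<Xi>_pred[OF increment_measurable]]
      by (simp only:) (intro X.finite_measure_subadditive_finite, auto)
    also have "\<dots> \<le> (\<Sum>x\<in>wball (2 * R). b)"
    proof (rule sum_mono)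
      fix x assume "x \<in> wball (2 * R)"
      then have x: "x \<in> V" using wball_sub by blast
      show "walk_prob (\<lambda>\<xi>. increment \<xi> i n = x) \<le> b" unfolding increment_law[OF x] by (rule b[OF x])
    qed
    finally show ?thesis by simp
  qed
  finally show ?thesis by simp
qed

text \<open>The bound on pairs of cut times uses that the local events decrease to the cut time, so that their
probability is close to \<open>r\<close> for large \<open>R\<close>; the lower bound for single cut times is exact by stationarity. The two choices of \<open>\<sigma>\<close>
cover the two directions of time.\<close>

theorem infinitely_many_cuts:
  assumes p: "0 \<le> p" "p < 1"
    and b: "\<And>n x. x \<in> V \<Longrightarrow> heat_kernel n x \<le> b n" "\<And>n. 0 \<le> b n" "summable (\<lambda>n. (real n + 1) * b n)"
    and C: "0 \<le> C" "\<And>x Y. x \<in> V \<Longrightarrow> finite Y \<Longrightarrow> Y \<subseteq> V \<Longrightarrow> (\<Sum>y\<in>Y. \<tau> p V x y) \<le> C"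
    and \<sigma>: "\<sigma> = int \<or> \<sigma> = (\<lambda>n. - int n)"
  shows "AE x in joint p. infinite {n. cut_time (\<lambda>k. pos (fst x) (\<sigma> n + k)) (snd x)}"
proof (rule infinitely_often_by_second_moment)
  interpret JP: prob_space "joint p" by (rule prob_space_joint)
  define r where "r = joint_prob p (\<lambda>\<xi>. cut_time (pos \<xi>))"
  show "prob_space (joint p)" by (rule prob_space_joint)
  show "{x \<in> space (joint p). cut_time (\<lambda>k. pos (fst x) (\<sigma> n + k)) (snd x)} \<in> sets (joint p)" for n
    by (rule predE[OF pred_cut_time_joint])
  obtain K :: nat where "0 < joint_prob p (\<lambda>\<xi> \<omega>. \<forall>i j. K \<le> i \<longrightarrow> K \<le> j \<longrightarrow> \<not> conn \<omega> V (pos \<xi> (- int i)) (pos \<xi> (int j)))"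
    using no_far_links[OF b C] by blast
  then show r: "0 < r" unfolding r_def by (rule cut_positive_probability[OF p])
  show "joint_prob p (\<lambda>\<xi>. cut_time (\<lambda>k. pos \<xi> (\<sigma> n + k))) = r" for n
    unfolding r_def by (rule stationary(1)[OF pred_cut_time_joint cut_time_translate])
  fix e :: real assume e: "0 < e"
  have "(\<lambda>R. (joint_prob p (\<lambda>\<xi>. local_cut_time R (pos \<xi>)))\<^sup>2) \<longlonglongrightarrow> r\<^sup>2"
    unfolding r_def by (intro tendsto_power local_cut_time_limit)
  then have "eventually (\<lambda>R. (joint_prob p (\<lambda>\<xi>. local_cut_time R (pos \<xi>)))\<^sup>2 < r\<^sup>2 + e / 2) sequentially"
    using e by (intro order_tendstoD(2)) auto
  then obtain R where R: "(joint_prob p (\<lambda>\<xi>. local_cut_time R (pos \<xi>)))\<^sup>2 < r\<^sup>2 + e / 2"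
    by (auto simp: eventually_sequentially)
  have "b \<longlonglongrightarrow> 0"
  proof (rule tendsto_sandwich[of "\<lambda>_. 0" b sequentially "\<lambda>n. (real n + 1) * b n"])
    show "eventually (\<lambda>n. b n \<le> (real n + 1) * b n) sequentially"
      using b(2) by (intro always_eventually allI) (simp add: distrib_right)
    show "(\<lambda>n. (real n + 1) * b n) \<longlonglongrightarrow> 0" by (rule summable_LIMSEQ_zero[OF b(3)])
  qed (use b(2) in auto)
  then have "(\<lambda>n. card (wball (2 * R)) * b n) \<longlonglongrightarrow> real (card (wball (2 * R))) * 0"
    by (intro tendsto_mult tendsto_const)
  then have "eventually (\<lambda>n. card (wball (2 * R)) * b n < e / 2) sequentially"
    using e by (intro order_tendstoD(2)) auto
  then obtain W0 where W0: "\<And>n. W0 \<le> n \<Longrightarrow> card (wball (2 * R)) * b n < e / 2"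
    by (auto simp: eventually_sequentially)
  define W where "W = W0 + 2 * R + 1"
  show "\<exists>W. \<forall>n m. n + W < m \<longrightarrow>
    measure (joint p) {x \<in> space (joint p). cut_time (\<lambda>k. pos (fst x) (\<sigma> n + k)) (snd x) \<and> cut_time (\<lambda>k. pos (fst x) (\<sigma> m + k)) (snd x)} \<le> r\<^sup>2 + e"
  proof (intro exI[of _ W] allI impI)
    fix n m assume nm: "n + W < m"
    have le: "joint_prob p (\<lambda>\<xi> \<omega>. cut_time (\<lambda>k. pos \<xi> (i + k)) \<omega> \<and> cut_time (\<lambda>k. pos \<xi> (j + k)) \<omega>) \<le> r\<^sup>2 + e"
      if j: "j = i + int (m - n)" for i j
    proof -
      have "joint_prob p (\<lambda>\<xi> \<omega>. cut_time (\<lambda>k. pos \<xi> (i + k)) \<omega> \<and> cut_time (\<lambda>k. pos \<xi> (j + k)) \<omega>) \<le>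
          joint_prob p (\<lambda>\<xi> \<omega>. local_cut_time R (\<lambda>k. pos \<xi> (i + k)) \<omega> \<and> local_cut_time R (\<lambda>k. pos \<xi> (j + k)) \<omega>)"
      proof (rule JP.finite_measure_mono)
        show "{x \<in> space (joint p). local_cut_time R (\<lambda>k. pos (fst x) (i + k)) (snd x) \<and> local_cut_time R (\<lambda>k. pos (fst x) (j + k)) (snd x)} \<in> sets (joint p)"
          by (intro predE pred_intros_logic pred_local_cut_time_joint)
        have "local_cut_time R (\<lambda>k. pos \<xi> (i + k)) \<omega>" if "\<xi> \<in> space \<Xi>" "cut_time (\<lambda>k. pos \<xi> (i + k)) \<omega>" for \<xi> \<omega> i
          using cut_time_imp_local_cut_time[of "\<lambda>k. pos \<xi> (i + k)"] that by simp
        then show "{x \<in> space (joint p). cut_time (\<lambda>k. pos (fst x) (i + k)) (snd x) \<and> cut_time (\<lambda>k. pos (fst x) (j + k)) (snd x)} \<subseteq>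
          {x \<in> space (joint p). local_cut_time R (\<lambda>k. pos (fst x) (i + k)) (snd x) \<and> local_cut_time R (\<lambda>k. pos (fst x) (j + k)) (snd x)}"
          by (auto simp: space_joint)
      qed
      also have "\<dots> \<le> (joint_prob p (\<lambda>\<xi>. local_cut_time R (pos \<xi>)))\<^sup>2 + card (wball (2 * R)) * b (m - n)"
        using nm by (intro local_cut_time_independent[where n="m - n"] b(1) j) (auto simp: W_def)
      also have "\<dots> \<le> r\<^sup>2 + e"
      proof -
        have "W0 \<le> m - n" using nm by (simp add: W_def)
        from W0[OF this] R show ?thesis by linarith
      qed
      finally show ?thesis .
    qed
    show "measure (joint p) {x \<in> space (joint p). cut_time (\<lambda>k. pos (fst x) (\<sigma> n + k)) (snd x) \<and> cut_time (\<lambda>k. pos (fst x) (\<sigma> m + k)) (snd x)} \<le> r\<^sup>2 + e"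
    proof (cases "\<sigma> = int")
      case True
      then show ?thesis using le[of "int m" "int n"] nm by simp
    next
      case False
      then have "\<sigma> = (\<lambda>n. - int n)" using \<sigma> by blast
      then show ?thesis using le[of "- int n" "- int m"] nm by (simp add: conj_commute)
    qed
  qed
qed

end

section \<open>From cut times to cut points\<close>

lemma reach_trans: "reach H y z \<Longrightarrow> reach H x y \<Longrightarrow> reach H x z"
  by (induction rule: reach.induct) (auto intro: reach_step)

lemma reach_edge: "x \<in> verts H \<Longrightarrow> y \<in> verts H \<Longrightarrow> {x, y} \<in> edges H \<Longrightarrow> reach H x y"
  by (rule reach_step[OF reach_refl])

text \<open>Edges are unordered.\<close>

lemma reach_sym: "reach H x y \<Longrightarrow> reach H y x"
proof (induction rule: reach.induct)
  case (reach_step x y z)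
  have "y \<in> verts H" using reach_in[OF reach_step.hyps(1)] by simp
  moreover have "{z, y} \<in> edges H" using reach_step.hyps(3) by (simp add: insert_commute)
  ultimately have "reach H z y" using reach_step.hyps(2) by (intro reach_edge)
  then show ?case by (rule reach_trans[OF reach_step.IH])
qed (rule reach_refl)

context cayley
begin

context
  fixes s :: "int \<Rightarrow> 'a" and \<omega> :: "'a set \<Rightarrow> bool" and n :: int
  assumes sV: "\<And>k. s k \<in> V" and s_edge: "\<And>k. {s k, s (k + 1)} \<in> E"
begin

text \<open>The union of the open clusters of the positions at times in \<open>K\<close>.\<close>

definition clusters_of :: "int set \<Rightarrow> 'a set" where
  "clusters_of K = {y. \<exists>k\<in>K. conn \<omega> V (s k) y}"

text \<open>The enlarged trace without the edge traversed after time \<open>n\<close>.\<close>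

definition cut_graph :: "'a graph" where
  "cut_graph = remove_edge (enlargement G \<omega> (walk_trace s)) {s n, s (n + 1)}"

lemma s_in_clusters_of: "k \<in> K \<Longrightarrow> s k \<in> clusters_of K"
  unfolding clusters_of_def using conn_refl[OF sV] by blast

lemma clusters_of_closed: "y \<in> clusters_of K \<Longrightarrow> {y, z} \<in> E \<Longrightarrow> \<omega> {y, z} \<Longrightarrow> z \<in> clusters_of K"
  unfolding clusters_of_def using conn_step edge_verts by blast

lemma verts_cut_graph: "verts cut_graph = clusters_of UNIV"
  by (auto simp: cut_graph_def remove_edge_def enlargement_def walk_trace_def verts_cluster clusters_of_def)

lemma edges_cut_graph:
  "edges cut_graph = ({{s k, s (k + 1)} | k. True} \<union> {e \<in> E. \<omega> e \<and> (\<exists>k. e \<subseteq> {y. conn \<omega> V (s k) y})}) - {{s n, s (n + 1)}}"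
  unfolding cut_graph_def remove_edge_def enlargement_def walk_trace_def cluster_def component_open
  by (auto simp: open_graph_def)

text \<open>Within a time interval, the walk connects all positions and each cluster is attached to a position. The second
assumption says that the removed edge is not among the edges used.\<close>

lemma side_connected:
  assumes conv: "\<And>a b c. a \<in> K \<Longrightarrow> c \<in> K \<Longrightarrow> a \<le> b \<Longrightarrow> b \<le> c \<Longrightarrow> b \<in> K"
    and e: "\<not> {s n, s (n + 1)} \<subseteq> clusters_of K" and xy: "x \<in> clusters_of K" "y \<in> clusters_of K"
  shows "reach cut_graph x y"
proof -
  have vert: "y \<in> verts cut_graph" if "y \<in> clusters_of K" for y
    using that unfolding verts_cut_graph clusters_of_def by blast
  have walk: "reach cut_graph (s k) (s k')" if k: "k \<in> K" "k' \<in> K" "k \<le> k'" for k k'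
    using k(3,2)
  proof (induction k' rule: int_ge_induct)
    case base
    show ?case using k(1) by (intro reach_refl vert s_in_clusters_of)
  next
    case (step i)
    have i: "i \<in> K" using conv[OF k(1) step.prems, of i] step.hyps by simp
    have "{s i, s (i + 1)} \<subseteq> clusters_of K" using s_in_clusters_of[OF i] s_in_clusters_of[OF step.prems] by simp
    then have "{s i, s (i + 1)} \<in> edges cut_graph" using e unfolding edges_cut_graph by blast
    then show ?case by (rule reach_step[OF step.IH[OF i] vert[OF s_in_clusters_of[OF step.prems]]])
  qed
  have clus: "reach cut_graph (s k) y" if k: "k \<in> K" and c: "conn \<omega> V (s k) y" for k y
    using c
  proof (induction "s k" y rule: conn.induct)
    case (conn_refl)
    show ?case using k by (intro reach_refl vert s_in_clusters_of)
  next
    case (conn_step y z)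
    have c: "conn \<omega> V (s k) z" using conn_step.hyps by (intro conn.conn_step[of \<omega> V "s k" y z])
    have sub: "{y, z} \<subseteq> {y. conn \<omega> V (s k) y}" using conn_step.hyps c by blast
    then have K: "{y, z} \<subseteq> clusters_of K" using k unfolding clusters_of_def by blast
    then have "{y, z} \<noteq> {s n, s (n + 1)}" using e by metis
    moreover have "z \<in> verts cut_graph" using K by (intro vert) blast
    moreover have "{y, z} \<in> {e \<in> E. \<omega> e \<and> (\<exists>k. e \<subseteq> {y. conn \<omega> V (s k) y})}"
      using sub conn_step.hyps(4,5) by blast
    ultimately have "{y, z} \<in> edges cut_graph" "z \<in> verts cut_graph" unfolding edges_cut_graph by blast+
    then show ?case using conn_step.hyps(2) by (intro reach_step[of cut_graph "s k" y z])
  qed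
  obtain k where k: "k \<in> K" "conn \<omega> V (s k) x" using xy unfolding clusters_of_def by blast
  obtain k' where k': "k' \<in> K" "conn \<omega> V (s k') y" using xy unfolding clusters_of_def by blast
  have "reach cut_graph (s k) (s k')"
  proof (cases "k \<le> k'")
    case True show ?thesis by (rule walk[OF k(1) k'(1) True])
  next
    case False show ?thesis by (rule reach_sym[OF walk[OF k'(1) k(1)]]) (use False in simp)
  qed
  then show ?thesis by (rule reach_trans[OF reach_trans[OF clus[OF k']] reach_sym[OF clus[OF k]]])
qed

text \<open>Every remaining edge is either traversed before or after the edge removed, or lies in a single cluster;
hence none of them joins the two sides.\<close>

lemma cut_point_of_cut:
  assumes cut: "cut_time (\<lambda>k. s (n + k)) \<omega>" and inf: "infinite (s ` {..n})" "infinite (s ` {n<..})"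
  shows "cut_point (enlargement G \<omega> (walk_trace s)) (s n)"
proof -
  let ?U = "enlargement G \<omega> (walk_trace s)" and ?e = "{s n, s (n + 1)}"
  let ?A = "clusters_of {..n}" and ?B = "clusters_of {n<..}"
  have disj: "?A \<inter> ?B = {}"
  proof (rule ccontr)
    assume "?A \<inter> ?B \<noteq> {}"
    then obtain y k m where km: "k \<le> n" "n < m" "conn \<omega> V (s k) y" "conn \<omega> V (s m) y"
      by (auto simp: clusters_of_def)
    have "conn \<omega> V (s k) (s m)" using conn_trans[OF conn_sym[OF km(4)] km(3)] .
    moreover define a b where "a = nat (n - k)" and "b = nat (m - n - 1)"
    have "n + - int a = k" "n + (1 + int b) = m" using km by (auto simp: a_def b_def)
    ultimately show False using cut unfolding cut_time_def by metis
  qed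
  have un: "?A \<union> ?B = clusters_of UNIV"
  proof -
    have "?A \<union> ?B = clusters_of ({..n} \<union> {n<..})" unfolding clusters_of_def by blast
    also have "{..n} \<union> {n<..} = UNIV" by auto
    finally show ?thesis .
  qed
  have A: "s n \<in> ?A" "s (n + 1) \<notin> ?A" "s (n + 1) \<in> ?B" "s n \<notin> ?B"
    using s_in_clusters_of[of n "{..n}"] s_in_clusters_of[of "n + 1" "{n<..}"] disj by auto
  have conA: "reach cut_graph x y" if "x \<in> ?A" "y \<in> ?A" for x y
    using that A by (intro side_connected[of "{..n}"]) auto
  have conB: "reach cut_graph x y" if "x \<in> ?B" "y \<in> ?B" for x y
    using that A by (intro side_connected[of "{n<..}"]) auto
  have adj: "{y, z} \<subseteq> ?A \<or> {y, z} \<subseteq> ?B" if yz: "{y, z} \<in> edges cut_graph" for y z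
  proof -
    from yz consider k where "{y, z} = {s k, s (k + 1)}" "k \<noteq> n" | "{y, z} \<in> E" "\<omega> {y, z}" "{y, z} \<subseteq> clusters_of UNIV"
      unfolding edges_cut_graph clusters_of_def by blast
    then show ?thesis
    proof cases
      case 1
      show ?thesis
      proof (cases "k < n")
        case True
        then show ?thesis using 1 s_in_clusters_of[of k "{..n}"] s_in_clusters_of[of "k + 1" "{..n}"] by simp
      next
        case False
        then show ?thesis using 1 s_in_clusters_of[of k "{n<..}"] s_in_clusters_of[of "k + 1" "{n<..}"] by simp
      qed
    next
      case 2
      then have "y \<in> ?A \<or> y \<in> ?B" using un by blast
      then show ?thesis using clusters_of_closed[OF _ 2(1,2)] by blast
    qed
  qed
  have stay: "y \<in> ?A \<longleftrightarrow> x \<in> ?A" if "reach cut_graph x y" for x y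
    using that
  proof (induction rule: reach.induct)
    case (reach_step x y z)
    then show ?case using adj[OF reach_step.hyps(3)] disj by blast
  qed simp
  have compA: "component cut_graph x = ?A" if "x \<in> ?A" for x
    unfolding component_eq using that conA stay by blast
  have compB: "component cut_graph x = ?B" if "x \<in> ?B" for x
  proof -
    have "x \<notin> ?A" using that disj by blast
    then have "y \<in> ?B" if "reach cut_graph x y" for y
      using stay[OF that] reach_in[OF that] un unfolding verts_cut_graph by blast
    then show ?thesis unfolding component_eq using that conB by blast
  qed
  have comps: "components cut_graph = {?A, ?B}"
  proof
    show "components cut_graph \<subseteq> {?A, ?B}"
      unfolding components_def verts_cut_graph un[symmetric] using compA compB by blast
    have "?A \<in> components cut_graph" "?B \<in> components cut_graph"
      unfolding components_def verts_cut_graph un[symmetric]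
      using compA[OF A(1)] compB[OF A(3)] A by blast+
    then show "{?A, ?B} \<subseteq> components cut_graph" by blast
  qed
  have "infinite ?A" "infinite ?B"
  proof -
    have "s ` {..n} \<subseteq> ?A" "s ` {n<..} \<subseteq> ?B" using s_in_clusters_of by blast+
    then show "infinite ?A" "infinite ?B" using inf finite_subset by blast+
  qed
  moreover have "?A \<noteq> ?B" using A by blast
  moreover have "?e \<in> edges ?U" by (auto simp: enlargement_def walk_trace_def)
  moreover have "s n \<in> verts ?U"
    using A un verts_cut_graph by (auto simp: cut_graph_def remove_edge_def)
  ultimately show ?thesis
    unfolding cut_point_def using comps unfolding cut_graph_def by blast
qed

end

text \<open>A cut time separates the positions before and after it, so positions at different cut times differ.
This yields both the infinitude of the two sides and that of the set of cut points.\<close>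

lemma infinitely_many_cut_points:
  assumes sV: "\<And>k. s k \<in> V" and s_edge: "\<And>k. {s k, s (k + 1)} \<in> E"
    and fut: "infinite {n. cut_time (\<lambda>k. s (int n + k)) \<omega>}"
    and past: "infinite {n. cut_time (\<lambda>k. s (- int n + k)) \<omega>}"
  shows "infinite {x. cut_point (enlargement G \<omega> (walk_trace s)) x}"
proof -
  have sep: "s i \<noteq> s j" if "cut_time (\<lambda>k. s (i + k)) \<omega>" "i < j" for i j
  proof
    assume eq: "s i = s j"
    have "\<not> conn \<omega> V (s (i + - int 0)) (s (i + (1 + int (nat (j - i - 1)))))"
      using that(1) unfolding cut_time_def by blast
    moreover have "i + (1 + int (nat (j - i - 1))) = j" using that by simp
    ultimately have "\<not> conn \<omega> V (s i) (s j)" by (simp only:) simp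
    then show False using conn_refl[OF sV] eq by metis
  qed
  define I where "I = {n. cut_time (\<lambda>k. s (int n + k)) \<omega>}"
  define I' where "I' = {n. cut_time (\<lambda>k. s (- int n + k)) \<omega>}"
  have inj: "inj_on (\<lambda>n. s (int n)) I"
    by (rule linorder_inj_onI) (use sep in \<open>auto simp: I_def\<close>)
  have inj': "inj_on (\<lambda>n. s (- int n)) I'"
  proof (rule linorder_inj_onI)
    fix x y assume "x < y" "x \<in> I'" "y \<in> I'"
    then show "s (- int x) \<noteq> s (- int y)" using sep[of "- int y" "- int x"] by (auto simp: I'_def)
  qed auto
  have "infinite (s ` {n<..})" for n
  proof -
    have "infinite (I - {..nat n})" using fut by (simp add: I_def)
    then have "infinite ((\<lambda>n. s (int n)) ` (I - {..nat n}))"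
      using finite_imageD[OF _ inj_on_subset[OF inj Diff_subset]] by blast
    moreover have "(\<lambda>n. s (int n)) ` (I - {..nat n}) \<subseteq> s ` {n<..}" by auto
    ultimately show ?thesis using finite_subset by blast
  qed
  moreover have "infinite (s ` {..n})" for n
  proof -
    have "infinite (I' - {..nat (- n)})" using past by (simp add: I'_def)
    then have "infinite ((\<lambda>n. s (- int n)) ` (I' - {..nat (- n)}))"
      using finite_imageD[OF _ inj_on_subset[OF inj' Diff_subset]] by blast
    moreover have "(\<lambda>n. s (- int n)) ` (I' - {..nat (- n)}) \<subseteq> s ` {..n}" by auto
    ultimately show ?thesis using finite_subset by blast
  qed
  ultimately have "cut_point (enlargement G \<omega> (walk_trace s)) (s (int n))" if "n \<in> I" for n
    using that by (intro cut_point_of_cut sV s_edge) (auto simp: I_def)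
  then have "(\<lambda>n. s (int n)) ` I \<subseteq> {x. cut_point (enlargement G \<omega> (walk_trace s)) x}" by blast
  moreover have "infinite ((\<lambda>n. s (int n)) ` I)"
    using fut finite_imageD[OF _ inj] by (auto simp: I_def)
  ultimately show ?thesis using finite_subset by blast
qed

end

section \<open>The law of the two-sided walk\<close>

abbreviation paths :: "(nat \<Rightarrow> 'a) measure" where
  "paths \<equiv> \<Pi>\<^sub>M i\<in>UNIV. count_space UNIV"

lemma sets_srw_law: "sets (srw_law G x) = sets paths"
proof -
  interpret Ionescu_Tulcea "srw_kernel G x" "\<lambda>_. count_space UNIV"
    by (rule Ionescu_Tulcea_srw)
  show ?thesis unfolding srw_law_def by (rule PF.sets_lim)
qed

lemma cylinder_measurable: "{f. \<forall>i\<le>n. f i = w i} \<in> sets (paths :: (nat \<Rightarrow> 'a) measure)"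
proof -
  have "{f \<in> space paths. \<forall>i\<in>{..n}. f i \<in> {w i}} \<in> sets (paths :: (nat \<Rightarrow> 'a) measure)"
    by (intro sets.sets_Collect_finite_All sets_Collect_single') auto
  then show ?thesis by (simp add: space_PiM atMost_iff Ball_def)
qed

text \<open>The state space may be uncountable, but up to any time only finitely many paths are charged by \<open>P\<close>. Summing
over these paths gives \<open>P \<le> Q\<close> on events up to a finite time, and passing to complements gives equality.\<close>

lemma path_measure_eqI:
  fixes P Q :: "(nat \<Rightarrow> 'a) measure"
  assumes P: "prob_space P" "sets P = sets paths" and Q: "prob_space Q" "sets Q = sets paths"
    and cyl: "\<And>n w. emeasure P {f. \<forall>i\<le>n. f i = w i} = emeasure Q {f. \<forall>i\<le>n. f i = w i}"
    and fin: "\<And>n. \<exists>F. finite F \<and> (AE f in P. restrict f {..n} \<in> F)"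
  shows "P = Q"
proof (rule measure_eqI_PiM_infinite[OF P(2) Q(2)])
  interpret P: prob_space P by (rule P)
  interpret Q: prob_space Q by (rule Q)
  show "finite_measure P" by unfold_locales
  have spP: "space P = UNIV" and spQ: "space Q = UNIV"
    using sets_eq_imp_space_eq[OF P(2)] sets_eq_imp_space_eq[OF Q(2)] by (simp_all add: space_PiM)
  have le: "measure P {f. restrict f {..n} \<in> D} \<le> measure Q {f. restrict f {..n} \<in> D}"
    if D: "{f. restrict f {..n} \<in> D} \<in> sets paths" for n D
  proof -
    obtain F where F: "finite F" "AE f in P. restrict f {..n} \<in> F" using fin by blast
    let ?F = "{w \<in> F \<inter> D. w \<in> extensional {..n}}"
    let ?c = "\<lambda>w. {f. \<forall>i\<le>n. f i = w i}"
    have c: "f \<in> ?c w \<longleftrightarrow> restrict f {..n} = w" if "w \<in> ?F" for f w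
      using that by (auto simp: fun_eq_iff extensional_def restrict_def)
    have cm: "?c w \<in> sets P" "?c w \<in> sets Q" for w
      unfolding P(2) Q(2) by (rule cylinder_measurable)+
    have dj: "disjoint_family_on ?c ?F"
      unfolding disjoint_family_on_def
    proof (intro ballI impI)
      fix w w' assume w: "w \<in> ?F" "w' \<in> ?F" "w \<noteq> w'"
      show "?c w \<inter> ?c w' = {}"
      proof (rule ccontr)
        assume "?c w \<inter> ?c w' \<noteq> {}"
        then obtain f where f: "f \<in> ?c w" "f \<in> ?c w'" by blast
        show False using c[THEN iffD1, OF w(1) f(1)] c[THEN iffD1, OF w(2) f(2)] w(3) by metis
      qed
    qed
    have sub: "(\<Union>w\<in>?F. ?c w) \<subseteq> {f. restrict f {..n} \<in> D}"
    proof
      fix f assume "f \<in> (\<Union>w\<in>?F. ?c w)"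
      then obtain w where w: "w \<in> ?F" "f \<in> ?c w" by blast
      then show "f \<in> {f. restrict f {..n} \<in> D}" using c[THEN iffD1, OF w] by simp
    qed
    have "measure P {f. restrict f {..n} \<in> D} = measure P (\<Union>w\<in>?F. ?c w)"
    proof (rule P.finite_measure_eq_AE)
      show "AE f in P. f \<in> {f. restrict f {..n} \<in> D} \<longleftrightarrow> f \<in> (\<Union>w\<in>?F. ?c w)"
        using F(2)
      proof eventually_elim
        case (elim f)
        show ?case
        proof
          assume "f \<in> {f. restrict f {..n} \<in> D}"
          then have w: "restrict f {..n} \<in> ?F" using elim by simp
          then have "f \<in> ?c (restrict f {..n})" by simp
          then show "f \<in> (\<Union>w\<in>?F. ?c w)" using w by blast
        qed (use sub in blast)
      qed
    qed (use D P(2) cm F in auto)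
    also have "\<dots> = (\<Sum>w\<in>?F. measure P (?c w))"
      using F cm dj by (intro P.finite_measure_finite_Union) auto
    also have "\<dots> = (\<Sum>w\<in>?F. measure Q (?c w))" by (simp only: measure_def cyl)
    also have "\<dots> = measure Q (\<Union>w\<in>?F. ?c w)"
      using F cm dj by (intro Q.finite_measure_finite_Union[symmetric]) auto
    also have "\<dots> \<le> measure Q {f. restrict f {..n} \<in> D}"
      using sub D Q(2) by (intro Q.finite_measure_mono) auto
    finally show ?thesis .
  qed
  fix A :: "nat \<Rightarrow> 'a set" and J :: "nat set" assume J: "finite J"
  let ?B = "prod_emb UNIV (\<lambda>_. count_space UNIV) J (Pi\<^sub>E J A)"
  obtain n where n: "J \<subseteq> {..n}" using J finite_nat_iff_bounded_le by blast
  have Bm: "?B \<in> sets (paths :: (nat \<Rightarrow> 'a) measure)" using J by (intro sets_PiM_I) auto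
  let ?D = "{g. \<forall>j\<in>J. g j \<in> A j}"
  have B: "?B = {f. restrict f {..n} \<in> ?D}"
    using n by (auto simp: prod_emb_def PiE_iff subset_iff)
  have Bc: "- ?B = {f. restrict f {..n} \<in> - ?D}" unfolding B by blast
  have Bcm: "- ?B \<in> sets (paths :: (nat \<Rightarrow> 'a) measure)"
    using sets.compl_sets[OF Bm] by (simp add: space_PiM Compl_eq_Diff_UNIV)
  have 1: "measure P ?B \<le> measure Q ?B" using le[of n ?D] Bm B by simp
  have 2: "measure P (- ?B) \<le> measure Q (- ?B)" using le[of n "- ?D"] Bcm Bc by simp
  have 3: "measure P (- ?B) = 1 - measure P ?B" "measure Q (- ?B) = 1 - measure Q ?B"
    using P.prob_compl[of ?B] Q.prob_compl[of ?B] Bm P(2) Q(2) by (simp_all add: spP spQ Compl_eq_Diff_UNIV)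
  have "measure P ?B = measure Q ?B" using 1 2 3 by linarith
  then show "emeasure P ?B = emeasure Q ?B" by (simp add: P.emeasure_eq_measure Q.emeasure_eq_measure)
qed

context cayley_walk
begin

text \<open>Stated for an abstract sequence of fresh letters \<open>L\<close> so that it applies to both directions of time.\<close>

lemma cylinder_law:
  fixes Z :: "(int \<Rightarrow> 'a) \<Rightarrow> nat \<Rightarrow> 'a"
  assumes Z0: "\<And>\<xi>. Z \<xi> 0 = v" and ZS: "\<And>\<xi> n. Z \<xi> (Suc n) = Z \<xi> n \<otimes> L \<xi> n"
    and L: "\<And>\<xi> n. \<xi> \<in> space \<Xi> \<Longrightarrow> L \<xi> n \<in> S"
    and dep: "\<And>n. depends_on \<Xi> (C n) (\<lambda>\<xi>. Z \<xi> n)" "\<And>n. finite (C n)" "\<And>m n. m \<le> n \<Longrightarrow> C m \<subseteq> C n"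
    and Ldep: "\<And>n. depends_on \<Xi> {c n} (\<lambda>\<xi>. L \<xi> n)" "\<And>n. c n \<notin> C n"
    and Lprob: "\<And>n s. s \<in> S \<Longrightarrow> walk_prob (\<lambda>\<xi>. L \<xi> n = s) = 1 / card S"
  shows "emeasure \<Xi> {\<xi> \<in> space \<Xi>. \<forall>i\<le>n. Z \<xi> i = w i} = emeasure (srw_law G v) {f. \<forall>i\<le>n. f i = w i}"
proof -
  interpret X: prob_space \<Xi> by (rule prob_space_\<Xi>)
  let ?q = "\<lambda>i. pmf (pmf_of_set (nbrs G (w i))) (w (Suc i))"
  have ZV: "Z \<xi> n \<in> V" if "\<xi> \<in> space \<Xi>" for \<xi> n
    using that L by (induction n) (auto simp: Z0 ZS v)
  have dC: "depends_on \<Xi> (C n) (\<lambda>\<xi>. \<forall>i\<le>n. Z \<xi> i = w i)" for n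
  proof (rule depends_onI)
    fix \<xi> \<xi>' assume a: "\<xi> \<in> space \<Xi>" "\<xi>' \<in> space \<Xi>" "\<And>i. i \<in> C n \<Longrightarrow> \<xi> i = \<xi>' i"
    have "Z \<xi> i = Z \<xi>' i" if "i \<le> n" for i
      by (rule depends_onD[OF dep(1) a(1,2)]) (use a(3) dep(3)[OF that] in blast)
    then show "(\<forall>i\<le>n. Z \<xi> i = w i) = (\<forall>i\<le>n. Z \<xi>' i = w i)" by simp
  qed
  have "walk_prob (\<lambda>\<xi>. \<forall>i\<le>n. Z \<xi> i = w i) = (if w 0 = v then 1 else 0) * (\<Prod>i<n. ?q i)"
  proof (induction n)
    case 0
    show ?case using X.prob_space by (auto simp: Z0)
  next
    case (Suc n)
    have split: "{\<xi> \<in> space \<Xi>. \<forall>i\<le>Suc n. Z \<xi> i = w i} = {\<xi> \<in> space \<Xi>. (\<forall>i\<le>n. Z \<xi> i = w i) \<and> w n \<otimes> L \<xi> n = w (Suc n)}"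
    proof -
      have eq: "(\<forall>i\<le>Suc n. Z \<xi> i = w i) \<longleftrightarrow> (\<forall>i\<le>n. Z \<xi> i = w i) \<and> Z \<xi> n \<otimes> L \<xi> n = w (Suc n)" for \<xi>
        unfolding ZS[symmetric] by (auto simp: le_Suc_eq)
      have "(\<forall>i\<le>Suc n. Z \<xi> i = w i) \<longleftrightarrow> (\<forall>i\<le>n. Z \<xi> i = w i) \<and> w n \<otimes> L \<xi> n = w (Suc n)" for \<xi>
      proof (cases "\<forall>i\<le>n. Z \<xi> i = w i")
        case True
        then have "Z \<xi> n = w n" by simp
        then show ?thesis unfolding eq by simp
      next
        case False
        then show ?thesis unfolding eq by blast
      qed
      then show ?thesis by simp
    qed
    have "walk_prob (\<lambda>\<xi>. \<forall>i\<le>Suc n. Z \<xi> i = w i) = walk_prob (\<lambda>\<xi>. \<forall>i\<le>n. Z \<xi> i = w i) * ?q n"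
    proof (cases "w n \<in> V")
      case False
      then have "\<not> (\<forall>i\<le>n. Z \<xi> i = w i)" if "\<xi> \<in> space \<Xi>" for \<xi>
        using ZV[OF that, of n] by auto
      then have "{\<xi> \<in> space \<Xi>. \<forall>i\<le>n. Z \<xi> i = w i} = {}"
        "{\<xi> \<in> space \<Xi>. (\<forall>i\<le>n. Z \<xi> i = w i) \<and> w n \<otimes> L \<xi> n = w (Suc n)} = {}" by blast+
      then show ?thesis by (simp only: split measure_empty mult_zero_left)
    next
      case True
      note nb = nbrs_eq[OF True]
      have inj: "inj_on (\<lambda>s. w n \<otimes> s) S" using True by (intro inj_onI) auto
      have fin: "finite (nbrs G (w n))" "nbrs G (w n) \<noteq> {}" "card (nbrs G (w n)) = card S"
        using S_fin S_ne card_image[OF inj] by (simp_all add: nb)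
      show ?thesis
      proof (cases "w (Suc n) \<in> nbrs G (w n)")
        case False
        then have "w n \<otimes> L \<xi> n \<noteq> w (Suc n)" if "\<xi> \<in> space \<Xi>" for \<xi>
          using L[OF that, of n] unfolding nb by (metis imageI)
        then have "{\<xi> \<in> space \<Xi>. (\<forall>i\<le>n. Z \<xi> i = w i) \<and> w n \<otimes> L \<xi> n = w (Suc n)} = {}" by blast
        moreover have "?q n = 0" using False fin by (simp add: pmf_of_set)
        ultimately show ?thesis by (simp only: split measure_empty mult_zero_right)
      next
        case T: True
        then obtain s where s: "s \<in> S" "w (Suc n) = w n \<otimes> s" by (auto simp: nb)
        have "{\<xi> \<in> space \<Xi>. (\<forall>i\<le>n. Z \<xi> i = w i) \<and> w n \<otimes> L \<xi> n = w (Suc n)} =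
            {\<xi> \<in> space \<Xi>. (\<forall>i\<le>n. Z \<xi> i = w i) \<and> L \<xi> n = s}"
          using L s True by auto
        then have "walk_prob (\<lambda>\<xi>. \<forall>i\<le>Suc n. Z \<xi> i = w i) = walk_prob (\<lambda>\<xi>. (\<forall>i\<le>n. Z \<xi> i = w i) \<and> L \<xi> n = s)"
          unfolding split by simp
        also have "\<dots> = walk_prob (\<lambda>\<xi>. \<forall>i\<le>n. Z \<xi> i = w i) * walk_prob (\<lambda>\<xi>. L \<xi> n = s)"
        proof (rule \<Xi>_indep[OF _ _ dC _ depends_on_compose[OF Ldep(1)]])
          show "C n \<inter> {c n} = {}" using Ldep(2) by blast
          show "Measurable.pred \<Xi> (\<lambda>\<xi>. \<forall>i\<le>n. Z \<xi> i = w i)" by (rule \<Xi>_finite_measurable[OF dep(2) dC])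
          show "Measurable.pred \<Xi> (\<lambda>\<xi>. L \<xi> n = s)" by (rule \<Xi>_pred[OF \<Xi>_finite_measurable[OF _ Ldep(1)]]) simp
        qed
        also have "walk_prob (\<lambda>\<xi>. L \<xi> n = s) = ?q n"
          using T fin Lprob[OF s(1)] by (simp add: pmf_of_set)
        finally show ?thesis .
      qed
    qed
    then show ?case using Suc by simp
  qed
  then show ?thesis
    unfolding emeasure_srw_law_cylinder X.emeasure_eq_measure
    by (simp add: prod_ennreal[symmetric] ennreal_mult' split: if_splits)
qed

lemma path_law:
  fixes Z :: "(int \<Rightarrow> 'a) \<Rightarrow> nat \<Rightarrow> 'a"
  assumes dep: "\<And>n. depends_on \<Xi> (C n) (\<lambda>\<xi>. Z \<xi> n)" "\<And>n. finite (C n)"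
    and cyl: "\<And>n w. emeasure \<Xi> {\<xi> \<in> space \<Xi>. \<forall>i\<le>n. Z \<xi> i = w i} = emeasure (srw_law G v) {f. \<forall>i\<le>n. f i = w i}"
    and ball: "\<And>\<xi> n. \<xi> \<in> space \<Xi> \<Longrightarrow> Z \<xi> n \<in> (\<lambda>x. v \<otimes> x) ` wball n"
  shows "Z \<in> measurable \<Xi> paths" "distr \<Xi> paths Z = srw_law G v"
proof -
  interpret X: prob_space \<Xi> by (rule prob_space_\<Xi>)
  have "(\<lambda>\<xi>. \<lambda>n\<in>UNIV. Z \<xi> n) \<in> measurable \<Xi> paths"
    by (intro measurable_restrict \<Xi>_finite_measurable[OF dep(2,1)])
  then show m: "Z \<in> measurable \<Xi> paths" by (simp only: restrict_UNIV)
  show "distr \<Xi> paths Z = srw_law G v"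
  proof (rule path_measure_eqI)
    show "prob_space (distr \<Xi> paths Z)" by (rule X.prob_space_distr[OF m])
    show "emeasure (distr \<Xi> paths Z) {f. \<forall>i\<le>n. f i = w i} = emeasure (srw_law G v) {f. \<forall>i\<le>n. f i = w i}" for n w
    proof -
      have "emeasure (distr \<Xi> paths Z) {f. \<forall>i\<le>n. f i = w i} = emeasure \<Xi> (Z -` {f. \<forall>i\<le>n. f i = w i} \<inter> space \<Xi>)"
        by (rule emeasure_distr[OF m cylinder_measurable])
      also have "Z -` {f. \<forall>i\<le>n. f i = w i} \<inter> space \<Xi> = {\<xi> \<in> space \<Xi>. \<forall>i\<le>n. Z \<xi> i = w i}" by blast
      finally show ?thesis using cyl by simp
    qed
    fix n
    let ?F = "\<Pi>\<^sub>E i\<in>{..n}. (\<lambda>x. v \<otimes> x) ` wball i"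
    have "finite ?F" by (intro finite_PiE) auto
    moreover have "AE f in distr \<Xi> paths Z. restrict f {..n} \<in> ?F"
    proof (subst AE_distr_iff[OF m])
      have "{f \<in> space paths. \<forall>i\<in>{..n}. f i \<in> (\<lambda>x. v \<otimes> x) ` wball i} \<in> sets (paths :: (nat \<Rightarrow> 'a) measure)"
        by (intro sets.sets_Collect_finite_All sets_Collect_single') auto
      moreover have "{f \<in> space paths. restrict f {..n} \<in> ?F} = {f \<in> space paths. \<forall>i\<in>{..n}. f i \<in> (\<lambda>x. v \<otimes> x) ` wball i}"
        by (auto simp: PiE_iff)
      ultimately show "{f \<in> space paths. restrict f {..n} \<in> ?F} \<in> sets (paths :: (nat \<Rightarrow> 'a) measure)" by simp
      show "AE \<xi> in \<Xi>. restrict (Z \<xi>) {..n} \<in> ?F"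
        using ball by (intro AE_I2) (auto simp: PiE_iff)
    qed
    ultimately show "\<exists>F. finite F \<and> (AE f in distr \<Xi> paths Z. restrict f {..n} \<in> F)" by blast
  qed (simp_all add: prob_space_srw_law sets_srw_law)
qed

lemma depends_forward: "depends_on \<Xi> {0..<int n} (\<lambda>\<xi>. forward \<xi> n)"
  using depends_pos[of "int n"] by (simp add: pos_def two_sided_def)

lemma depends_backward: "depends_on \<Xi> {- int n..<0} (\<lambda>\<xi>. backward \<xi> n)"
proof -
  have "pos \<xi> (- int n) = backward \<xi> n" for \<xi> by (cases "n = 0") (simp_all add: pos_def two_sided_def)
  then show ?thesis using depends_pos[of "- int n"] by simp
qed

lemma walk_ball:
  assumes "\<And>n. Z 0 = v" "\<And>n. Z (Suc n) = Z n \<otimes> l n" "\<And>n. l n \<in> S"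
  shows "Z n \<in> (\<lambda>x. v \<otimes> x) ` wball n"
proof (induction n)
  case 0
  then show ?case using assms(1) v by (intro image_eqI[of _ _ \<one>]) auto
next
  case (Suc n)
  then obtain x where x: "x \<in> wball n" "Z n = v \<otimes> x" by blast
  have "x \<otimes> l n \<in> wball (n + 1)" by (intro wball_mult x S_wball assms)
  moreover have "x \<in> V" "l n \<in> V" using x wball_sub assms(3) by blast+
  then have "Z (Suc n) = v \<otimes> (x \<otimes> l n)"
    using assms(2) x(2) v by (simp add: m_assoc)
  ultimately show ?case by (metis Suc_eq_plus1 imageI)
qed

lemma forward_law: "forward \<in> measurable \<Xi> paths" "distr \<Xi> paths forward = srw_law G v"
proof -
  have c: "emeasure \<Xi> {\<xi> \<in> space \<Xi>. \<forall>i\<le>n. forward \<xi> i = w i} = emeasure (srw_law G v) {f. \<forall>i\<le>n. f i = w i}" for n w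
    by (rule cylinder_law[where L="\<lambda>\<xi> n. \<xi> (int n)" and C="\<lambda>n. {0..<int n}" and c=int])
       (auto simp: \<xi>_in depends_forward letter_prob, auto simp: depends_on_def)
  have b: "forward \<xi> n \<in> (\<lambda>x. v \<otimes> x) ` wball n" if "\<xi> \<in> space \<Xi>" for \<xi> n
    by (rule walk_ball[where l="\<lambda>n. \<xi> (int n)"]) (use that in \<open>auto simp: \<xi>_in\<close>)
  show "forward \<in> measurable \<Xi> paths" "distr \<Xi> paths forward = srw_law G v"
    using path_law[OF depends_forward _ c b] by auto
qed

lemma backward_law: "backward \<in> measurable \<Xi> paths" "distr \<Xi> paths backward = srw_law G v"
proof -
  have pr: "walk_prob (\<lambda>\<xi>. inv (\<xi> i) = s) = 1 / card S" if s: "s \<in> S" for i s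
  proof -
    have "{\<xi> \<in> space \<Xi>. inv (\<xi> i) = s} = {\<xi> \<in> space \<Xi>. \<xi> i = inv s}"
      using s \<xi>_in by (auto intro: inv_inv[symmetric])
    then show ?thesis using letter_prob[OF S_inv[OF s], of i] by simp
  qed
  have c: "emeasure \<Xi> {\<xi> \<in> space \<Xi>. \<forall>i\<le>n. backward \<xi> i = w i} = emeasure (srw_law G v) {f. \<forall>i\<le>n. f i = w i}" for n w
    by (rule cylinder_law[where L="\<lambda>\<xi> n. inv (\<xi> (- int n - 1))" and C="\<lambda>n. {- int n..<0}" and c="\<lambda>n. - int n - 1"])
       (auto simp: \<xi>_in S_inv depends_backward pr, auto simp: depends_on_def)
  have b: "backward \<xi> n \<in> (\<lambda>x. v \<otimes> x) ` wball n" if "\<xi> \<in> space \<Xi>" for \<xi> n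
    by (rule walk_ball[where l="\<lambda>n. inv (\<xi> (- int n - 1))"]) (use that in \<open>auto simp: \<xi>_in S_inv\<close>)
  show "backward \<in> measurable \<Xi> paths" "distr \<Xi> paths backward = srw_law G v"
    using path_law[OF depends_backward _ c b] by auto
qed

text \<open>The two one-sided walks use disjoint sets of increments.\<close>

lemma two_srw_law_eq:
  "two_srw_law G v v = distr \<Xi> (paths \<Otimes>\<^sub>M paths) (\<lambda>\<xi>. (forward \<xi>, backward \<xi>))"
  unfolding two_srw_law_def
proof (rule pair_measure_eqI)
  interpret S: prob_space "srw_law G v" by (rule prob_space_srw_law)
  show "sigma_finite_measure (srw_law G v)" by unfold_locales
  then show "sigma_finite_measure (srw_law G v)" .
  show "sets (srw_law G v \<Otimes>\<^sub>M srw_law G v) = sets (distr \<Xi> (paths \<Otimes>\<^sub>M paths) (\<lambda>\<xi>. (forward \<xi>, backward \<xi>)))"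
    by (simp add: sets_srw_law cong: sets_pair_measure_cong)
  interpret X: prob_space \<Xi> by (rule prob_space_\<Xi>)
  fix A B assume "A \<in> sets (srw_law G v)" "B \<in> sets (srw_law G v)"
  then have AB: "A \<in> sets paths" "B \<in> sets paths" by (simp_all add: sets_srw_law)
  have mp: "(\<lambda>\<xi>. (forward \<xi>, backward \<xi>)) \<in> measurable \<Xi> (paths \<Otimes>\<^sub>M paths)"
    by (intro measurable_Pair forward_law backward_law)
  have pA: "Measurable.pred \<Xi> (\<lambda>\<xi>. forward \<xi> \<in> A)" and pB: "Measurable.pred \<Xi> (\<lambda>\<xi>. backward \<xi> \<in> B)"
    using measurable_sets[OF forward_law(1) AB(1)] measurable_sets[OF backward_law(1) AB(2)]
    by (auto simp: pred_def vimage_def Int_def conj_commute)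
  have dA: "depends_on \<Xi> {0..} (\<lambda>\<xi>. forward \<xi> \<in> A)"
  proof (rule depends_onI)
    fix \<xi> \<xi>' assume a: "\<xi> \<in> space \<Xi>" "\<xi>' \<in> space \<Xi>" "\<And>i. i \<in> {0..} \<Longrightarrow> \<xi> i = \<xi>' i"
    have "forward \<xi> = forward \<xi>'"
    proof
      show "forward \<xi> n = forward \<xi>' n" for n by (rule depends_onD[OF depends_forward a(1,2)]) (use a(3) in auto)
    qed
    then show "(forward \<xi> \<in> A) = (forward \<xi>' \<in> A)" by simp
  qed
  have dB: "depends_on \<Xi> {..<0} (\<lambda>\<xi>. backward \<xi> \<in> B)"
  proof (rule depends_onI)
    fix \<xi> \<xi>' assume a: "\<xi> \<in> space \<Xi>" "\<xi>' \<in> space \<Xi>" "\<And>i. i \<in> {..<0} \<Longrightarrow> \<xi> i = \<xi>' i"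
    have "backward \<xi> = backward \<xi>'"
    proof
      show "backward \<xi> n = backward \<xi>' n" for n by (rule depends_onD[OF depends_backward a(1,2)]) (use a(3) in auto)
    qed
    then show "(backward \<xi> \<in> B) = (backward \<xi>' \<in> B)" by simp
  qed
  have eA: "emeasure (srw_law G v) A = ennreal (walk_prob (\<lambda>\<xi>. forward \<xi> \<in> A))"
    unfolding forward_law(2)[symmetric] emeasure_distr[OF forward_law(1) AB(1)] X.emeasure_eq_measure
    by (intro arg_cong[where f=ennreal] arg_cong2[where f=measure] refl) blast
  have eB: "emeasure (srw_law G v) B = ennreal (walk_prob (\<lambda>\<xi>. backward \<xi> \<in> B))"
    unfolding backward_law(2)[symmetric] emeasure_distr[OF backward_law(1) AB(2)] X.emeasure_eq_measure
    by (intro arg_cong[where f=ennreal] arg_cong2[where f=measure] refl) blast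
  have "emeasure (distr \<Xi> (paths \<Otimes>\<^sub>M paths) (\<lambda>\<xi>. (forward \<xi>, backward \<xi>))) (A \<times> B) =
      emeasure \<Xi> ((\<lambda>\<xi>. (forward \<xi>, backward \<xi>)) -` (A \<times> B) \<inter> space \<Xi>)"
    using AB by (intro emeasure_distr[OF mp]) auto
  also have "(\<lambda>\<xi>. (forward \<xi>, backward \<xi>)) -` (A \<times> B) \<inter> space \<Xi> = {\<xi> \<in> space \<Xi>. forward \<xi> \<in> A \<and> backward \<xi> \<in> B}" by blast
  also have "emeasure \<Xi> \<dots> = ennreal (walk_prob (\<lambda>\<xi>. forward \<xi> \<in> A) * walk_prob (\<lambda>\<xi>. backward \<xi> \<in> B))"
    unfolding X.emeasure_eq_measure
    by (intro arg_cong[where f=ennreal] \<Xi>_indep[OF _ pA dA pB dB]) auto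
  finally show "emeasure (srw_law G v) A * emeasure (srw_law G v) B =
      emeasure (distr \<Xi> (paths \<Otimes>\<^sub>M paths) (\<lambda>\<xi>. (forward \<xi>, backward \<xi>))) (A \<times> B)"
    unfolding eA eB by (simp add: ennreal_mult)
qed

lemma pred_two_sided:
  "(\<lambda>x. two_sided (fst (fst x)) (snd (fst x)) k) \<in> measurable ((paths \<Otimes>\<^sub>M paths) \<Otimes>\<^sub>M perc p) (count_space (UNIV :: 'a set))"
proof -
  have ev: "(\<lambda>f. f i) \<in> measurable paths (count_space (UNIV :: 'a set))" for i :: nat
    by (rule measurable_component_singleton) simp
  show ?thesis
  proof (cases "k \<ge> 0")
    case True
    have "(\<lambda>x. fst (fst x) (nat k)) \<in> measurable ((paths \<Otimes>\<^sub>M paths) \<Otimes>\<^sub>M perc p) (count_space (UNIV :: 'a set))"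
      by (rule measurable_compose[OF measurable_compose[OF measurable_fst measurable_fst] ev])
    then show ?thesis using True by (simp add: two_sided_def)
  next
    case False
    have "(\<lambda>x. snd (fst x) (nat (- k))) \<in> measurable ((paths \<Otimes>\<^sub>M paths) \<Otimes>\<^sub>M perc p) (count_space (UNIV :: 'a set))"
      by (rule measurable_compose[OF measurable_compose[OF measurable_fst measurable_snd] ev])
    then show ?thesis using False by (simp add: two_sided_def)
  qed
qed

text \<open>Trajectories may leave the group here, but \<open>R\<close> only holds between group elements, of which there are
countably many.\<close>

lemma pred_two_sided_rel:
  assumes R: "\<And>x y. x \<in> V \<Longrightarrow> y \<in> V \<Longrightarrow> Measurable.pred (perc p) (R x y)"
    and RV: "\<And>x y \<omega>. R x y \<omega> \<Longrightarrow> x \<in> V \<and> y \<in> V"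
  shows "Measurable.pred ((paths \<Otimes>\<^sub>M paths) \<Otimes>\<^sub>M perc p)
    (\<lambda>x. R (two_sided (fst (fst x)) (snd (fst x)) i) (two_sided (fst (fst x)) (snd (fst x)) j) (snd x))"
proof -
  have "Measurable.pred ((paths \<Otimes>\<^sub>M paths) \<Otimes>\<^sub>M perc p)
    (\<lambda>x. \<exists>a\<in>V. \<exists>b\<in>V. (two_sided (fst (fst x)) (snd (fst x)) i = a \<and> two_sided (fst (fst x)) (snd (fst x)) j = b) \<and> R a b (snd x))"
  proof (intro pred_countable_Bex countable_V pred_intros_logic(3))
    fix a b assume ab: "a \<in> V" "b \<in> V"
    show "Measurable.pred ((paths \<Otimes>\<^sub>M paths) \<Otimes>\<^sub>M perc p) (\<lambda>x. two_sided (fst (fst x)) (snd (fst x)) i = a)"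
      by (rule measurable_compose[OF pred_two_sided]) simp
    show "Measurable.pred ((paths \<Otimes>\<^sub>M paths) \<Otimes>\<^sub>M perc p) (\<lambda>x. two_sided (fst (fst x)) (snd (fst x)) j = b)"
      by (rule measurable_compose[OF pred_two_sided]) simp
    show "Measurable.pred ((paths \<Otimes>\<^sub>M paths) \<Otimes>\<^sub>M perc p) (\<lambda>x. R a b (snd x))"
      by (rule measurable_compose[OF measurable_snd R[OF ab]])
  qed
  moreover have "(\<lambda>x. \<exists>a\<in>V. \<exists>b\<in>V. (two_sided (fst (fst x)) (snd (fst x)) i = a \<and> two_sided (fst (fst x)) (snd (fst x)) j = b) \<and> R a b (snd x))
     = (\<lambda>x. R (two_sided (fst (fst x)) (snd (fst x)) i) (two_sided (fst (fst x)) (snd (fst x)) j) (snd x))"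
    using RV by (intro ext) blast
  ultimately show ?thesis by simp
qed

text \<open>Transferring an almost sure statement along a distribution requires a measurable event. The transfer
is therefore made for the existence of infinitely many cut times, and cut points are derived pointwise afterwards.\<close>

theorem cut_points_walk:
  assumes p: "0 \<le> p" "p < 1"
    and b: "\<And>n x. x \<in> V \<Longrightarrow> heat_kernel n x \<le> b n" "\<And>n. 0 \<le> b n" "summable (\<lambda>n. (real n + 1) * b n)"
    and C: "0 \<le> C" "\<And>x Y. x \<in> V \<Longrightarrow> finite Y \<Longrightarrow> Y \<subseteq> V \<Longrightarrow> (\<Sum>y\<in>Y. \<tau> p V x y) \<le> C"
  shows "AE ((s1, s2), \<omega>) in two_srw_law G v v \<Otimes>\<^sub>M perc p.
    infinite {x. cut_point (enlargement G \<omega> (walk_trace (two_sided s1 s2))) x}"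
proof -
  interpret P: prob_space "perc p" by (rule prob_space_perc)
  let ?N = "(paths \<Otimes>\<^sub>M paths) \<Otimes>\<^sub>M perc p"
  let ?f = "\<lambda>(\<xi>, \<omega>). ((forward \<xi>, backward \<xi>), \<omega>)"
  let ?s = "\<lambda>x. two_sided (fst (fst x)) (snd (fst x))"
  have mp: "(\<lambda>\<xi>. (forward \<xi>, backward \<xi>)) \<in> measurable \<Xi> (paths \<Otimes>\<^sub>M paths)"
    by (intro measurable_Pair forward_law backward_law)
  have mf: "?f \<in> measurable (joint p) ?N"
    unfolding joint_def case_prod_unfold
    by (intro measurable_Pair measurable_snd measurable_compose[OF measurable_fst] forward_law backward_law)
  have law: "two_srw_law G v v \<Otimes>\<^sub>M perc p = distr (joint p) ?N ?f"
  proof -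
    have "distr \<Xi> (paths \<Otimes>\<^sub>M paths) (\<lambda>\<xi>. (forward \<xi>, backward \<xi>)) \<Otimes>\<^sub>M distr (perc p) (perc p) (\<lambda>\<omega>. \<omega>) =
        distr (\<Xi> \<Otimes>\<^sub>M perc p) ?N (\<lambda>(\<xi>, \<omega>). ((forward \<xi>, backward \<xi>), \<omega>))"
      by (intro pair_measure_distr mp measurable_ident_sets refl)
         (simp add: distr_id P.sigma_finite_measure_axioms)
    then show ?thesis by (simp add: two_srw_law_eq distr_id joint_def)
  qed
  let ?P = "\<lambda>x. (\<forall>k. {?s x k, ?s x (k + 1)} \<in> E) \<and> infinite {n. cut_time (\<lambda>k. ?s x (int n + k)) (snd x)}
      \<and> infinite {n. cut_time (\<lambda>k. ?s x (- int n + k)) (snd x)}"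
  have pc: "Measurable.pred ?N (\<lambda>x. cut_time (\<lambda>k. ?s x (n + k)) (snd x))" for n
    unfolding cut_time_def
    by (intro pred_intros_countable pred_intros_logic pred_two_sided_rel[where R="\<lambda>x y \<omega>. conn \<omega> V x y"] pred_conn)
       (auto dest: conn_in)
  have pe: "Measurable.pred ?N (\<lambda>x. {?s x k, ?s x (k + 1)} \<in> E)" for k
    by (rule pred_two_sided_rel[where R="\<lambda>x y \<omega>. {x, y} \<in> E"]) (auto dest: edge_verts)
  have pP: "Measurable.pred ?N ?P"
    unfolding infinite_nat_iff_unbounded_le mem_Collect_eq
    by (intro pred_intros_logic pred_intros_countable pc pe) auto
  have "AE x in joint p. ?P (?f x)"
  proof -
    have 1: "AE x in joint p. infinite {n. cut_time (\<lambda>k. pos (fst x) (int n + k)) (snd x)}"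
      by (rule infinitely_many_cuts[OF p b C disjI1[OF refl]])
    have 2: "AE x in joint p. infinite {n. cut_time (\<lambda>k. pos (fst x) (- int n + k)) (snd x)}"
      by (rule infinitely_many_cuts[OF p b C disjI2[OF refl]])
    show ?thesis
      using 1 2 AE_space
    proof eventually_elim
      case (elim x)
      have \<xi>: "fst x \<in> space \<Xi>" using elim(3) by (auto simp: space_joint)
      have s: "?s (?f x) = pos (fst x)" by (simp add: pos_def case_prod_unfold)
      have "{pos (fst x) k, pos (fst x) (k + 1)} \<in> E" for k
        using edge_mult[OF pos_in[OF \<xi>] \<xi>_in[OF \<xi>]] by (simp add: pos_step[OF \<xi>])
      moreover have "snd (?f x) = snd x" by (simp add: case_prod_unfold)
      ultimately show ?case unfolding s using elim(1,2) by simp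
    qed
  qed
  then have "AE x in two_srw_law G v v \<Otimes>\<^sub>M perc p. ?P x"
    unfolding law by (subst AE_distr_iff[OF mf predE[OF pP]])
  then show ?thesis
  proof eventually_elim
    case (elim x)
    have "?s x k \<in> V" for k using elim edge_verts by blast
    then have "infinite {y. cut_point (enlargement G (snd x) (walk_trace (?s x))) y}"
      using elim by (intro infinitely_many_cut_points) auto
    then show ?case by (simp add: case_prod_unfold)
  qed
qed

end

section \<open>Volume growth\<close>

context cayley
begin

lemma graph_ball_sub: "x \<in> V \<Longrightarrow> graph_ball G x n \<subseteq> (\<lambda>y. x \<otimes> y) ` wball n"
proof
  fix y assume x: "x \<in> V" and "y \<in> graph_ball G x n"
  then have d: "graph_dist G x y \<le> enat n" by (simp add: graph_ball_def)
  let ?A = "(\<lambda>ws. enat (length ws - 1)) ` {ws. walk G x ws y}"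
  have "?A \<noteq> {}"
  proof
    assume "?A = {}"
    then have "graph_dist G x y = \<infinity>" unfolding graph_dist_def by (simp add: top_enat_def)
    then show False using d by simp
  qed
  then have "Inf ?A \<in> ?A" by (meson all_not_in_conv wellorder_InfI)
  then obtain ws where ws: "walk G x ws y" "enat (length ws - 1) = graph_dist G x y"
    unfolding graph_dist_def by auto
  have len: "length ws - 1 \<le> n" using d ws(2) by (metis enat_ord_simps(1))
  have "walk G x ws y \<Longrightarrow> y \<in> (\<lambda>y. x \<otimes> y) ` wball (length ws - 1)" for ws y
  proof (induction ws arbitrary: y rule: rev_induct)
    case Nil then show ?case by (simp add: walk_def)
  next
    case (snoc z ws)
    show ?case
    proof (cases "ws = []")
      case True
      then show ?thesis using snoc.prems x by (auto simp: walk_def intro!: image_eqI[of _ _ \<one>])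
    next
      case False
      then have w: "walk G x ws (last ws)" "{last ws, z} \<in> E" "y = z"
        using snoc.prems by (auto simp: walk_def successively_append_iff)
      obtain g where g: "g \<in> wball (length ws - 1)" "last ws = x \<otimes> g" using snoc.IH[OF w(1)] by blast
      obtain s where s: "s \<in> S" "z = last ws \<otimes> s" using w(2) by (auto simp: edge_iff)
      have "g \<otimes> s \<in> wball (length ws - 1 + 1)" by (intro wball_mult g S_wball s)
      moreover have "length ws - 1 + 1 = length (ws @ [z]) - 1" using False by (cases ws) auto
      moreover have "g \<in> V" "s \<in> V" using g(1) s(1) wball_sub by blast+
      then have "y = x \<otimes> (g \<otimes> s)" using w(3) s(2) g(2) x by (simp add: m_assoc)
      ultimately show ?thesis by auto
    qed
  qed
  from this[OF ws(1)] show "y \<in> (\<lambda>y. x \<otimes> y) ` wball n" using wball_mono[OF len] by blast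
qed

text \<open>The limit inferior bounds the volume of large balls from below; small radii are covered by lowering the constant,
since balls are not empty.\<close>

lemma growth_lower_bound:
  assumes d: "degree_of_growth G d" "5 \<le> d" and v: "v \<in> V"
  obtains c where "c > 0" "\<And>m. m \<ge> 1 \<Longrightarrow> c * real m ^ 5 \<le> card (wball m)"
proof -
  have "0 < liminf (\<lambda>n. ereal (real (card (graph_ball G v n)) / real n powr d))"
    using d v by (simp add: degree_of_growth_def)
  then obtain c0 where c0: "0 < c0" "c0 < liminf (\<lambda>n. ereal (real (card (graph_ball G v n)) / real n powr d))"
    using dense by blast
  obtain c1 :: real where c1: "0 < c1" "ereal c1 \<le> c0"
  proof (cases c0)
    case (real r) then show ?thesis using that[of r] c0 by simp
  next
    case PInf then show ?thesis using that[of 1] by simp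
  next
    case MInf then show ?thesis using c0 by simp
  qed
  have "eventually (\<lambda>n. c0 < ereal (real (card (graph_ball G v n)) / real n powr d)) sequentially"
    using less_LiminfD[OF c0(2)] .
  then obtain N where N: "\<And>n. N \<le> n \<Longrightarrow> c0 < ereal (real (card (graph_ball G v n)) / real n powr d)"
    by (auto simp: eventually_sequentially)
  define M where "M = max N 1"
  define c where "c = min c1 (1 / real M ^ 5)"
  have M: "1 \<le> M" "N \<le> M" by (auto simp: M_def)
  have c: "0 < c" using c1 M by (auto simp: c_def)
  have "c * real m ^ 5 \<le> card (wball m)" if m: "m \<ge> 1" for m
  proof (cases "m \<ge> M")
    case True
    have "ereal c1 < ereal (real (card (graph_ball G v m)) / real m powr d)"
      using True M by (intro le_less_trans[OF c1(2) N]) simp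
    then have "c1 < real (card (graph_ball G v m)) / real m powr d" by simp
    then have "c1 * real m powr d \<le> real (card (graph_ball G v m))"
      using m by (simp add: pos_less_divide_eq less_imp_le)
    moreover have "real m ^ 5 \<le> real m powr d"
    proof -
      have "real m ^ 5 = real m powr 5" by (simp add: powr_numeral)
      also have "\<dots> \<le> real m powr d" using m d by (intro powr_mono) auto
      finally show ?thesis .
    qed
    moreover have "c * real m ^ 5 \<le> c1 * real m powr d"
      using calculation(2) c c1 by (intro mult_mono) (auto simp: c_def)
    moreover have "card (graph_ball G v m) \<le> card (wball m)"
    proof -
      have "card (graph_ball G v m) \<le> card ((\<lambda>y. v \<otimes> y) ` wball m)"
        using graph_ball_sub[OF v] by (intro card_mono) auto
      also have "\<dots> \<le> card (wball m)" by (intro card_image_le) simp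
      finally show ?thesis .
    qed
    ultimately show ?thesis by linarith
  next
    case False
    have "c * real m ^ 5 \<le> 1 / real M ^ 5 * real M ^ 5"
      using False c by (intro mult_mono power_mono) (auto simp: c_def)
    also have "\<dots> = 1" using M by simp
    also have "\<dots> \<le> card (wball m)"
    proof -
      have "wball m \<noteq> {}" using one_wball by blast
      then have "0 < card (wball m)" unfolding card_gt_0_iff by simp
      then show ?thesis by simp
    qed
    finally show ?thesis .
  qed
  then show ?thesis using that c by blast
qed

lemma infinite_of_growth:
  assumes c: "c > 0" "\<And>m. m \<ge> 1 \<Longrightarrow> c * real m ^ 5 \<le> card (wball m)"
  shows "infinite V"
proof
  assume fin: "finite V"
  obtain m :: nat where m: "card V / c < real m" using reals_Archimedean2 by blast
  have m1: "1 \<le> m" using m c by (cases m) (auto simp: divide_less_0_iff)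
  have "real m * 1 \<le> real m * real m ^ 4" using m1 by (intro mult_left_mono) auto
  then have "c * real m \<le> c * real m ^ 5" using c by (simp add: power_eq_if)
  also have "\<dots> \<le> card (wball m)" using c m1 by blast
  also have "\<dots> \<le> card V" using wball_sub fin by (simp add: card_mono)
  finally have "real m \<le> card V / c" using c by (simp add: pos_le_divide_eq mult.commute)
  then show False using m by simp
qed

end

theorem theorem1p7:
  fixes \<Gamma> :: "('a, 'b) monoid_scheme" and S :: "'a set" and d p :: real and v :: 'a
  assumes "group \<Gamma>"
    and "S \<subseteq> carrier \<Gamma>" and "finite S" and "\<And>s. s \<in> S \<Longrightarrow> inv\<^bsub>\<Gamma>\<^esub> s \<in> S" and "\<one>\<^bsub>\<Gamma>\<^esub> \<notin> S"
    and "generate \<Gamma> S = carrier \<Gamma>"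
    and "degree_of_growth (cayley_graph \<Gamma> S) d" and "d \<ge> 5"
    and "v \<in> carrier \<Gamma>"
    and "0 \<le> p" and "p < critical_prob (cayley_graph \<Gamma> S) v"
  shows "AE ((s1, s2), \<omega>) in two_srw_law (cayley_graph \<Gamma> S) v v \<Otimes>\<^sub>M percolation (cayley_graph \<Gamma> S) p.
    infinite {x. cut_point (enlargement (cayley_graph \<Gamma> S) \<omega> (walk_trace (two_sided s1 s2))) x}"
proof -
  interpret cayley \<Gamma> S
    by (intro cayley.intro cayley_axioms.intro) (fact assms)+
  obtain c where c: "c > 0" "\<And>m. m \<ge> 1 \<Longrightarrow> c * real m ^ 5 \<le> card (wball m)"
    using growth_lower_bound[OF assms(7,8,9)] by blast
  have inf: "infinite (carrier \<Gamma>)" by (rule infinite_of_growth[OF c])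
  have S_ne: "S \<noteq> {}"
  proof
    assume S: "S = {}"
    have "wball n \<subseteq> {\<one>\<^bsub>\<Gamma>\<^esub>}" for n
    proof
      fix x assume "x \<in> wball n"
      then obtain w where "x = wprod w" "set w \<subseteq> S" by (auto simp: wball_def)
      moreover from this have "w = []" using S by simp
      ultimately show "x \<in> {\<one>\<^bsub>\<Gamma>\<^esub>}" by simp
    qed
    then have "carrier \<Gamma> \<subseteq> {\<one>\<^bsub>\<Gamma>\<^esub>}" unfolding V_eq by blast
    then show False using inf finite_subset by blast
  qed
  interpret cayley_walk \<Gamma> S v
    by unfold_locales (fact assms(9) S_ne)+
  obtain C where C: "p < 1" "0 \<le> C" "\<And>x Y. x \<in> carrier \<Gamma> \<Longrightarrow> finite Y \<Longrightarrow> Y \<subseteq> carrier \<Gamma> \<Longrightarrow>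
      (\<Sum>y\<in>Y. \<tau> p (carrier \<Gamma>) x y) \<le> C"
    using subcritical_susceptibility[OF inf assms(9,10,11)] by blast
  obtain b where b: "\<And>n x. x \<in> carrier \<Gamma> \<Longrightarrow> heat_kernel n x \<le> b n" "\<And>n. 0 \<le> b n" "summable (\<lambda>n. (real n + 1) * b n)"
    using heat_kernel_decay[OF S_ne c] by blast
  show ?thesis by (rule cut_points_walk[OF assms(10) C(1) b C(2,3)])
qed

end
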